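(* Let $\mathfrak g$ be simple, $(G,H)$ a symmetric pair with $H/L\to G/K$ a holomorphic immersion, and $(\tau,W)$ the lowest $K$-type of a holomorphic discrete series of $G$. Assume that $\mathcal V^{(1)}\cap\mathcal L_{W,H}^c=\mathcal V^{(1)}\cap\mathcal U(\mathfrak h_0)W$. Then $\mathcal L_{W,H}^c=\mathcal U(\mathfrak h_0)W$ if and only if $[[\mathfrak p_{\mathfrak h_0}^+,\mathfrak p_{\mathfrak h}^-],\mathfrak p_{\mathfrak h_0}^+]=\{0\}$.
   Context: Setting. $G$ is a connected, simple, noncompact matrix Lie group with maximal compact subgroup $K$ and Cartan involution $\theta$; $G/K$ carries a $G$-invariant complex structure (bounded symmetric domain). $\iota$ is an involution of $G$ commuting with $\theta$, with $\iota\neq \mathrm{id}$ and $\iota\neq\theta$; $H=(G^{\iota})_0$, $H_0=(G^{\iota\theta})_0$ (associated subgroup), $L=K\cap H$. Lie algebras are $\mathfrak g,\mathfrak k,\mathfrak h,\mathfrak h_0,\mathfrak l$; the same letters also denote complexifications. Write $\mathfrak g=\mathfrak k+\mathfrak p$ and $\mathfrak p_{\mathbb C}=\mathfrak p^+\oplus\mathfrak p^-$ for the $Ad(K)$-invariant decomposition given by the complex structure ($\mathfrak p^\pm$ abelian, conjugate to each other). The inclusion $H/L\to G/K$ is holomorphic, so with $\mathfrak p_{\mathfrak h}^{\pm}=\mathfrak p^\pm\cap\mathfrak h_{\mathbb C}$ and $\mathfrak p_{\mathfrak h_0}^{\pm}=\mathfrak p^\pm\cap(\mathfrak h_0)_{\mathbb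 C}$ one has $\mathfrak p^\pm=\mathfrak p_{\mathfrak h}^\pm\oplus\mathfrak p_{\mathfrak h_0}^\pm$. Extending $\tau$ by zero to $\mathfrak p^+$, the $K$-finite vectors of the holomorphic discrete series are identified with $M=\mathcal U(\mathfrak g)\otimes_{\mathcal U(\mathfrak k_{\mathbb C}+\mathfrak p^+)}W$; $[D\otimes w]$ is the class of $D\otimes w$, $L^\tau$ the action of $\mathcal U(\mathfrak g)$ on $M$. Put $\mathcal V^{(n)}=\mathrm{span}\{[x_1\cdots x_n\otimes w]:x_i\in\mathfrak p^-,w\in W\}$, $\mathcal U(\mathfrak h_0)W=\mathrm{span}\{L^\tau_D [1\otimes w]: D\in\mathcal U(\mathfrak h_0),w\in W\}$, and $\mathcal L_{W,H}^c=\{v\in M: L_X^\tau v=0\ \forall X\in\mathfrak p_{\mathfrak h}^+\}$ (equal to the sum of the lowest $L$-types of all irreducible $H$-factors of the restriction to $H$). *)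

theory Defs
  imports "HOL-Analysis.Analysis" "HOL-Library.Poly_Mapping"
begin

section \<open>Matrix Lie groups and their Lie algebras\<close>

text \<open>
  A matrix Lie group is a closed subgroup of some \<open>GL(n, \<real>)\<close>; complex matrix groups are covered
  through \<open>GL(n, \<complex>) \<subseteq> GL(2n, \<real>)\<close>. With real matrices the complexification of a
  Lie algebra \<open>\<gg>\<close> is simply \<open>\<gg> + i\<gg>\<close> inside the complex matrices.
\<close>

type_synonym 'n rmat = "real^'n^'n"
type_synonym 'n cmat = "complex^'n^'n"

definition matrix_subgroup :: "'n::finite rmat set \<Rightarrow> bool" where
  "matrix_subgroup G \<longleftrightarrow>
     (\<forall>g\<in>G. invertible g) \<and> mat 1 \<in> G \<and>
     (\<forall>g\<in>G. \<forall>h\<in>G. g ** h \<in> G) \<and> (\<forall>g\<in>G. matrix_inv g \<in> G)"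

definition matrix_lie_group :: "'n::finite rmat set \<Rightarrow> bool" where
  "matrix_lie_group G \<longleftrightarrow>
     matrix_subgroup G \<and> closedin (top_of_set {A. invertible A}) G"

text \<open>The multiplication of the type \<^typ>\<open>real^'n^'n\<close> is entrywise, so the matrix exponential
  is not the library's \<^const>\<open>exp\<close>.\<close>

definition mexp :: "'n::finite rmat \<Rightarrow> 'n rmat" where
  "mexp A = suminf (\<lambda>k. (1 / fact k) *\<^sub>R (((**) A ^^ k) (mat 1)))"

definition lie_algebra :: "'n::finite rmat set \<Rightarrow> 'n rmat set" where
  "lie_algebra G = {X. \<forall>t::real. mexp (t *\<^sub>R X) \<in> G}"

definition brk :: "'a::ring_1^'n::finite^'n \<Rightarrow> 'a^'n^'n \<Rightarrow> 'a^'n^'n" where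
  "brk X Y = X ** Y - Y ** X"

text \<open>\<open>[A, B]\<close> for linear subspaces. It is used for complex subspaces only, where the real span
  of the brackets is already a complex subspace.\<close>

definition brk_space :: "'n::finite cmat set \<Rightarrow> 'n cmat set \<Rightarrow> 'n cmat set" where
  "brk_space A B = span {brk X Y | X Y. X \<in> A \<and> Y \<in> B}"

definition simple_lie_algebra :: "'n::finite rmat set \<Rightarrow> bool" where
  "simple_lie_algebra \<gg> \<longleftrightarrow>
     (\<exists>X\<in>\<gg>. \<exists>Y\<in>\<gg>. brk X Y \<noteq> 0) \<and>
     (\<forall>\<aa>. subspace \<aa> \<and> \<aa> \<subseteq> \<gg> \<and> (\<forall>X\<in>\<gg>. \<forall>Y\<in>\<aa>. brk X Y \<in> \<aa>) \<longrightarrow> \<aa> = {0} \<or> \<aa> = \<gg>)"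

definition maximal_compact_subgroup :: "'n::finite rmat set \<Rightarrow> 'n rmat set \<Rightarrow> bool" where
  "maximal_compact_subgroup K G \<longleftrightarrow>
     matrix_subgroup K \<and> compact K \<and> K \<subseteq> G \<and>
     (\<forall>K'. matrix_subgroup K' \<and> compact K' \<and> K \<subseteq> K' \<and> K' \<subseteq> G \<longrightarrow> K' = K)"

text \<open>Continuous homomorphisms between matrix Lie groups are automatically smooth.\<close>

definition involutive_automorphism :: "'n::finite rmat set \<Rightarrow> ('n rmat \<Rightarrow> 'n rmat) \<Rightarrow> bool" where
  "involutive_automorphism G \<sigma> \<longleftrightarrow>
     \<sigma> ` G \<subseteq> G \<and> continuous_on G \<sigma> \<and>
     (\<forall>g\<in>G. \<forall>h\<in>G. \<sigma> (g ** h) = \<sigma> g ** \<sigma> h) \<and> (\<forall>g\<in>G. \<sigma> (\<sigma> g) = g)"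

definition fixed_points :: "'n::finite rmat set \<Rightarrow> ('n rmat \<Rightarrow> 'n rmat) \<Rightarrow> 'n rmat set" where
  "fixed_points G \<sigma> = {g \<in> G. \<sigma> g = g}"

definition identity_component :: "'n::finite rmat set \<Rightarrow> 'n rmat set" where
  "identity_component G = connected_component_set G (mat 1)"

definition differential :: "('n::finite rmat \<Rightarrow> 'b::real_normed_vector) \<Rightarrow> 'n rmat \<Rightarrow> 'b" where
  "differential \<sigma> X = vector_derivative (\<lambda>t. \<sigma> (mexp (t *\<^sub>R X))) (at 0)"

definition trace_on :: "'a::real_vector set \<Rightarrow> ('a \<Rightarrow> 'a) \<Rightarrow> real" where
  "trace_on V f =
     (let B = (SOME B. B \<subseteq> V \<and> independent B \<and> span B = V)
      in \<Sum>b\<in>B. representation B (f b) b)"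

definition killing_form :: "'n::finite rmat set \<Rightarrow> 'n rmat \<Rightarrow> 'n rmat \<Rightarrow> real" where
  "killing_form \<gg> X Y = trace_on \<gg> (\<lambda>Z. brk X (brk Y Z))"

definition cartan_involution :: "'n::finite rmat set \<Rightarrow> ('n rmat \<Rightarrow> 'n rmat) \<Rightarrow> bool" where
  "cartan_involution G \<theta> \<longleftrightarrow>
     involutive_automorphism G \<theta> \<and>
     (\<forall>X \<in> lie_algebra G. X \<noteq> 0 \<longrightarrow> - killing_form (lie_algebra G) X (differential \<theta> X) > 0)"

definition cartan_p :: "'n::finite rmat set \<Rightarrow> ('n rmat \<Rightarrow> 'n rmat) \<Rightarrow> 'n rmat set" where
  "cartan_p G \<theta> = {X \<in> lie_algebra G. differential \<theta> X = - X}"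

section \<open>Complexification and invariant complex structures\<close>

definition of_real_mat :: "'n::finite rmat \<Rightarrow> 'n cmat" where
  "of_real_mat A = (\<chi> i j. of_real (A $ i $ j))"

definition scale_mat :: "complex \<Rightarrow> 'n::finite cmat \<Rightarrow> 'n cmat" where
  "scale_mat c A = (\<chi> i j. c * A $ i $ j)"

definition complexify :: "'n::finite rmat set \<Rightarrow> 'n cmat set" where
  "complexify V = {of_real_mat X + scale_mat \<i> (of_real_mat Y) | X Y. X \<in> V \<and> Y \<in> V}"

definition complexify_map :: "('n::finite rmat \<Rightarrow> 'm::finite cmat) \<Rightarrow> 'n cmat \<Rightarrow> 'm cmat" where
  "complexify_map f Z = f (\<chi> i j. Re (Z $ i $ j)) + scale_mat \<i> (f (\<chi> i j. Im (Z $ i $ j)))"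

text \<open>
  The tangent space of \<open>G/K\<close> at the base point is \<open>\<pp>\<close>, with \<open>K\<close> acting by \<open>Ad\<close>; a \<open>G\<close>-invariant
  almost complex structure on \<open>G/K\<close> is the same as an \<open>Ad(K)\<close>-invariant \<open>J\<close> on \<open>\<pp>\<close> with
  \<open>J\<^sup>2 = -1\<close>. On a symmetric space it is automatically integrable, because \<open>[\<pp>, \<pp>] \<subseteq> \<kk>\<close>.
  In the following definition \<open>V\<close> is the tangent space and \<open>S\<close> the isotropy group.
\<close>

definition invariant_complex_structure ::
    "'n::finite rmat set \<Rightarrow> 'n rmat set \<Rightarrow> ('n rmat \<Rightarrow> 'n rmat) \<Rightarrow> bool" where
  "invariant_complex_structure V S J \<longleftrightarrow>
     (\<forall>X\<in>V. J X \<in> V \<and> J (J X) = - X) \<and>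
     (\<forall>X\<in>V. \<forall>Y\<in>V. \<forall>a b. J (a *\<^sub>R X + b *\<^sub>R Y) = a *\<^sub>R J X + b *\<^sub>R J Y) \<and>
     (\<forall>k\<in>S. \<forall>X\<in>V. J (k ** X ** matrix_inv k) = k ** J X ** matrix_inv k)"

definition p_plus :: "'n::finite rmat set \<Rightarrow> ('n rmat \<Rightarrow> 'n rmat) \<Rightarrow> 'n cmat set" where
  "p_plus \<pp> J = {of_real_mat X - scale_mat \<i> (of_real_mat (J X)) | X. X \<in> \<pp>}"

definition p_minus :: "'n::finite rmat set \<Rightarrow> ('n rmat \<Rightarrow> 'n rmat) \<Rightarrow> 'n cmat set" where
  "p_minus \<pp> J = {of_real_mat X + scale_mat \<i> (of_real_mat (J X)) | X. X \<in> \<pp>}"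

text \<open>
  Holomorphy of the inclusion of \<open>H/L\<close> into \<open>G/K\<close>: there is an \<open>H\<close>-invariant complex structure on
  \<open>H/L\<close> for which the differential at the base point, the inclusion of \<open>\<pp> \<inter> \<hh>\<close> into \<open>\<pp>\<close>, is
  complex linear. At the other points this follows by invariance.
\<close>

definition holomorphic_immersion ::
    "'n::finite rmat set \<Rightarrow> 'n rmat set \<Rightarrow> 'n rmat set \<Rightarrow> ('n rmat \<Rightarrow> 'n rmat) \<Rightarrow> bool" where
  "holomorphic_immersion \<pp> \<hh> L J \<longleftrightarrow>
     (\<exists>J\<^sub>H. invariant_complex_structure (\<pp> \<inter> \<hh>) L J\<^sub>H \<and> (\<forall>X \<in> \<pp> \<inter> \<hh>. J X = J\<^sub>H X))"

section \<open>Unitary representations and the discrete series\<close>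

text \<open>A complex Hilbert space is a real one with a compatible complex scalar multiplication.\<close>

class complex_hilbert = real_inner + complete_space +
  fixes scaleC :: "complex \<Rightarrow> 'a \<Rightarrow> 'a" (infixr "*\<^sub>C" 75)
  assumes scaleC_add_right: "c *\<^sub>C (x + y) = c *\<^sub>C x + c *\<^sub>C y"
    and scaleC_add_left: "(c + d) *\<^sub>C x = c *\<^sub>C x + d *\<^sub>C x"
    and scaleC_scaleC: "c *\<^sub>C d *\<^sub>C x = (c * d) *\<^sub>C x"
    and scaleC_of_real: "of_real r *\<^sub>C x = r *\<^sub>R x"
    and inner_scaleC_ii: "inner (\<i> *\<^sub>C x) (\<i> *\<^sub>C y) = inner x y"

text \<open>Linear in the first argument, with real part \<^const>\<open>inner\<close>.\<close>

definition cinner :: "'h::complex_hilbert \<Rightarrow> 'h \<Rightarrow> complex" where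
  "cinner x y = Complex (inner x y) (inner x (\<i> *\<^sub>C y))"

definition unitary_representation ::
    "'n::finite rmat set \<Rightarrow> ('n rmat \<Rightarrow> 'h::complex_hilbert \<Rightarrow> 'h) \<Rightarrow> bool" where
  "unitary_representation G \<pi> \<longleftrightarrow>
     (\<forall>v. \<pi> (mat 1) v = v) \<and> (\<forall>g\<in>G. \<forall>h\<in>G. \<forall>v. \<pi> (g ** h) v = \<pi> g (\<pi> h v)) \<and>
     (\<forall>g\<in>G. (\<forall>u v. \<pi> g (u + v) = \<pi> g u + \<pi> g v) \<and> (\<forall>c v. \<pi> g (c *\<^sub>C v) = c *\<^sub>C \<pi> g v) \<and>
             (\<forall>u v. cinner (\<pi> g u) (\<pi> g v) = cinner u v)) \<and>
     (\<forall>v. continuous_on G (\<lambda>g. \<pi> g v))"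

definition irreducible_unitary ::
    "'n::finite rmat set \<Rightarrow> ('n rmat \<Rightarrow> 'h::complex_hilbert \<Rightarrow> 'h) \<Rightarrow> bool" where
  "irreducible_unitary G \<pi> \<longleftrightarrow>
     (UNIV :: 'h set) \<noteq> {0} \<and>
     (\<forall>S. subspace S \<and> (\<forall>c. \<forall>v\<in>S. c *\<^sub>C v \<in> S) \<and> closed S \<and> (\<forall>g\<in>G. \<forall>v\<in>S. \<pi> g v \<in> S)
          \<longrightarrow> S = {0} \<or> S = UNIV)"

definition haar_measure :: "'n::finite rmat set \<Rightarrow> 'n rmat measure \<Rightarrow> bool" where
  "haar_measure G \<mu> \<longleftrightarrow>
     space \<mu> = G \<and> sets \<mu> = sets (restrict_space borel G) \<and> emeasure \<mu> G \<noteq> 0 \<and>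
     (\<forall>C\<subseteq>G. compact C \<longrightarrow> emeasure \<mu> C < \<infinity>) \<and>
     (\<forall>g\<in>G. \<forall>A\<in>sets \<mu>. emeasure \<mu> ((\<lambda>x. g ** x) ` A) = emeasure \<mu> A)"

text \<open>Irreducible and square integrable.\<close>

definition discrete_series ::
    "'n::finite rmat set \<Rightarrow> ('n rmat \<Rightarrow> 'h::complex_hilbert \<Rightarrow> 'h) \<Rightarrow> bool" where
  "discrete_series G \<pi> \<longleftrightarrow>
     unitary_representation G \<pi> \<and> irreducible_unitary G \<pi> \<and>
     (\<exists>\<mu>. haar_measure G \<mu> \<and>
        (\<forall>u v. integrable \<mu> (\<lambda>g. (cmod (cinner (\<pi> g u) v))\<^sup>2)))"

definition K_finite_vectors ::
    "'n::finite rmat set \<Rightarrow> ('n rmat \<Rightarrow> 'h::complex_hilbert \<Rightarrow> 'h) \<Rightarrow> 'h set" where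
  "K_finite_vectors K \<pi> = {v. \<exists>B. finite B \<and> (\<lambda>k. \<pi> k v) ` K \<subseteq> span B}"

text \<open>Irreducible finite-dimensional continuous complex representations of \<open>K\<close>; the representation
  space is \<open>W = \<complex>\<^sup>m\<close>.\<close>

definition K_type :: "'n::finite rmat set \<Rightarrow> ('n rmat \<Rightarrow> 'm::finite cmat) \<Rightarrow> bool" where
  "K_type K \<tau> \<longleftrightarrow>
     continuous_on K \<tau> \<and> \<tau> (mat 1) = mat 1 \<and> (\<forall>k\<in>K. \<forall>l\<in>K. \<tau> (k ** l) = \<tau> k ** \<tau> l) \<and>
     (\<forall>S. vec.subspace S \<and> (\<forall>k\<in>K. \<forall>w\<in>S. \<tau> k *v w \<in> S) \<longrightarrow> S = {0} \<or> S = UNIV)"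

section \<open>Enveloping algebras and induced modules\<close>

text \<open>Words under concatenation: \<open>'a list \<Rightarrow>\<^sub>0 complex\<close> is then the free associative unital algebra
  on the letters \<open>'a\<close>, with multiplication by convolution.\<close>

instantiation list :: (type) monoid_add
begin

definition zero_list :: "'a list" where
  "zero_list = []"

definition plus_list :: "'a list \<Rightarrow> 'a list \<Rightarrow> 'a list" where
  "plus_list xs ys = xs @ ys"

instance
  by standard (simp_all add: zero_list_def plus_list_def)

end

type_synonym 'n free_alg = "'n cmat list \<Rightarrow>\<^sub>0 complex"

definition scalar :: "complex \<Rightarrow> 'n::finite free_alg" where
  "scalar c = Poly_Mapping.single [] c"

definition letter :: "'n::finite cmat \<Rightarrow> 'n free_alg" where
  "letter X = Poly_Mapping.single [X] 1"

definition free_algebra :: "'n::finite cmat set \<Rightarrow> 'n free_alg set" where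
  "free_algebra \<aa> = {D. Poly_Mapping.keys D \<subseteq> lists \<aa>}"

text \<open>
  \<open>\<U>(\<aa>)\<close> is the quotient of the free algebra on the set \<open>\<aa>\<close> by the two-sided ideal generated by the
  relations that make \<^const>\<open>letter\<close> linear (which gives the tensor algebra) and compatible with
  brackets. Elements of \<open>\<U>(\<aa>)\<close> are represented below by elements of the free algebra.
\<close>

inductive_set enveloping_ideal :: "'n::finite cmat set \<Rightarrow> 'n free_alg set"
  for \<aa> :: "'n::finite cmat set" where
  linear: "X \<in> \<aa> \<Longrightarrow> Y \<in> \<aa> \<Longrightarrow>
     letter (scale_mat a X + scale_mat b Y) - scalar a * letter X - scalar b * letter Y
       \<in> enveloping_ideal \<aa>"
| bracket: "X \<in> \<aa> \<Longrightarrow> Y \<in> \<aa> \<Longrightarrow>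
     letter X * letter Y - letter Y * letter X - letter (brk X Y) \<in> enveloping_ideal \<aa>"
| zero: "0 \<in> enveloping_ideal \<aa>"
| add: "D \<in> enveloping_ideal \<aa> \<Longrightarrow> E \<in> enveloping_ideal \<aa> \<Longrightarrow> D + E \<in> enveloping_ideal \<aa>"
| mult: "D \<in> enveloping_ideal \<aa> \<Longrightarrow> A \<in> free_algebra \<aa> \<Longrightarrow> B \<in> free_algebra \<aa> \<Longrightarrow>
     A * D * B \<in> enveloping_ideal \<aa>"

text \<open>
  The module \<open>\<U>(\<gg>) \<otimes>\<^bsub>\<U>(\<qq>)\<^esub> W\<close> for Lie algebras \<open>\<qq> \<subseteq> \<gg>\<close> and a representation \<open>\<rho>\<close> of \<open>\<qq>\<close> on
  \<open>W = \<complex>\<^sup>m\<close>, as a quotient of (free algebra) \<open>\<otimes>\<^bsub>\<complex>\<^esub> \<complex>\<^sup>m\<close>. The latter consists of the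
  \<open>m\<close>-tuples over the free algebra, on which the free algebra acts from the left by \<open>(*s)\<close>.
\<close>

type_synonym ('n, 'm) pretensor = "('n free_alg)^'m"

definition pretensor_space :: "'n::finite cmat set \<Rightarrow> ('n, 'm::finite) pretensor set" where
  "pretensor_space \<gg> = {f. \<forall>i. f $ i \<in> free_algebra \<gg>}"

definition pretensor :: "'n::finite free_alg \<Rightarrow> complex^'m::finite \<Rightarrow> ('n, 'm) pretensor" where
  "pretensor D w = (\<chi> i. D * scalar (w $ i))"

inductive_set tensor_relations ::
    "'n::finite cmat set \<Rightarrow> 'n cmat set \<Rightarrow> ('n cmat \<Rightarrow> 'm::finite cmat) \<Rightarrow> ('n, 'm) pretensor set"
  for \<gg> :: "'n::finite cmat set" and \<qq> :: "'n cmat set" and \<rho> :: "'n cmat \<Rightarrow> 'm::finite cmat" where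
  ideal: "D \<in> enveloping_ideal \<gg> \<Longrightarrow> pretensor D w \<in> tensor_relations \<gg> \<qq> \<rho>"
| balanced: "D \<in> free_algebra \<gg> \<Longrightarrow> Z \<in> \<qq> \<Longrightarrow>
     pretensor (D * letter Z) w - pretensor D (\<rho> Z *v w) \<in> tensor_relations \<gg> \<qq> \<rho>"
| zero: "0 \<in> tensor_relations \<gg> \<qq> \<rho>"
| add: "f \<in> tensor_relations \<gg> \<qq> \<rho> \<Longrightarrow> f' \<in> tensor_relations \<gg> \<qq> \<rho> \<Longrightarrow>
     f + f' \<in> tensor_relations \<gg> \<qq> \<rho>"
| scale: "f \<in> tensor_relations \<gg> \<qq> \<rho> \<Longrightarrow> scalar c *s f \<in> tensor_relations \<gg> \<qq> \<rho>"

definition tensor_eq ::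
    "'n::finite cmat set \<Rightarrow> 'n cmat set \<Rightarrow> ('n cmat \<Rightarrow> 'm::finite cmat) \<Rightarrow> ('n, 'm) pretensor rel" where
  "tensor_eq \<gg> \<qq> \<rho> =
     {(f, f'). f \<in> pretensor_space \<gg> \<and> f' \<in> pretensor_space \<gg> \<and> f - f' \<in> tensor_relations \<gg> \<qq> \<rho>}"

definition ind_module ::
    "'n::finite cmat set \<Rightarrow> 'n cmat set \<Rightarrow> ('n cmat \<Rightarrow> 'm::finite cmat) \<Rightarrow> ('n, 'm) pretensor set set" where
  "ind_module \<gg> \<qq> \<rho> = pretensor_space \<gg> // tensor_eq \<gg> \<qq> \<rho>"

definition tensor_class ::
    "'n::finite cmat set \<Rightarrow> 'n cmat set \<Rightarrow> ('n cmat \<Rightarrow> 'm::finite cmat) \<Rightarrow>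
     'n free_alg \<Rightarrow> complex^'m \<Rightarrow> ('n, 'm) pretensor set" where
  "tensor_class \<gg> \<qq> \<rho> D w = tensor_eq \<gg> \<qq> \<rho> `` {pretensor D w}"

definition ind_zero ::
    "'n::finite cmat set \<Rightarrow> 'n cmat set \<Rightarrow> ('n cmat \<Rightarrow> 'm::finite cmat) \<Rightarrow> ('n, 'm) pretensor set" where
  "ind_zero \<gg> \<qq> \<rho> = tensor_eq \<gg> \<qq> \<rho> `` {0}"

definition ind_add ::
    "'n::finite cmat set \<Rightarrow> 'n cmat set \<Rightarrow> ('n cmat \<Rightarrow> 'm::finite cmat) \<Rightarrow>
     ('n, 'm) pretensor set \<Rightarrow> ('n, 'm) pretensor set \<Rightarrow> ('n, 'm) pretensor set" where
  "ind_add \<gg> \<qq> \<rho> u v = (\<Union>f\<in>u. \<Union>f'\<in>v. tensor_eq \<gg> \<qq> \<rho> `` {f + f'})"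

text \<open>The action \<open>L\<^sub>D\<close> of \<open>D \<in> \<U>(\<gg>)\<close>; multiplication by \<open>c \<in> \<complex>\<close> is the case \<open>D = scalar c\<close>.\<close>

definition ind_act ::
    "'n::finite cmat set \<Rightarrow> 'n cmat set \<Rightarrow> ('n cmat \<Rightarrow> 'm::finite cmat) \<Rightarrow>
     'n free_alg \<Rightarrow> ('n, 'm) pretensor set \<Rightarrow> ('n, 'm) pretensor set" where
  "ind_act \<gg> \<qq> \<rho> D v = (\<Union>f\<in>v. tensor_eq \<gg> \<qq> \<rho> `` {D *s f})"

definition ind_subspace ::
    "'n::finite cmat set \<Rightarrow> 'n cmat set \<Rightarrow> ('n cmat \<Rightarrow> 'm::finite cmat) \<Rightarrow>
     ('n, 'm) pretensor set set \<Rightarrow> bool" where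
  "ind_subspace \<gg> \<qq> \<rho> S \<longleftrightarrow>
     S \<subseteq> ind_module \<gg> \<qq> \<rho> \<and> ind_zero \<gg> \<qq> \<rho> \<in> S \<and>
     (\<forall>u\<in>S. \<forall>v\<in>S. ind_add \<gg> \<qq> \<rho> u v \<in> S) \<and> (\<forall>c. \<forall>v\<in>S. ind_act \<gg> \<qq> \<rho> (scalar c) v \<in> S)"

definition ind_span ::
    "'n::finite cmat set \<Rightarrow> 'n cmat set \<Rightarrow> ('n cmat \<Rightarrow> 'm::finite cmat) \<Rightarrow>
     ('n, 'm) pretensor set set \<Rightarrow> ('n, 'm) pretensor set set" where
  "ind_span \<gg> \<qq> \<rho> S = ind_subspace \<gg> \<qq> \<rho> hull S"

text \<open>\<open>\<V>\<^sup>(\<^sup>n\<^sup>)\<close>, for \<open>\<nn> = \<pp>\<^sup>-\<close>.\<close>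

definition ind_layer ::
    "'n::finite cmat set \<Rightarrow> 'n cmat set \<Rightarrow> ('n cmat \<Rightarrow> 'm::finite cmat) \<Rightarrow>
     'n cmat set \<Rightarrow> nat \<Rightarrow> ('n, 'm) pretensor set set" where
  "ind_layer \<gg> \<qq> \<rho> \<nn> n =
     ind_span \<gg> \<qq> \<rho>
       {tensor_class \<gg> \<qq> \<rho> (prod_list (map letter xs)) w | xs w. xs \<in> lists \<nn> \<and> length xs = n}"

text \<open>\<open>\<U>(\<aa>)W\<close>, for a subalgebra \<open>\<aa>\<close> of \<open>\<gg>\<close>.\<close>

definition enveloping_orbit ::
    "'n::finite cmat set \<Rightarrow> 'n cmat set \<Rightarrow> ('n cmat \<Rightarrow> 'm::finite cmat) \<Rightarrow>
     'n cmat set \<Rightarrow> ('n, 'm) pretensor set set" where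
  "enveloping_orbit \<gg> \<qq> \<rho> \<aa> =
     ind_span \<gg> \<qq> \<rho>
       {ind_act \<gg> \<qq> \<rho> D (tensor_class \<gg> \<qq> \<rho> 1 w) | D w. D \<in> free_algebra \<aa>}"

text \<open>\<open>\<L>\<^sup>c\<close>, for \<open>\<nn> = \<pp>\<^bsub>\<hh>\<^esub>\<^sup>+\<close>.\<close>

definition annihilated_vectors ::
    "'n::finite cmat set \<Rightarrow> 'n cmat set \<Rightarrow> ('n cmat \<Rightarrow> 'm::finite cmat) \<Rightarrow>
     'n cmat set \<Rightarrow> ('n, 'm) pretensor set set" where
  "annihilated_vectors \<gg> \<qq> \<rho> \<nn> =
     {v \<in> ind_module \<gg> \<qq> \<rho>. \<forall>X\<in>\<nn>. ind_act \<gg> \<qq> \<rho> (letter X) v = ind_zero \<gg> \<qq> \<rho>}"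

section \<open>Holomorphic discrete series\<close>

text \<open>The subalgebra \<open>\<kk> + \<pp>\<^sup>+\<close> of \<open>\<gg>\<close> (all complexified) and the extension to it of the complexified
  differential of \<open>\<tau>\<close> by zero on \<open>\<pp>\<^sup>+\<close>.\<close>

definition parabolic :: "'n::finite rmat set \<Rightarrow> 'n cmat set \<Rightarrow> 'n cmat set" where
  "parabolic K \<pp>p = {Y + X | Y X. Y \<in> complexify (lie_algebra K) \<and> X \<in> \<pp>p}"

definition extend_by_zero ::
    "'n::finite rmat set \<Rightarrow> 'n cmat set \<Rightarrow> ('n rmat \<Rightarrow> 'm::finite cmat) \<Rightarrow> 'n cmat \<Rightarrow> 'm cmat" where
  "extend_by_zero K \<pp>p \<tau> Z =
     complexify_map (differential \<tau>) (THE Y. Y \<in> complexify (lie_algebra K) \<and> Z - Y \<in> \<pp>p)"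

text \<open>
  \<open>\<pi>\<close> is a holomorphic discrete series representation of \<open>G\<close> and \<open>(\<tau>, W)\<close> is its lowest \<open>K\<close>-type:
  \<open>\<pi>\<close> is in the discrete series, and its \<open>(\<gg>, K)\<close>-module of \<open>K\<close>-finite vectors is identified, by
  \<open>\<Phi>\<close>, with \<open>M = \<U>(\<gg>) \<otimes>\<^bsub>\<U>(\<kk> + \<pp>\<^sup>+)\<^esub> W\<close>. In particular \<open>\<pp>\<^sup>+\<close> annihilates the copy
  \<open>\<Phi>[1 \<otimes> W]\<close> of \<open>W\<close>. The \<open>K\<close>-equivariance is only required on \<open>[1 \<otimes> W]\<close>, which generates \<open>M\<close>;
  with \<open>K\<close> connected the rest follows from the \<open>\<gg>\<close>-equivariance.
\<close>

definition holomorphic_discrete_series ::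
    "'n::finite rmat set \<Rightarrow> 'n rmat set \<Rightarrow> 'n cmat set \<Rightarrow>
     ('n rmat \<Rightarrow> 'm::finite cmat) \<Rightarrow> ('n rmat \<Rightarrow> 'h::complex_hilbert \<Rightarrow> 'h) \<Rightarrow> bool" where
  "holomorphic_discrete_series G K \<pp>p \<tau> \<pi> \<longleftrightarrow>
     discrete_series G \<pi> \<and> K_type K \<tau> \<and>
     (let \<gg> = complexify (lie_algebra G);
          \<qq> = parabolic K \<pp>p;
          \<rho> = extend_by_zero K \<pp>p \<tau>;
          M = ind_module \<gg> \<qq> \<rho>
      in \<exists>\<Phi>. bij_betw \<Phi> M (K_finite_vectors K \<pi>) \<and>
           (\<forall>u\<in>M. \<forall>v\<in>M. \<Phi> (ind_add \<gg> \<qq> \<rho> u v) = \<Phi> u + \<Phi> v) \<and>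
           (\<forall>c. \<forall>v\<in>M. \<Phi> (ind_act \<gg> \<qq> \<rho> (scalar c) v) = c *\<^sub>C \<Phi> v) \<and>
           (\<forall>X\<in>lie_algebra G. \<forall>v\<in>M.
              ((\<lambda>t. \<pi> (mexp (t *\<^sub>R X)) (\<Phi> v)) has_vector_derivative
                 \<Phi> (ind_act \<gg> \<qq> \<rho> (letter (of_real_mat X)) v)) (at 0)) \<and>
           (\<forall>k\<in>K. \<forall>w. \<Phi> (tensor_class \<gg> \<qq> \<rho> 1 (\<tau> k *v w)) =
                         \<pi> k (\<Phi> (tensor_class \<gg> \<qq> \<rho> 1 w))))"

end

theory Submission
  imports Defs
begin

text \<open>
  Write \<open>\<aa>\<^sup>\<plusminus>\<close> and \<open>\<bb>\<^sup>\<plusminus>\<close> for the parts of \<open>\<pp>\<^sup>\<plusminus>\<close> in \<open>\<hh>\<close> and \<open>\<hh>\<^sub>0\<close>. Then \<open>\<pp>\<^sup>- = \<aa>\<^sup>- + \<bb>\<^sup>-\<close> and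
  \<open>\<hh>\<^sub>0 = \<ll> + \<bb>\<^sup>+ + \<bb>\<^sup>-\<close>, and complex conjugation turns the condition on triple brackets into
  \<open>[[\<aa>\<^sup>+, \<bb>\<^sup>-], \<bb>\<^sup>-] = 0\<close>. For \<open>X \<in> \<aa>\<^sup>+\<close>, \<open>Y \<in> \<bb>\<^sup>-\<close> and \<open>w \<in> W\<close> one has \<open>XYw = [X, Y]w\<close>, so the hypothesis on the
  first layer implies that \<open>[\<aa>\<^sup>+, \<bb>\<^sup>-]\<close> annihilates \<open>W\<close>.

  Suppose that \<open>[\<aa>\<^sup>+, \<bb>\<^sup>-]\<close> commutes with \<open>\<bb>\<^sup>-\<close>. Then the vectors annihilated by both \<open>\<aa>\<^sup>+\<close> and
  \<open>[\<aa>\<^sup>+, \<bb>\<^sup>-]\<close> form an \<open>\<hh>\<^sub>0\<close>-stable space that contains \<open>W\<close>, hence \<open>\<U>(\<hh>\<^sub>0)W\<close> (\<open>orbit_subset_lowest\<close>). This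
  inclusion already forces equality: \<open>M = \<U>(\<hh>\<^sub>0)W + \<aa>\<^sup>-M\<close> because \<open>\<pp>\<^sup>-\<close> is abelian
  (\<open>module_decomposition\<close>), and the vectors annihilated by \<open>\<aa>\<^sup>+\<close> are orthogonal to \<open>\<aa>\<^sup>-M\<close>, since elements of
  \<open>\<gg>\<close> act by skew operators on the Hilbert space of the discrete series (\<open>lowest_subset_orbit\<close>).

  Conversely, if \<open>\<aa>\<^sup>+\<close> annihilates \<open>\<U>(\<hh>\<^sub>0)W\<close>, then \<open>0 = XYY'w = [[X, Y], Y']w\<close> (\<open>brackets_vanish\<close>). It remains to
  see that \<open>Z \<in> \<pp>\<^sup>-\<close> is zero if \<open>Zw = 0\<close> for all \<open>w\<close>, which is an instance of the Poincare-Birkhoff-Witt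
  theorem. The proof of this instance (\<open>no_relations_in_first_layer\<close>) lets \<open>\<gg>\<close> act on functions on
  \<open>\<pp>\<^sup>- \<times> W\<close> by polynomial vector fields. They describe infinitesimally how the complex group acts on
  the homogeneous bundle with fibre \<open>W\<close> in the chart \<open>exp \<pp>\<^sup>-\<close>. Applying differential operators and evaluating
  over the base point pairs functions with the induced module, and coordinate functions detect \<open>Z\<close>.

  That \<open>\<pp>\<^sup>+\<close> and \<open>\<pp>\<^sup>-\<close> are abelian and that \<open>J\<close> preserves the part of \<open>\<pp>\<close> in \<open>\<hh>\<^sub>0\<close> rest on one fact: an
  \<open>Ad(K)\<close>-invariant complex structure on \<open>\<pp>\<close> is orthogonal for the Killing form, because \<open>\<pp>\<close> is irreducible
  under \<open>\<kk>\<close> when \<open>\<gg>\<close> is simple (\<open>p_irreducible\<close>, \<open>J_orthogonal\<close>, \<open>J_brk\<close>). The passage from groups to Lie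
  algebras uses that continuous homomorphisms of closed matrix groups have differentials that are
  homomorphisms of Lie algebras (\<open>one_parameter_group\<close>, \<open>trotter_product\<close>, \<open>D_brk\<close>).
\<close>

section \<open>Brackets of matrices\<close>

lemma scale_mat_add: "scale_mat c (X + Y) = scale_mat c X + scale_mat c Y"
  by (simp add: scale_mat_def vec_eq_iff algebra_simps)
lemma scale_mat_mult: "scale_mat c (scale_mat d X) = scale_mat (c * d) X"
  by (simp add: scale_mat_def vec_eq_iff algebra_simps)
lemma scale_mat_diff: "scale_mat c (X - Y) = scale_mat c X - scale_mat c Y"
  by (simp add: scale_mat_def vec_eq_iff algebra_simps)
lemma scale_mat_one [simp]: "scale_mat 1 X = X"
  by (simp add: scale_mat_def vec_eq_iff)
lemma scale_mat_zero [simp]: "scale_mat c 0 = 0" "scale_mat 0 X = 0"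
  by (simp_all add: scale_mat_def vec_eq_iff)
lemma scale_mat_of_real: "scale_mat (of_real r) X = r *\<^sub>R X"
  unfolding scale_mat_def vec_eq_iff vector_scaleR_component vec_lambda_beta scaleR_conv_of_real[symmetric] by simp
lemma scale_mat_neg_one: "scale_mat (- 1) X = - X"
  by (simp add: scale_mat_def vec_eq_iff)
lemma scale_mat_mult_left: "scale_mat c X ** Y = scale_mat c (X ** Y)"
  by (simp add: scale_mat_def vec_eq_iff matrix_matrix_mult_def sum_distrib_left mult.assoc)
lemma scale_mat_mult_right: "X ** scale_mat c Y = scale_mat c (X ** Y)"
  by (simp add: scale_mat_def vec_eq_iff matrix_matrix_mult_def sum_distrib_left mult.left_commute)
lemma scale_mat_vector: "scale_mat c X *v w = c *s (X *v w)"
  by (simp add: scale_mat_def vec_eq_iff matrix_vector_mult_def sum_distrib_left mult.assoc)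

lemma brk_scale_left: "brk (scale_mat c X) Y = scale_mat c (brk X Y)"
  by (simp add: brk_def scale_mat_mult_left scale_mat_mult_right scale_mat_diff)
lemma brk_scale_right: "brk X (scale_mat c Y) = scale_mat c (brk X Y)"
  by (simp add: brk_def scale_mat_mult_left scale_mat_mult_right scale_mat_diff)

lemma mat_mul_diff_left: "(A - B) ** C = A ** C - B ** (C :: 'a::ring_1^'n::finite^'n)"
  by (simp add: vec_eq_iff matrix_matrix_mult_def left_diff_distrib sum_subtractf)
lemma mat_mul_diff_right: "C ** (A - B) = C ** A - C ** (B :: 'a::ring_1^'n::finite^'n)"
  by (simp add: vec_eq_iff matrix_matrix_mult_def right_diff_distrib sum_subtractf)
lemma mat_mul_minus_left: "(- A) ** C = - (A ** (C :: 'a::ring_1^'n::finite^'n))"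
  by (simp add: vec_eq_iff matrix_matrix_mult_def sum_negf)
lemma mat_mul_minus_right: "C ** (- A) = - (C ** (A :: 'a::ring_1^'n::finite^'n))"
  by (simp add: vec_eq_iff matrix_matrix_mult_def sum_negf)

lemma mat_mul_add_left: "(A + B) ** C = A ** C + B ** (C :: 'a::ring_1^'n::finite^'n)"
  by (simp add: vec_eq_iff matrix_matrix_mult_def distrib_right sum.distrib)

lemmas mat_mul_ring = mat_mul_diff_left mat_mul_diff_right mat_mul_minus_left mat_mul_minus_right
  matrix_add_ldistrib mat_mul_add_left matrix_mul_assoc

lemma brk_add_left: "brk (X + Y) Z = brk X Z + brk Y Z"
  and brk_add_right: "brk Z (X + Y) = brk Z X + brk Z Y"
  and brk_diff_left: "brk (X - Y) Z = brk X Z - brk Y Z"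
  and brk_diff_right: "brk Z (X - Y) = brk Z X - brk Z Y"
  and brk_minus_left: "brk (- X) Z = - brk X Z"
  and brk_minus_right: "brk Z (- X) = - brk Z X"
  by (simp_all add: brk_def mat_mul_ring)

lemma brk_antisym: "brk X Y = - brk Y X"
  by (simp add: brk_def)
lemma brk_self [simp]: "brk X X = 0"
  by (simp add: brk_def)
lemma brk_zero [simp]: "brk 0 X = 0" "brk X 0 = 0"
  by (simp_all add: brk_def)

lemma brk_jacobi: "brk X (brk Y Z) = brk (brk X Y) Z + brk Y (brk X Z)"
  by (simp add: brk_def mat_mul_ring)

lemmas brk_linear = brk_add_left brk_add_right brk_diff_left brk_diff_right brk_minus_left
  brk_minus_right

lemma brk_scaleR_left: "brk (r *\<^sub>R X) (Y::'a::{real_algebra_1}^'n::finite^'n) = r *\<^sub>R brk X Y"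
  by (simp add: brk_def scaleR_diff_right vec_eq_iff matrix_matrix_mult_def scaleR_sum_right)

lemma brk_scaleR_right: "brk X (r *\<^sub>R Y) = r *\<^sub>R brk X (Y::'a::{real_algebra_1}^'n::finite^'n)"
  by (simp add: brk_def scaleR_diff_right vec_eq_iff matrix_matrix_mult_def scaleR_sum_right)

section \<open>One-parameter groups in Banach algebras\<close>

lemma geometric_right_inverse:
  fixes x :: "'b::{real_normed_algebra_1,banach}"
  assumes "norm (1 - x) < 1"
  shows "\<exists>y. x * y = 1"
proof -
  define z where "z = 1 - x"
  have "summable (\<lambda>n. norm (z ^ n))"
    by (rule summable_comparison_test'[where g = "\<lambda>n. norm z ^ n"])
       (use assms in \<open>auto simp: z_def norm_power_ineq intro: summable_geometric\<close>)
  then have s: "summable (\<lambda>n. z ^ n)"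
    by (rule summable_norm_cancel)
  define S where "S = suminf (\<lambda>n. z ^ n)"
  have "z * S = suminf (\<lambda>n. z ^ Suc n)"
    unfolding S_def using suminf_mult[OF s, of z] by simp
  also have "\<dots> = S - 1"
    unfolding S_def using suminf_split_head[OF s] by simp
  finally have "x * S = 1"
    by (simp add: z_def algebra_simps)
  then show ?thesis by blast
qed

lemma exp_scaleR_derivative_0:
  fixes A :: "'b::{real_normed_algebra_1,banach}"
  shows "((\<lambda>t. exp (t *\<^sub>R A)) has_vector_derivative A) (at 0)"
  using exp_scaleR_has_vector_derivative_right[of A 0 UNIV] by simp

lemma exp_scaleR_inject:
  fixes A :: "'b::{real_normed_algebra_1,banach}"
  assumes "\<And>t. exp (t *\<^sub>R A) = exp (t *\<^sub>R B)"
  shows "A = B"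
  using exp_scaleR_derivative_0[of A] exp_scaleR_derivative_0[of B] vector_derivative_unique_at
  unfolding assms by blast

lemma exp_conjugation_derivative:
  fixes A B :: "'b::{real_normed_algebra_1,banach}"
  shows "((\<lambda>s. exp (s *\<^sub>R A) * B * exp (- (s *\<^sub>R A))) has_vector_derivative A * B - B * A) (at 0)"
proof -
  have "((\<lambda>s. exp (s *\<^sub>R - A)) has_vector_derivative - A) (at 0)"
    by (rule exp_scaleR_derivative_0)
  then have 1: "((\<lambda>s. exp (- (s *\<^sub>R A))) has_vector_derivative - A) (at 0)"
    by simp
  have 2: "((\<lambda>s. exp (s *\<^sub>R A) * B) has_vector_derivative A * B) (at 0)"
    by (rule has_vector_derivative_mult_left[OF exp_scaleR_derivative_0])
  show ?thesis
    using has_vector_derivative_mult[OF 2 1] by simp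
qed

lemma has_vector_derivative_translate:
  assumes "(F has_vector_derivative D) (at (x + a))"
  shows "((\<lambda>t::real. F (t + a)) has_vector_derivative D) (at x)"
proof -
  have "((\<lambda>t::real. t + a) has_vector_derivative (1 + 0)) (at x)"
    by (intro has_vector_derivative_add has_vector_derivative_id has_vector_derivative_const)
  from vector_diff_chain_at[OF this assms] show ?thesis
    by (simp add: o_def)
qed

text \<open>A mean \<open>I\<close> of \<open>T\<close> over a short interval is close to \<open>1\<close>, hence invertible, and \<open>T(t) I\<close> is a difference
  of values of a primitive of \<open>T\<close>, hence differentiable in \<open>t\<close>.\<close>

lemma one_parameter_group_differentiable:
  fixes T :: "real \<Rightarrow> 'b::{real_normed_algebra_1,banach}"
  assumes T0: "T 0 = 1" and add: "\<And>s t. T (s + t) = T s * T t" and cont: "continuous_on UNIV T"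
  shows "\<exists>C. (T has_vector_derivative C) (at 0)"
proof -
  have "isCont T 0"
    using cont continuous_on_eq_continuous_at by blast
  then obtain d where d: "d > 0" "\<And>s. norm s < d \<Longrightarrow> norm (T s - 1) < 1/2"
    unfolding continuous_at_eps_delta using T0
    by (metis (no_types, lifting) dist_norm diff_zero half_gt_zero zero_less_one)
  define a where "a = d / 2"
  have a: "a > 0" "\<And>s. s \<in> {0..a} \<Longrightarrow> norm (T s - 1) \<le> 1/2"
    by (use d(1) in \<open>simp add: a_def\<close>) (rule less_imp_le, rule d(2), use d(1) in \<open>auto simp: a_def\<close>)
  have c: "continuous_on S T" for S
    using cont continuous_on_subset by blast
  define I where "I = integral {0..a} T"
  have "norm (integral {0..a} (\<lambda>s. T s - 1)) \<le> integral {0..a} (\<lambda>s. 1/2)"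
    by (rule integral_norm_bound_integral)
       (use a(2) in \<open>auto intro!: integrable_continuous_real continuous_intros c\<close>)
  also have "integral {0..a} (\<lambda>s. T s - 1) = I - a *\<^sub>R 1"
    unfolding I_def using a by (subst integral_diff) (auto intro!: integrable_continuous_real continuous_intros c)
  finally have "norm (I - a *\<^sub>R 1) \<le> a / 2"
    using a by simp
  then have "inverse a * norm (I - a *\<^sub>R 1) < 1"
    using a(1) by (simp add: field_simps)
  moreover have "1 - I /\<^sub>R a = - (inverse a *\<^sub>R (I - a *\<^sub>R 1))"
    using a(1) by (simp add: scaleR_diff_right)
  ultimately have "norm (1 - I /\<^sub>R a) < 1"
    using a(1) by (simp only: norm_minus_cancel norm_scaleR) simp
  then obtain y where y: "(I /\<^sub>R a) * y = 1"
    using geometric_right_inverse by blast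
  \<comment> \<open>a primitive whose domain contains \<open>0\<close> in its interior\<close>
  define F where "F = (\<lambda>t. integral {-1..t} T)"
  have F: "(F has_vector_derivative T t) (at t)" if "t > -1" for t
  proof -
    have "(F has_vector_derivative T t) (at t within {-1..t + 1})"
      unfolding F_def by (rule integral_has_vector_derivative) (use that c in auto)
    moreover have "at t within {-1..t + 1} = at t"
      using that by (intro at_within_interior) auto
    ultimately show ?thesis by simp
  qed
  have shift: "T t * I = F (t + a) - F t" if "t > -1" for t
  proof -
    have "T t * I = integral {0..a} (\<lambda>s. T t * T s)"
      unfolding I_def
      by (rule integral_linear[OF _ bounded_linear_mult_right, unfolded o_def, symmetric])
         (rule integrable_continuous_real[OF c])
    also have "\<dots> = integral {0..a} (\<lambda>s. T (s + t))"
      by (simp add: add.commute[of _ t] add)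
    also have "\<dots> = F (a + t) - F (0 + t)"
      by (rule integral_unique[OF fundamental_theorem_of_calculus])
         (use a(1) that in \<open>auto intro!: has_vector_derivative_at_within has_vector_derivative_translate F\<close>)
    finally show ?thesis by (simp add: add.commute)
  qed
  have T: "T t = (F (t + a) - F t) * (y /\<^sub>R a)" if "t > -1" for t
  proof -
    have "T t = T t * ((I /\<^sub>R a) * y)" using y by simp
    also have "\<dots> = (T t * I) * (y /\<^sub>R a)" by (simp add: mult.assoc)
    finally show ?thesis unfolding shift[OF that] .
  qed
  have "((\<lambda>t. F (t + a)) has_vector_derivative T a) (at 0)"
    using has_vector_derivative_translate[of F "T a" 0 a] F[of a] a(1) by simp
  then have "((\<lambda>t. (F (t + a) - F t) * (y /\<^sub>R a)) has_vector_derivative (T a - T 0) * (y /\<^sub>R a)) (at 0)"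
    using F[of 0] by (intro has_vector_derivative_mult_left has_vector_derivative_diff) auto
  then have "(T has_vector_derivative (T a - T 0) * (y /\<^sub>R a)) (at 0)"
    by (rule has_vector_derivative_transform_within_open[of _ _ _ "{-1<..}"]) (auto simp: T)
  then show ?thesis by blast
qed

theorem one_parameter_group:
  fixes T :: "real \<Rightarrow> 'b::{real_normed_algebra_1,banach}"
  assumes T0: "T 0 = 1" and add: "\<And>s t. T (s + t) = T s * T t" and cont: "continuous_on UNIV T"
  shows "\<exists>C. \<forall>t. T t = exp (t *\<^sub>R C)"
proof -
  obtain C where C: "(T has_vector_derivative C) (at 0)"
    using one_parameter_group_differentiable[OF assms] by blast
  have T': "(T has_vector_derivative T t * C) (at t)" for t
  proof -
    have "((\<lambda>h. T (h - t)) has_vector_derivative C) (at t)"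
      using has_vector_derivative_translate[of T C t "- t"] C by simp
    then have "((\<lambda>h. T t * T (h - t)) has_vector_derivative T t * C) (at t)"
      by (rule has_vector_derivative_mult_right)
    then show ?thesis
      by (simp flip: add)
  qed
  have "((\<lambda>t. T t * exp (t *\<^sub>R - C)) has_vector_derivative 0) (at t)" for t
    using has_vector_derivative_mult[OF T' exp_scaleR_has_vector_derivative_left[of "- C" t]]
    by (simp add: mult.assoc)
  then obtain c where c: "\<And>t. T t * exp (t *\<^sub>R - C) = c"
    using has_vector_derivative_zero_constant[of UNIV "\<lambda>t. T t * exp (t *\<^sub>R - C)"] by auto
  then have "T t * exp (t *\<^sub>R - C) = 1" for t
    using c[of 0] T0 by simp
  then have "T t * exp (- (t *\<^sub>R C)) * exp (t *\<^sub>R C) = exp (t *\<^sub>R C)" for t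
    by simp
  moreover have "exp (- (t *\<^sub>R C)) * exp (t *\<^sub>R C) = 1" for t
    using exp_minus_inverse[of "- (t *\<^sub>R C)"] by simp
  ultimately have "T t = exp (t *\<^sub>R C)" for t
    by (simp add: mult.assoc)
  then show ?thesis by blast
qed

lemma power_difference_bound:
  fixes a b :: "'b::real_normed_algebra_1"
  assumes "norm a \<le> M" "norm b \<le> M" "M \<ge> 1"
  shows "norm (a ^ n - b ^ n) \<le> n * M ^ n * norm (a - b)"
proof (induction n)
  case (Suc n)
  have bn: "norm (b ^ n) \<le> M ^ n"
    by (rule order_trans[OF norm_power_ineq]) (simp add: assms power_mono)
  have "a ^ Suc n - b ^ Suc n = a * (a ^ n - b ^ n) + (a - b) * b ^ n"
    by (simp add: algebra_simps)
  then have "norm (a ^ Suc n - b ^ Suc n) \<le> norm a * norm (a ^ n - b ^ n) + norm (a - b) * norm (b ^ n)"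
    using norm_triangle_le[OF add_mono[OF norm_mult_ineq norm_mult_ineq]] by simp
  also have "\<dots> \<le> M * (n * M ^ n * norm (a - b)) + norm (a - b) * M ^ n"
    using assms Suc bn by (intro add_mono mult_mono mult_left_mono) auto
  also have "\<dots> \<le> M * (n * M ^ n * norm (a - b)) + norm (a - b) * (M * M ^ n)"
    using assms by (intro add_left_mono mult_left_mono) (auto simp: mult_le_cancel_right1)
  also have "\<dots> = Suc n * M ^ Suc n * norm (a - b)"
    by (simp add: algebra_simps)
  finally show ?case .
qed simp

text \<open>The factors \<open>exp(A/n) exp(B/n)\<close> and \<open>exp((A+B)/n)\<close> differ by \<open>o(1/n)\<close>, and raising to the \<open>n\<close>-th power
  magnifies the difference at most by a bounded multiple of \<open>n\<close>.\<close>

theorem trotter_product: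
  fixes A B :: "'b::{real_normed_algebra_1,banach}"
  shows "(\<lambda>n. (exp ((1 / real (Suc n)) *\<^sub>R A) * exp ((1 / real (Suc n)) *\<^sub>R B)) ^ Suc n) \<longlonglongrightarrow> exp (A + B)"
proof -
  define h where "h = (\<lambda>n. 1 / real (Suc n))"
  define a where "a = (\<lambda>n. exp (h n *\<^sub>R A) * exp (h n *\<^sub>R B))"
  define b where "b = (\<lambda>n. exp (h n *\<^sub>R (A + B)))"
  define c where "c = norm A + norm B"
  have h: "h \<longlonglongrightarrow> 0" "\<And>n. h n > 0" "\<And>n. h n \<noteq> 0"
    unfolding h_def using LIMSEQ_inverse_real_of_nat by (simp_all add: inverse_eq_divide)
  have D: "((\<lambda>t. exp (t *\<^sub>R A) * exp (t *\<^sub>R B) - exp (t *\<^sub>R (A + B))) has_vector_derivative 0) (at 0)"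
  proof -
    have "((\<lambda>t. exp (t *\<^sub>R A) * exp (t *\<^sub>R B)) has_vector_derivative A + B) (at 0)"
      using has_vector_derivative_mult[OF exp_scaleR_derivative_0[of A] exp_scaleR_derivative_0[of B]]
      by (simp add: add.commute)
    from has_vector_derivative_diff[OF this exp_scaleR_derivative_0[of "A + B"]] show ?thesis by simp
  qed
  have "((\<lambda>t. norm (exp (t *\<^sub>R A) * exp (t *\<^sub>R B) - exp (t *\<^sub>R (A + B))) / norm t) \<longlongrightarrow> 0) (at 0)"
    using D unfolding has_vector_derivative_def has_derivative_at by simp
  then have lim: "(\<lambda>n. norm (a n - b n) / norm (h n)) \<longlonglongrightarrow> 0"
    unfolding a_def b_def
    by (rule filterlim_compose) (use h in \<open>auto simp: filterlim_at\<close>)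
  have bound: "norm (a n ^ Suc n - b n ^ Suc n) \<le> exp c * (norm (a n - b n) / norm (h n))" for n
  proof -
    have hc: "h n * c \<ge> 0" using h(2)[of n] by (simp add: c_def)
    have "norm (a n) \<le> exp (norm (h n *\<^sub>R A)) * exp (norm (h n *\<^sub>R B))"
      unfolding a_def by (rule order_trans[OF norm_mult_ineq]) (intro mult_mono norm_exp, auto)
    then have 1: "norm (a n) \<le> exp (h n * c)"
      using h(2)[of n] by (simp add: c_def exp_add[symmetric] distrib_left)
    have "norm (b n) \<le> exp (norm (h n *\<^sub>R (A + B)))"
      unfolding b_def by (rule norm_exp)
    also have "\<dots> \<le> exp (h n * c)"
      using h(2)[of n] norm_triangle_ineq[of A B] by (simp add: c_def)
    finally have 2: "norm (b n) \<le> exp (h n * c)" .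
    have "norm (a n ^ Suc n - b n ^ Suc n) \<le> Suc n * exp (h n * c) ^ Suc n * norm (a n - b n)"
      by (rule power_difference_bound[OF 1 2]) (use hc in simp)
    also have "exp (h n * c) ^ Suc n = exp c"
      unfolding exp_of_nat_mult[symmetric] by (simp add: h_def)
    also have "Suc n * exp c * norm (a n - b n) = exp c * (norm (a n - b n) / norm (h n))"
      by (simp add: h_def)
    finally show ?thesis .
  qed
  have "(\<lambda>n. a n ^ Suc n - b n ^ Suc n) \<longlonglongrightarrow> 0"
  proof (rule Lim_null_comparison)
    show "(\<lambda>n. exp c * (norm (a n - b n) / norm (h n))) \<longlonglongrightarrow> 0"
      using tendsto_mult_right_zero[OF lim] by simp
  qed (use bound in auto)
  moreover have "b n ^ Suc n = exp (A + B)" for n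
  proof -
    have "exp Z ^ k = exp (real k *\<^sub>R Z)" for k and Z :: 'b
    proof (induction k)
      case (Suc k)
      have "exp (Z + real k *\<^sub>R Z) = exp Z * exp (real k *\<^sub>R Z)"
        by (rule exp_add_commuting) simp
      then show ?case using Suc by (simp add: scaleR_add_left add.commute)
    qed simp
    from this[of "h n *\<^sub>R (A + B)" "Suc n"] have "b n ^ Suc n = exp (real (Suc n) *\<^sub>R h n *\<^sub>R (A + B))"
      unfolding b_def .
    moreover have "real (Suc n) *\<^sub>R h n *\<^sub>R (A + B) = A + B"
      unfolding h_def by simp
    ultimately show ?thesis
      by (simp only:)
  qed
  ultimately have "(\<lambda>n. a n ^ Suc n - exp (A + B)) \<longlonglongrightarrow> 0"
    by (simp only:)
  then show ?thesis
    unfolding LIM_zero_iff a_def h_def .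
qed

section \<open>The Banach algebra of endomorphisms\<close>

text \<open>Bounded linear maps with composition as multiplication. Regarding matrices as elements of this Banach
  algebra brings them under the general theory of the exponential function.\<close>

typedef (overloaded) 'e endo = "UNIV :: ('e::euclidean_space \<Rightarrow>\<^sub>L 'e) set"
  morphisms blinfun_of Endo ..

lemmas blinfun_of_simps [simp] = Endo_inverse[OF UNIV_I] blinfun_of_inverse

instantiation endo :: (euclidean_space) real_normed_vector
begin

definition "0 = Endo 0"
definition "a + b = Endo (blinfun_of a + blinfun_of b)"
definition "- a = Endo (- blinfun_of a)"
definition "a - b = Endo (blinfun_of a - blinfun_of b)"
definition "r *\<^sub>R a = Endo (r *\<^sub>R blinfun_of a)"
definition "norm a = norm (blinfun_of a)"
definition "sgn a = (inverse (norm a) :: real) *\<^sub>R (a :: 'a endo)"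
definition "dist a b = norm (a - b :: 'a endo)"
definition "(uniformity :: ('a endo \<times> 'a endo) filter) = (INF e\<in>{0<..}. principal {(x, y). dist x y < e})"
definition "open (U :: 'a endo set) \<longleftrightarrow> (\<forall>x\<in>U. eventually (\<lambda>(x', y). x' = x \<longrightarrow> y \<in> U) uniformity)"

instance
proof
  fix a b c :: "'a endo" and r t :: real
  note ops = zero_endo_def plus_endo_def uminus_endo_def minus_endo_def scaleR_endo_def norm_endo_def
  show "a + b + c = a + (b + c)" "a + b = b + a" "0 + a = a" "- a + a = 0" "a - b = a + - b"
    by (simp_all add: ops add.assoc) (simp add: add.commute)
  show "r *\<^sub>R (a + b) = r *\<^sub>R a + r *\<^sub>R b" "(r + t) *\<^sub>R a = r *\<^sub>R a + t *\<^sub>R a"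
    "r *\<^sub>R t *\<^sub>R a = (r * t) *\<^sub>R a" "1 *\<^sub>R a = a"
    by (simp_all add: ops scaleR_add_right scaleR_add_left)
  have "blinfun_of a = 0 \<longleftrightarrow> a = 0"
    by (metis blinfun_of_simps zero_endo_def)
  then show "norm a = 0 \<longleftrightarrow> a = 0"
    by (simp add: norm_endo_def)
  show "norm (a + b) \<le> norm a + norm b" "norm (r *\<^sub>R a) = \<bar>r\<bar> * norm a"
    by (simp_all add: ops norm_triangle_ineq)
  show "sgn a = inverse (norm a) *\<^sub>R a" "dist a b = norm (a - b)"
    by (rule sgn_endo_def dist_endo_def)+
  show "(uniformity :: ('a endo \<times> 'a endo) filter) = (INF e\<in>{0<..}. principal {(x, y). dist x y < e})"
    by (rule uniformity_endo_def)
  show "open U \<longleftrightarrow> (\<forall>x\<in>U. eventually (\<lambda>(x', y). x' = x \<longrightarrow> y \<in> U) uniformity)" for U :: "'a endo set"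
    by (rule open_endo_def)
qed

end

instantiation endo :: (euclidean_space) real_normed_algebra_1
begin

definition "1 = Endo id_blinfun"
definition "a * b = Endo (blinfun_of a o\<^sub>L blinfun_of b)"

instance
proof
  fix a b c :: "'a endo" and r :: real
  show "a * b * c = a * (b * c)"
    by (simp add: times_endo_def Endo_inject) (rule blinfun_eqI, simp)
  show "(a + b) * c = a * c + b * c" "a * (b + c) = a * b + a * c"
    by (simp_all add: times_endo_def plus_endo_def bounded_bilinear.add_left[OF bounded_bilinear_blinfun_compose]
      bounded_bilinear.add_right[OF bounded_bilinear_blinfun_compose])
  show "r *\<^sub>R a * b = r *\<^sub>R (a * b)" "a * r *\<^sub>R b = r *\<^sub>R (a * b)"
    by (simp_all add: times_endo_def scaleR_endo_def bounded_bilinear.scaleR_left[OF bounded_bilinear_blinfun_compose]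
      bounded_bilinear.scaleR_right[OF bounded_bilinear_blinfun_compose])
  have "id_blinfun o\<^sub>L f = f" "f o\<^sub>L id_blinfun = f" for f :: "'a \<Rightarrow>\<^sub>L 'a"
    by (auto intro!: blinfun_eqI)
  then show "1 * a = a" "a * 1 = a"
    by (simp_all add: times_endo_def one_endo_def)
  show "norm (a * b) \<le> norm a * norm b"
    by (simp add: times_endo_def norm_endo_def norm_blinfun_compose)
  show one: "norm (1::'a endo) = 1"
    by (simp add: one_endo_def norm_endo_def)
  show "(0::'a endo) \<noteq> 1"
    using one by (metis norm_zero zero_neq_one)
qed

end

lemma bounded_linear_Endo: "bounded_linear Endo"
  by (rule bounded_linear_intro[of _ 1]) (simp_all add: plus_endo_def scaleR_endo_def norm_endo_def)

lemma bounded_linear_blinfun_of: "bounded_linear blinfun_of"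
  by (rule bounded_linear_intro[of _ 1]) (simp_all add: plus_endo_def scaleR_endo_def norm_endo_def)

instance endo :: (euclidean_space) banach
proof
  fix X :: "nat \<Rightarrow> 'a endo"
  assume "Cauchy X"
  then have "Cauchy (\<lambda>n. blinfun_of (X n))"
    by (rule bounded_linear.Cauchy[OF bounded_linear_blinfun_of])
  then obtain l where "(\<lambda>n. blinfun_of (X n)) \<longlonglongrightarrow> l"
    using Cauchy_convergent convergent_def by blast
  then have "(\<lambda>n. Endo (blinfun_of (X n))) \<longlonglongrightarrow> Endo l"
    by (rule bounded_linear.tendsto[OF bounded_linear_Endo])
  then show "convergent X"
    by (auto simp: convergent_def)
qed

definition mat_endo :: "'a::{euclidean_space, real_normed_field}^'n::finite^'n \<Rightarrow> ('a^'n) endo" where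
  "mat_endo A = Endo (Blinfun ((*v) A))"

text \<open>A continuous left inverse of \<open>mat_endo\<close>, by which limits and derivatives are carried back to matrices.\<close>

definition endo_mat :: "('a::{euclidean_space, real_normed_field}^'n::finite) endo \<Rightarrow> 'a^'n^'n" where
  "endo_mat f = (\<chi> i j. blinfun_apply (blinfun_of f) (axis j 1) $ i)"

lemma blinfun_of_mat_endo: 
  fixes A :: "'a::{euclidean_space, real_normed_field}^'n::finite^'n"
  shows "blinfun_apply (blinfun_of (mat_endo A)) v = A *v v"
proof -
  have "linear ((*v) A)"
    by (intro linearI)
      (simp_all add: vec_eq_iff matrix_vector_mult_def scaleR_sum_right distrib_left sum.distrib)
  then have "bounded_linear ((*v) A)"
    by (simp add: linear_linear)
  then show ?thesis
    by (simp add: mat_endo_def bounded_linear_Blinfun_apply)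
qed

lemma endo_eqI: "(\<And>v. blinfun_apply (blinfun_of f) v = blinfun_apply (blinfun_of g) v) \<Longrightarrow> f = g"
  by (metis blinfun_eqI blinfun_of_inject)

lemma blinfun_of_plus: "blinfun_of (f + g) = blinfun_of f + blinfun_of g"
  and blinfun_of_times: "blinfun_of (f * g) = blinfun_of f o\<^sub>L blinfun_of g"
  and blinfun_of_scaleR: "blinfun_of (r *\<^sub>R f) = r *\<^sub>R blinfun_of f"
  and blinfun_of_one: "blinfun_of 1 = id_blinfun"
  by (simp_all add: plus_endo_def times_endo_def scaleR_endo_def one_endo_def)

lemma endo_mat_inverse [simp]: "endo_mat (mat_endo A) = A"
  by (simp add: endo_mat_def blinfun_of_mat_endo vec_eq_iff matrix_vector_mult_def axis_def
      if_distrib[of "times _"] cong: if_cong)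

lemma linear_mat_endo: "linear mat_endo"
  by (intro linearI endo_eqI)
     (simp_all add: blinfun_of_plus blinfun_of_scaleR blinfun_of_mat_endo plus_blinfun.rep_eq scaleR_blinfun.rep_eq
       matrix_vector_mult_add_rdistrib, simp add: vec_eq_iff matrix_vector_mult_def scaleR_sum_right)

lemma bounded_linear_mat_endo: "bounded_linear mat_endo"
  by (rule linear_conv_bounded_linear[THEN iffD1, OF linear_mat_endo])

lemma mat_endo_mult: "mat_endo (A ** B) = mat_endo A * mat_endo B"
  by (rule endo_eqI) (simp add: blinfun_of_mat_endo blinfun_of_times matrix_vector_mul_assoc)

lemma mat_endo_one: "mat_endo (mat 1) = 1"
  by (rule endo_eqI) (simp add: blinfun_of_mat_endo blinfun_of_one)

lemma bounded_linear_endo_mat: "bounded_linear endo_mat"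
proof -
  have entry: "norm (endo_mat f $ i $ j) \<le> norm f" for f :: "('a^'n) endo" and i j
  proof -
    have "norm (endo_mat f $ i $ j) \<le> norm (blinfun_apply (blinfun_of f) (axis j 1))"
      unfolding endo_mat_def vec_lambda_beta by (rule Finite_Cartesian_Product.norm_nth_le)
    also have "\<dots> \<le> norm (blinfun_of f) * norm (axis j 1 :: 'a^'n)"
      by (rule norm_blinfun)
    also have "norm (axis j 1 :: 'a^'n) = 1"
      by (simp add: norm_vec_def L2_set_def axis_def if_distrib[of norm] if_distrib[of "\<lambda>x. x\<^sup>2"] cong: if_cong)
    finally show ?thesis by (simp add: norm_endo_def)
  qed
  have "norm (endo_mat f) \<le> norm f * (real CARD('n) * real CARD('n))" for f :: "('a^'n) endo"
  proof -
    have "norm (endo_mat f) \<le> (\<Sum>i\<in>UNIV. norm (endo_mat f $ i))"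
      unfolding norm_vec_def[of "endo_mat f"] by (rule L2_set_le_sum) simp
    also have "\<dots> \<le> (\<Sum>i\<in>UNIV. \<Sum>j\<in>UNIV. norm (endo_mat f $ i $ j))"
      by (rule sum_mono, subst (1) norm_vec_def, rule L2_set_le_sum) simp
    also have "\<dots> \<le> (\<Sum>i\<in>(UNIV::'n set). \<Sum>j\<in>(UNIV::'n set). norm f)"
      by (intro sum_mono entry)
    finally show ?thesis by (simp add: mult_ac)
  qed
  then show ?thesis
    by (intro bounded_linear_intro[of _ "real CARD('n) * real CARD('n)"])
       (simp_all add: endo_mat_def vec_eq_iff blinfun_of_plus blinfun_of_scaleR plus_blinfun.rep_eq scaleR_blinfun.rep_eq)
qed

lemma inj_mat_endo: "mat_endo A = mat_endo B \<Longrightarrow> A = B"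
  by (metis endo_mat_inverse)

section \<open>Matrix Lie groups and their homomorphisms\<close>

definition mat_pow :: "'n::finite rmat \<Rightarrow> nat \<Rightarrow> 'n rmat" where
  "mat_pow A k = ((**) A ^^ k) (mat 1)"

lemma mat_endo_pow: "mat_endo (mat_pow A k) = mat_endo A ^ k"
  by (induction k) (simp_all add: mat_pow_def mat_endo_one mat_endo_mult)

lemma mat_endo_scaleR: "mat_endo (r *\<^sub>R A) = r *\<^sub>R mat_endo A"
  by (rule linear_scale[OF linear_mat_endo])
lemma mat_endo_add: "mat_endo (A + B) = mat_endo A + mat_endo B"
  by (rule linear_add[OF linear_mat_endo])
lemma mat_endo_diff: "mat_endo (A - B) = mat_endo A - mat_endo B"
  by (rule linear_diff[OF linear_mat_endo])

lemma mat_endo_brk: "mat_endo (brk A B) = mat_endo A * mat_endo B - mat_endo B * mat_endo A"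
  by (simp add: brk_def mat_endo_diff mat_endo_mult)

lemma mat_endo_mexp: "mat_endo (mexp A) = exp (mat_endo A)"
proof -
  define f where "f = (\<lambda>k. (1 / fact k) *\<^sub>R mat_pow A k)"
  have f: "mat_endo (f k) = (1 / fact k) *\<^sub>R mat_endo A ^ k" for k
    by (simp add: f_def mat_endo_scaleR mat_endo_pow)
  have "summable (\<lambda>k. mat_endo (f k))"
    unfolding f using summable_exp_generic[of "mat_endo A"] by (simp add: divide_inverse)
  then have "summable (\<lambda>k. endo_mat (mat_endo (f k)))"
    by (rule bounded_linear.summable[OF bounded_linear_endo_mat])
  then have s: "summable f" by simp
  have "mat_endo (suminf f) = suminf (\<lambda>k. mat_endo (f k))"
    by (rule bounded_linear.suminf[OF bounded_linear_mat_endo s])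
  also have "\<dots> = exp (mat_endo A)"
    unfolding f exp_def by (simp add: divide_inverse)
  finally show ?thesis
    unfolding mexp_def f_def mat_pow_def .
qed

lemma mexp_eq: "mexp A = endo_mat (exp (mat_endo A))"
  by (metis endo_mat_inverse mat_endo_mexp)

lemma mexp_zero [simp]: "mexp 0 = mat 1"
  by (metis endo_mat_inverse exp_zero linear_0 linear_mat_endo mat_endo_one mexp_eq)

lemma mexp_add: "mexp ((s + t) *\<^sub>R X) = mexp (s *\<^sub>R X) ** mexp (t *\<^sub>R X)"
proof (rule inj_mat_endo)
  have "exp ((s + t) *\<^sub>R mat_endo X) = exp (s *\<^sub>R mat_endo X) * exp (t *\<^sub>R mat_endo X)"
    unfolding scaleR_add_left by (rule exp_add_commuting) simp
  then show "mat_endo (mexp ((s + t) *\<^sub>R X)) = mat_endo (mexp (s *\<^sub>R X) ** mexp (t *\<^sub>R X))"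
    by (simp add: mat_endo_mexp mat_endo_mult mat_endo_scaleR)
qed

lemma mexp_inverse: "mexp X ** mexp (- X) = mat 1" "mexp (- X) ** mexp X = mat 1"
  using mexp_add[of 1 "-1" X] mexp_add[of "-1" 1 X] by simp_all

lemma matrix_inv_inverse:
  assumes "invertible (A :: 'n::finite rmat)"
  shows "A ** matrix_inv A = mat 1" "matrix_inv A ** A = mat 1"
  using assms someI_ex[of "\<lambda>B. A ** B = mat 1 \<and> B ** A = mat 1"]
  unfolding invertible_def matrix_inv_def by blast+

lemma matrix_inv_unique:
  fixes A B :: "'n::finite rmat"
  assumes "A ** B = mat 1" "B ** A = mat 1"
  shows "matrix_inv A = B"
proof -
  have "invertible A" using assms unfolding invertible_def by blast
  then have "B ** (A ** matrix_inv A) = B"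
    by (simp add: matrix_inv_inverse)
  then show ?thesis
    by (simp add: matrix_mul_assoc assms)
qed

lemma matrix_inv_mexp: "matrix_inv (mexp X) = mexp (- X)"
  by (rule matrix_inv_unique[OF mexp_inverse])

lemma continuous_mexp: "continuous_on UNIV (\<lambda>t. mexp (t *\<^sub>R X))"
proof -
  have "continuous_on UNIV (\<lambda>t. endo_mat (exp (t *\<^sub>R mat_endo X)))"
    by (intro bounded_linear.continuous_on[OF bounded_linear_endo_mat] continuous_at_imp_continuous_on ballI
        has_vector_derivative_continuous[OF exp_scaleR_has_vector_derivative_right])
  then show ?thesis
    by (simp add: mexp_eq mat_endo_scaleR)
qed

lemma mexp_derivative: "((\<lambda>t. mexp (t *\<^sub>R X)) has_vector_derivative X) (at 0)"
  using bounded_linear.has_vector_derivative[OF bounded_linear_endo_mat exp_scaleR_derivative_0[of "mat_endo X"]]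
  by (simp add: mexp_eq mat_endo_scaleR)

text \<open>Such projections extend linear maps from a subspace to the whole space, where they are bounded.\<close>

lemma linear_subspace_projection:
  fixes V :: "'v::euclidean_space set"
  assumes "subspace V"
  shows "\<exists>P. linear P \<and> (\<forall>v. P v \<in> V) \<and> (\<forall>v\<in>V. P v = v)"
  using linear_exists_left_inverse_on[OF linear_id assms] by (auto simp: image_subset_iff)

locale matrix_group =
  fixes G :: "'n::finite rmat set"
  assumes lie_group: "matrix_lie_group G"
begin

lemma one_mem: "mat 1 \<in> G" and mult_mem: "g \<in> G \<Longrightarrow> h \<in> G \<Longrightarrow> g ** h \<in> G"
  and inv_mem: "g \<in> G \<Longrightarrow> matrix_inv g \<in> G" and invertible: "g \<in> G \<Longrightarrow> invertible g"
  using lie_group unfolding matrix_lie_group_def matrix_subgroup_def by auto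

lemma inverse_mult: "g \<in> G \<Longrightarrow> g ** matrix_inv g = mat 1" "g \<in> G \<Longrightarrow> matrix_inv g ** g = mat 1"
  by (simp_all add: matrix_inv_inverse invertible)

lemma pow_mem: "g \<in> G \<Longrightarrow> mat_pow g k \<in> G"
  by (induction k) (auto simp: mat_pow_def one_mem mult_mem)

lemma limit_mem:
  assumes "\<And>k. a k \<in> G" "a \<longlonglongrightarrow> l" "invertible l"
  shows "l \<in> G"
proof -
  obtain T where "closed T" "G = {A. invertible A} \<inter> T"
    using lie_group unfolding matrix_lie_group_def closedin_closed by blast
  moreover have "l \<in> T"
    by (rule closed_sequentially[OF \<open>closed T\<close> _ assms(2)]) (use assms(1) calculation in blast)
  ultimately show ?thesis
    using assms(3) by blast
qed

abbreviation "\<gg> \<equiv> lie_algebra G"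

lemma mexp_mem: "X \<in> \<gg> \<Longrightarrow> mexp (t *\<^sub>R X) \<in> G"
  by (simp add: lie_algebra_def)

lemma lie_scaleR: "X \<in> \<gg> \<Longrightarrow> c *\<^sub>R X \<in> \<gg>"
  by (simp add: lie_algebra_def)

lemma lie_zero: "0 \<in> \<gg>"
  by (simp add: lie_algebra_def one_mem)

lemma lie_Ad:
  assumes "g \<in> G" "X \<in> \<gg>"
  shows "mexp (t *\<^sub>R (g ** X ** matrix_inv g)) = g ** mexp (t *\<^sub>R X) ** matrix_inv g"
    and "g ** X ** matrix_inv g \<in> \<gg>"
proof -
  define a b where "a = mat_endo g" and "b = mat_endo (matrix_inv g)"
  have ba: "b * a = 1"
    unfolding a_def b_def by (simp add: inverse_mult assms mat_endo_one flip: mat_endo_mult)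
  have ab: "a * b = 1"
    unfolding a_def b_def by (simp add: inverse_mult assms mat_endo_one flip: mat_endo_mult)
  have pow: "(a * Y * b) ^ k = a * Y ^ k * b" for Y k
  proof (induction k)
    case (Suc k)
    have "a * Y * b * (a * Y ^ k * b) = a * Y * (b * a) * Y ^ k * b"
      by (simp only: mult.assoc)
    then show ?case using Suc by (simp add: ba mult.assoc)
  qed (simp add: ab)
  have exp: "exp (a * Y * b) = a * exp Y * b" for Y
  proof -
    have "(\<lambda>k. a * (Y ^ k /\<^sub>R fact k) * b) sums (a * exp Y * b)"
      by (intro sums_mult sums_mult2 exp_converges)
    then have "(\<lambda>k. (a * Y * b) ^ k /\<^sub>R fact k) sums (a * exp Y * b)"
      by (simp add: pow)
    then show ?thesis
      by (rule sums_unique2[OF exp_converges])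
  qed
  have "mat_endo (mexp (t *\<^sub>R (g ** X ** matrix_inv g))) = mat_endo (g ** mexp (t *\<^sub>R X) ** matrix_inv g)" for t
    using exp[of "t *\<^sub>R mat_endo X"]
    by (simp add: mat_endo_mexp mat_endo_mult mat_endo_scaleR a_def b_def)
  then have *: "mexp (t *\<^sub>R (g ** X ** matrix_inv g)) = g ** mexp (t *\<^sub>R X) ** matrix_inv g" for t
    by (rule inj_mat_endo)
  show "mexp (t *\<^sub>R (g ** X ** matrix_inv g)) = g ** mexp (t *\<^sub>R X) ** matrix_inv g"
    by (rule *)
  show "g ** X ** matrix_inv g \<in> \<gg>"
    unfolding lie_algebra_def by (simp add: * mult_mem inv_mem mexp_mem assms)
qed

text \<open>The approximants of Trotter's formula lie in \<open>G\<close>, which is closed in \<open>GL(n, \<real>)\<close>.\<close>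

definition trotter :: "'n rmat \<Rightarrow> 'n rmat \<Rightarrow> nat \<Rightarrow> 'n rmat" where
  "trotter X Y k = mat_pow (mexp ((1 / real (Suc k)) *\<^sub>R X) ** mexp ((1 / real (Suc k)) *\<^sub>R Y)) (Suc k)"

lemma trotter_mem: "X \<in> \<gg> \<Longrightarrow> Y \<in> \<gg> \<Longrightarrow> trotter X Y k \<in> G"
  unfolding trotter_def by (intro pow_mem mult_mem mexp_mem)

lemma trotter_limit: "trotter X Y \<longlonglongrightarrow> mexp (X + Y)"
proof -
  have "(\<lambda>k. endo_mat (mat_endo (trotter X Y k))) \<longlonglongrightarrow> endo_mat (exp (mat_endo X + mat_endo Y))"
    unfolding trotter_def mat_endo_pow mat_endo_mult mat_endo_mexp mat_endo_scaleR
    by (rule bounded_linear.tendsto[OF bounded_linear_endo_mat trotter_product])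
  then show ?thesis
    by (simp add: mexp_eq mat_endo_add)
qed

lemma lie_add:
  assumes "X \<in> \<gg>" "Y \<in> \<gg>"
  shows "X + Y \<in> \<gg>"
proof -
  have "mexp (t *\<^sub>R X + t *\<^sub>R Y) \<in> G" for t
  proof (rule limit_mem[OF _ trotter_limit])
    show "trotter (t *\<^sub>R X) (t *\<^sub>R Y) k \<in> G" for k
      using assms lie_scaleR by (intro trotter_mem)
    show "invertible (mexp (t *\<^sub>R X + t *\<^sub>R Y))"
      using mexp_inverse unfolding invertible_def by blast
  qed
  then show ?thesis
    by (simp add: lie_algebra_def scaleR_add_right)
qed

lemma lie_subspace: "subspace \<gg>"
  by (simp add: subspace_def lie_zero lie_add lie_scaleR)

text \<open>The curve \<open>s \<mapsto> Ad(exp(sX)) Y\<close>, whose derivative at \<open>0\<close> is \<open>[X, Y]\<close>.\<close>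

definition Ad_curve :: "'n rmat \<Rightarrow> 'n rmat \<Rightarrow> real \<Rightarrow> 'n rmat" where
  "Ad_curve X Y s = mexp (s *\<^sub>R X) ** Y ** mexp (- (s *\<^sub>R X))"

lemma Ad_curve_mem: "X \<in> \<gg> \<Longrightarrow> Y \<in> \<gg> \<Longrightarrow> Ad_curve X Y s \<in> \<gg>"
  unfolding Ad_curve_def using lie_Ad(2)[OF mexp_mem] by (simp add: matrix_inv_mexp)

lemma Ad_curve_derivative: "(Ad_curve X Y has_vector_derivative brk X Y) (at 0)"
proof -
  have "Ad_curve X Y = (\<lambda>s. endo_mat (exp (s *\<^sub>R mat_endo X) * mat_endo Y * exp (- (s *\<^sub>R mat_endo X))))"
  proof
    fix s
    have "mat_endo (Ad_curve X Y s) = exp (s *\<^sub>R mat_endo X) * mat_endo Y * exp (- (s *\<^sub>R mat_endo X))"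
      by (simp add: Ad_curve_def mat_endo_mult mat_endo_mexp mat_endo_scaleR linear_neg[OF linear_mat_endo])
    then show "Ad_curve X Y s = endo_mat (exp (s *\<^sub>R mat_endo X) * mat_endo Y * exp (- (s *\<^sub>R mat_endo X)))"
      by (metis endo_mat_inverse)
  qed
  moreover have "endo_mat (mat_endo X * mat_endo Y - mat_endo Y * mat_endo X) = brk X Y"
    by (simp flip: mat_endo_brk)
  ultimately show ?thesis
    using bounded_linear.has_vector_derivative[OF bounded_linear_endo_mat exp_conjugation_derivative[of "mat_endo X" "mat_endo Y"]]
    by simp
qed

lemma subspace_derivative_mem:
  assumes "subspace V" "\<And>s. c s \<in> V" "(c has_vector_derivative D) (at (0::real))"
  shows "D \<in> (V :: 'v::euclidean_space set)"
proof -
  obtain P where P: "linear P" "\<And>v. P v \<in> V" "\<And>v. v \<in> V \<Longrightarrow> P v = v"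
    using linear_subspace_projection[OF assms(1)] by blast
  have "((\<lambda>s. P (c s)) has_vector_derivative P D) (at 0)"
    by (rule bounded_linear.has_vector_derivative[OF _ assms(3)])
       (simp add: linear_conv_bounded_linear[symmetric] P)
  then have "P D = D"
    by (intro vector_derivative_unique_at[OF _ assms(3)]) (simp only: P(3)[OF assms(2)])
  then show ?thesis using P(2) by metis
qed

lemma lie_brk: "X \<in> \<gg> \<Longrightarrow> Y \<in> \<gg> \<Longrightarrow> brk X Y \<in> \<gg>"
  by (rule subspace_derivative_mem[OF lie_subspace Ad_curve_mem Ad_curve_derivative])

end

text \<open>Continuous homomorphisms of \<open>G\<close> into the units of a Banach algebra.\<close>

locale group_hom = matrix_group G
  for G :: "'n::finite rmat set" +
  fixes \<phi> :: "'n rmat \<Rightarrow> 'b::{real_normed_algebra_1,banach}"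
  assumes cont: "continuous_on G \<phi>" and one: "\<phi> (mat 1) = 1"
    and mult: "g \<in> G \<Longrightarrow> h \<in> G \<Longrightarrow> \<phi> (g ** h) = \<phi> g * \<phi> h"
begin

definition D :: "'n rmat \<Rightarrow> 'b" where
  "D X = (THE C. \<forall>t. \<phi> (mexp (t *\<^sub>R X)) = exp (t *\<^sub>R C))"

lemma hom_exp:
  assumes X: "X \<in> \<gg>"
  shows "\<phi> (mexp (t *\<^sub>R X)) = exp (t *\<^sub>R D X)"
proof -
  have "\<exists>C. \<forall>t. \<phi> (mexp (t *\<^sub>R X)) = exp (t *\<^sub>R C)"
  proof (rule one_parameter_group)
    show "\<phi> (mexp (0 *\<^sub>R X)) = 1" by (simp add: one)
    show "\<phi> (mexp ((s + t) *\<^sub>R X)) = \<phi> (mexp (s *\<^sub>R X)) * \<phi> (mexp (t *\<^sub>R X))" for s t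
      by (simp add: mexp_add mult mexp_mem X)
    show "continuous_on UNIV (\<lambda>t. \<phi> (mexp (t *\<^sub>R X)))"
      by (rule continuous_on_compose2[OF cont continuous_mexp]) (use X mexp_mem in auto)
  qed
  then obtain C where C: "\<And>t. \<phi> (mexp (t *\<^sub>R X)) = exp (t *\<^sub>R C)" by blast
  have "D X = C"
    unfolding D_def
  proof (rule the_equality)
    fix C'
    assume *: "\<forall>t. \<phi> (mexp (t *\<^sub>R X)) = exp (t *\<^sub>R C')"
    show "C' = C"
      by (rule exp_scaleR_inject) (simp only: C[symmetric] *)
  qed (simp add: C)
  then show ?thesis using C by simp
qed

lemma D_unique: "X \<in> \<gg> \<Longrightarrow> (\<And>t. \<phi> (mexp (t *\<^sub>R X)) = exp (t *\<^sub>R C)) \<Longrightarrow> D X = C"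
  by (rule exp_scaleR_inject) (simp flip: hom_exp)

lemma hom_derivative:
  assumes "X \<in> \<gg>"
  shows "((\<lambda>t. \<phi> (mexp (t *\<^sub>R X))) has_vector_derivative D X) (at 0)"
  unfolding hom_exp[OF assms] by (rule exp_scaleR_derivative_0)

lemma D_scaleR: "X \<in> \<gg> \<Longrightarrow> D (c *\<^sub>R X) = c *\<^sub>R D X"
  by (rule D_unique) (simp_all add: lie_scaleR hom_exp)

lemma hom_pow: "g \<in> G \<Longrightarrow> \<phi> (mat_pow g k) = \<phi> g ^ k"
proof (induction k)
  case (Suc k)
  then show ?case using mult[OF Suc.prems pow_mem[OF Suc.prems, of k]] by (simp add: mat_pow_def)
qed (simp add: mat_pow_def one)

text \<open>Apply \<open>\<phi>\<close> to the approximants of Trotter's formula.\<close>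

lemma D_add:
  assumes "X \<in> \<gg>" "Y \<in> \<gg>"
  shows "D (X + Y) = D X + D Y"
proof (rule D_unique[OF lie_add[OF assms]])
  fix t
  have mem: "t *\<^sub>R X \<in> \<gg>" "t *\<^sub>R Y \<in> \<gg>" using assms lie_scaleR by auto
  have G: "mexp (t *\<^sub>R X + t *\<^sub>R Y) \<in> G"
    using mexp_mem[OF lie_add[OF mem], of 1] by simp
  have "(\<lambda>k. \<phi> (trotter (t *\<^sub>R X) (t *\<^sub>R Y) k)) \<longlonglongrightarrow> \<phi> (mexp (t *\<^sub>R X + t *\<^sub>R Y))"
    by (rule continuous_on_tendsto_compose[OF cont trotter_limit G]) (simp add: trotter_mem mem)
  moreover have "\<phi> (trotter (t *\<^sub>R X) (t *\<^sub>R Y) k) =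
      (exp ((1 / real (Suc k)) *\<^sub>R (t *\<^sub>R D X)) * exp ((1 / real (Suc k)) *\<^sub>R (t *\<^sub>R D Y))) ^ Suc k" for k
  proof -
    define r where "r = 1 / real (Suc k)"
    have ab: "mexp (r *\<^sub>R (t *\<^sub>R X)) \<in> G" "mexp (r *\<^sub>R (t *\<^sub>R Y)) \<in> G"
      using mexp_mem[OF mem(1)] mexp_mem[OF mem(2)] by auto
    have "\<phi> (mat_pow (mexp (r *\<^sub>R (t *\<^sub>R X)) ** mexp (r *\<^sub>R (t *\<^sub>R Y))) (Suc k)) =
        (\<phi> (mexp (r *\<^sub>R (t *\<^sub>R X))) * \<phi> (mexp (r *\<^sub>R (t *\<^sub>R Y)))) ^ Suc k"
      by (simp only: hom_pow[OF mult_mem[OF ab]] mult[OF ab])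
    then show ?thesis
      unfolding trotter_def r_def[symmetric] hom_exp[OF mem(1)] hom_exp[OF mem(2)]
        D_scaleR[OF assms(1)] D_scaleR[OF assms(2)] .
  qed
  moreover have "(\<lambda>k. (exp ((1 / real (Suc k)) *\<^sub>R (t *\<^sub>R D X)) * exp ((1 / real (Suc k)) *\<^sub>R (t *\<^sub>R D Y))) ^ Suc k)
      \<longlonglongrightarrow> exp (t *\<^sub>R D X + t *\<^sub>R D Y)"
    by (rule trotter_product)
  ultimately have "\<phi> (mexp (t *\<^sub>R X + t *\<^sub>R Y)) = exp (t *\<^sub>R D X + t *\<^sub>R D Y)"
    by (intro LIMSEQ_unique[of "\<lambda>k. \<phi> (trotter (t *\<^sub>R X) (t *\<^sub>R Y) k)"]) (simp_all only:)
  then show "\<phi> (mexp (t *\<^sub>R (X + Y))) = exp (t *\<^sub>R (D X + D Y))"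
    by (simp add: scaleR_add_right)
qed

lemma D_Ad_curve:
  assumes "X \<in> \<gg>" "Y \<in> \<gg>"
  shows "D (Ad_curve X Y s) = exp (s *\<^sub>R D X) * D Y * exp (- (s *\<^sub>R D X))"
proof -
  define g where "g = mexp (s *\<^sub>R X)"
  have g: "g \<in> G" and inv: "matrix_inv g = mexp (- s *\<^sub>R X)" 
    by (simp_all add: g_def mexp_mem assms matrix_inv_mexp)
  have c: "Ad_curve X Y s = g ** Y ** matrix_inv g"
    by (simp add: Ad_curve_def g_def matrix_inv_mexp)
  have \<phi>: "\<phi> g = exp (s *\<^sub>R D X)" "\<phi> (matrix_inv g) = exp (- (s *\<^sub>R D X))"
    using hom_exp[OF assms(1), of s] hom_exp[OF assms(1), of "- s"] unfolding g_def inv[unfolded g_def] by simp_all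
  have "((\<lambda>t. \<phi> (mexp (t *\<^sub>R (Ad_curve X Y s)))) has_vector_derivative D (Ad_curve X Y s)) (at 0)"
    by (rule hom_derivative[OF Ad_curve_mem[OF assms]])
  moreover have "\<phi> (mexp (t *\<^sub>R (Ad_curve X Y s))) = \<phi> g * \<phi> (mexp (t *\<^sub>R Y)) * \<phi> (matrix_inv g)" for t
    unfolding c lie_Ad(1)[OF g assms(2)] by (simp add: mult mult_mem g inv_mem mexp_mem assms)
  moreover have "((\<lambda>t. \<phi> g * \<phi> (mexp (t *\<^sub>R Y)) * \<phi> (matrix_inv g)) has_vector_derivative \<phi> g * D Y * \<phi> (matrix_inv g)) (at 0)"
    by (intro has_vector_derivative_mult_left has_vector_derivative_mult_right hom_derivative assms)
  ultimately have "D (Ad_curve X Y s) = \<phi> g * D Y * \<phi> (matrix_inv g)"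
    by (intro vector_derivative_unique_at[of "\<lambda>t. \<phi> g * \<phi> (mexp (t *\<^sub>R Y)) * \<phi> (matrix_inv g)"])
      (simp_all only:)
  then show ?thesis unfolding \<phi> .
qed

text \<open>Differentiate \<open>D (Ad(exp(sX)) Y) = exp(s D X) D Y exp(- s D X)\<close> at \<open>s = 0\<close>; since \<open>D\<close> is linear on a
  finite-dimensional space, it commutes with the derivative.\<close>

lemma D_brk:
  assumes "X \<in> \<gg>" "Y \<in> \<gg>"
  shows "D (brk X Y) = D X * D Y - D Y * D X"
proof -
  obtain P where P: "linear P" "\<And>v. P v \<in> \<gg>" "\<And>v. v \<in> \<gg> \<Longrightarrow> P v = v"
    using linear_subspace_projection[OF lie_subspace] by blast
  have "linear (\<lambda>v. D (P v))"
    by (intro linearI) (simp_all add: linear_add[OF P(1)] linear_scale[OF P(1)] D_add D_scaleR P(2))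
  then have "bounded_linear (\<lambda>v. D (P v))"
    by (simp add: linear_conv_bounded_linear)
  from bounded_linear.has_vector_derivative[OF this Ad_curve_derivative[of X Y]]
  have "((\<lambda>s. D (P (Ad_curve X Y s))) has_vector_derivative D (P (brk X Y))) (at 0)" .
  then have "((\<lambda>s. exp (s *\<^sub>R D X) * D Y * exp (- (s *\<^sub>R D X))) has_vector_derivative D (brk X Y)) (at 0)"
    by (simp add: P(3) Ad_curve_mem assms lie_brk D_Ad_curve)
  then show ?thesis
    by (rule vector_derivative_unique_at) (rule exp_conjugation_derivative)
qed

end

section \<open>Differentials and involutions\<close>

locale matrix_hom = matrix_group G
  for G :: "'n::finite rmat set" +
  fixes \<sigma> :: "'n rmat \<Rightarrow> 'a::{euclidean_space, real_normed_field}^'k::finite^'k"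
  assumes cont_hom: "continuous_on G \<sigma>" and hom_one: "\<sigma> (mat 1) = mat 1"
    and hom_mult: "g \<in> G \<Longrightarrow> h \<in> G \<Longrightarrow> \<sigma> (g ** h) = \<sigma> g ** \<sigma> h"
begin

sublocale endo: group_hom G "\<lambda>g. mat_endo (\<sigma> g)"
proof
  show "continuous_on G (\<lambda>g. mat_endo (\<sigma> g))"
    by (rule bounded_linear.continuous_on[OF bounded_linear_mat_endo cont_hom])
qed (simp_all add: hom_one hom_mult mat_endo_one mat_endo_mult)

lemma has_differential:
  assumes "X \<in> \<gg>"
  shows "((\<lambda>t. \<sigma> (mexp (t *\<^sub>R X))) has_vector_derivative differential \<sigma> X) (at 0)"
proof -
  have "((\<lambda>t. endo_mat (mat_endo (\<sigma> (mexp (t *\<^sub>R X))))) has_vector_derivative endo_mat (endo.D X)) (at 0)"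
    by (rule bounded_linear.has_vector_derivative[OF bounded_linear_endo_mat endo.hom_derivative[OF assms]])
  then have "((\<lambda>t. \<sigma> (mexp (t *\<^sub>R X))) has_vector_derivative endo_mat (endo.D X)) (at 0)"
    by simp
  moreover from this have "differential \<sigma> X = endo_mat (endo.D X)"
    unfolding differential_def by (rule vector_derivative_at)
  ultimately show ?thesis by simp
qed

lemma mat_endo_differential:
  assumes "X \<in> \<gg>"
  shows "mat_endo (differential \<sigma> X) = endo.D X"
  by (rule vector_derivative_unique_at[OF bounded_linear.has_vector_derivative[OF bounded_linear_mat_endo
        has_differential[OF assms]] endo.hom_derivative[OF assms]])

lemma mat_endo_hom_mexp:
  assumes "X \<in> \<gg>"
  shows "mat_endo (\<sigma> (mexp (t *\<^sub>R X))) = exp (t *\<^sub>R mat_endo (differential \<sigma> X))"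
  by (simp add: mat_endo_differential endo.hom_exp assms)

lemma differential_add:
  "X \<in> \<gg> \<Longrightarrow> Y \<in> \<gg> \<Longrightarrow> differential \<sigma> (X + Y) = differential \<sigma> X + differential \<sigma> Y"
  by (rule inj_mat_endo) (simp add: mat_endo_differential mat_endo_add endo.D_add lie_add)

lemma differential_scaleR:
  "X \<in> \<gg> \<Longrightarrow> differential \<sigma> (c *\<^sub>R X) = c *\<^sub>R differential \<sigma> X"
  by (rule inj_mat_endo) (simp add: mat_endo_differential mat_endo_scaleR endo.D_scaleR lie_scaleR)

lemma differential_brk:
  "X \<in> \<gg> \<Longrightarrow> Y \<in> \<gg> \<Longrightarrow> differential \<sigma> (brk X Y) = brk (differential \<sigma> X) (differential \<sigma> Y)"
  by (rule inj_mat_endo) (simp add: mat_endo_differential mat_endo_brk endo.D_brk lie_brk)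

end

locale matrix_involution = matrix_group G
  for G :: "'n::finite rmat set" +
  fixes \<sigma> :: "'n rmat \<Rightarrow> 'n rmat"
  assumes involution: "involutive_automorphism G \<sigma>"
begin

lemma image_mem: "g \<in> G \<Longrightarrow> \<sigma> g \<in> G"
  and image_mult: "g \<in> G \<Longrightarrow> h \<in> G \<Longrightarrow> \<sigma> (g ** h) = \<sigma> g ** \<sigma> h"
  and involutive: "g \<in> G \<Longrightarrow> \<sigma> (\<sigma> g) = g"
  using involution unfolding involutive_automorphism_def by auto

lemma image_one: "\<sigma> (mat 1) = mat 1"
proof -
  define e where "e = \<sigma> (mat 1)"
  have e: "e \<in> G" "e ** e = e"
    unfolding e_def by (simp_all add: image_mem one_mem flip: image_mult)
  have "matrix_inv e ** (e ** e) = matrix_inv e ** e"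
    by (simp only: e)
  then have "e = mat 1"
    by (simp add: matrix_mul_assoc inverse_mult e(1))
  then show ?thesis by (simp add: e_def)
qed

sublocale matrix_hom G \<sigma>
  by unfold_locales
    (use involution image_mult image_one in \<open>auto simp: involutive_automorphism_def\<close>)

abbreviation "d \<equiv> differential \<sigma>"

lemma image_mexp: "X \<in> \<gg> \<Longrightarrow> \<sigma> (mexp (t *\<^sub>R X)) = mexp (t *\<^sub>R d X)"
  by (rule inj_mat_endo) (simp add: mat_endo_hom_mexp mat_endo_mexp mat_endo_scaleR)

lemma d_mem: "X \<in> \<gg> \<Longrightarrow> d X \<in> \<gg>"
proof -
  assume X: "X \<in> \<gg>"
  have "mexp (t *\<^sub>R d X) \<in> G" for t
    unfolding image_mexp[OF X, symmetric] by (intro image_mem mexp_mem X)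
  then show ?thesis by (simp add: lie_algebra_def)
qed

lemma d_unique:
  assumes "X \<in> \<gg>" "\<And>t. \<sigma> (mexp (t *\<^sub>R X)) = mexp (t *\<^sub>R Y)"
  shows "d X = Y"
  using vector_derivative_unique_at[OF has_differential[OF assms(1), unfolded assms(2)] mexp_derivative] .

lemma d_d: "X \<in> \<gg> \<Longrightarrow> d (d X) = X"
  by (rule d_unique) (simp_all add: d_mem involutive mexp_mem flip: image_mexp)

lemma lie_algebra_fixed_points: "lie_algebra (fixed_points G \<sigma>) = {X \<in> \<gg>. d X = X}"
proof (intro equalityI subsetI)
  fix X assume "X \<in> lie_algebra (fixed_points G \<sigma>)"
  then have X: "mexp (t *\<^sub>R X) \<in> G" "\<sigma> (mexp (t *\<^sub>R X)) = mexp (t *\<^sub>R X)" for t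
    by (simp_all add: lie_algebra_def fixed_points_def)
  then have "X \<in> \<gg>"
    by (simp add: lie_algebra_def)
  then show "X \<in> {X \<in> \<gg>. d X = X}"
    using d_unique X(2) by simp
next
  fix X assume "X \<in> {X \<in> \<gg>. d X = X}"
  then show "X \<in> lie_algebra (fixed_points G \<sigma>)"
    using image_mexp[of X] by (simp add: lie_algebra_def fixed_points_def)
qed

end

text \<open>The one-parameter groups of \<open>F\<close> are connected sets through the identity.\<close>

lemma lie_algebra_identity_component: "lie_algebra (identity_component F) = lie_algebra F"
proof (intro equalityI subsetI)
  fix X assume "X \<in> lie_algebra (identity_component F)"
  then show "X \<in> lie_algebra F"
    unfolding lie_algebra_def identity_component_def using connected_component_subset by blast
next
  fix X assume X: "X \<in> lie_algebra F"
  define S where "S = range (\<lambda>t. mexp (t *\<^sub>R X))"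
  have "connected S"
    unfolding S_def by (rule connected_continuous_image[OF continuous_mexp connected_UNIV])
  moreover have "mat 1 \<in> S"
    unfolding S_def by (rule image_eqI[of _ _ 0]) simp_all
  moreover have "S \<subseteq> F"
    using X by (auto simp: S_def lie_algebra_def)
  ultimately have "S \<subseteq> identity_component F"
    unfolding identity_component_def by (intro connected_component_maximal)
  then show "X \<in> lie_algebra (identity_component F)"
    by (auto simp: S_def lie_algebra_def)
qed

lemma compact_matrix_subgroup:
  assumes "matrix_subgroup K" "compact K"
  shows "matrix_lie_group K"
proof -
  have "K = {A. invertible A} \<inter> K"
    using assms(1) unfolding matrix_subgroup_def by blast
  then show ?thesis
    using assms compact_imp_closed unfolding matrix_lie_group_def closedin_closed by blast
qed

locale commuting_involutions =
  \<theta>: matrix_involution G \<theta> + \<iota>: matrix_involution G \<iota>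
  for G :: "'n::finite rmat set" and \<theta> \<iota> :: "'n rmat \<Rightarrow> 'n rmat" +
  assumes commute: "g \<in> G \<Longrightarrow> \<iota> (\<theta> g) = \<theta> (\<iota> g)"
begin

sublocale comp: matrix_involution G "\<iota> \<circ> \<theta>"
proof
  show "involutive_automorphism G (\<iota> \<circ> \<theta>)"
    unfolding involutive_automorphism_def
  proof (intro conjI ballI)
    show "(\<iota> \<circ> \<theta>) ` G \<subseteq> G"
      by (auto simp: \<theta>.image_mem \<iota>.image_mem)
    show "continuous_on G (\<iota> \<circ> \<theta>)"
      by (rule continuous_on_compose[OF \<theta>.cont_hom continuous_on_subset[OF \<iota>.cont_hom]])
         (auto simp: \<theta>.image_mem)
  qed (simp_all add: \<theta>.image_mem \<iota>.image_mem \<theta>.image_mult \<iota>.image_mult commute \<theta>.involutive \<iota>.involutive)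
qed

lemma d_comp: "X \<in> lie_algebra G \<Longrightarrow> differential (\<iota> \<circ> \<theta>) X = differential \<iota> (differential \<theta> X)"
  by (rule comp.d_unique) (simp_all add: \<theta>.image_mexp \<iota>.image_mexp \<theta>.d_mem)

lemma d_commute: "X \<in> lie_algebra G \<Longrightarrow> differential \<iota> (differential \<theta> X) = differential \<theta> (differential \<iota> X)"
proof -
  assume X: "X \<in> lie_algebra G"
  have "(\<iota> \<circ> \<theta>) (mexp (t *\<^sub>R X)) = mexp (t *\<^sub>R differential \<theta> (differential \<iota> X))" for t
    by (simp only: o_apply commute[OF \<theta>.mexp_mem[OF X]] \<iota>.image_mexp[OF X] \<theta>.image_mexp[OF \<iota>.d_mem[OF X]])
  then show ?thesis
    unfolding d_comp[OF X, symmetric] by (rule comp.d_unique[OF X])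
qed

end

section \<open>Traces and the Killing form\<close>

definition endo_on :: "'v::euclidean_space set \<Rightarrow> ('v \<Rightarrow> 'v) \<Rightarrow> bool" where
  "endo_on V f \<longleftrightarrow> (\<forall>x\<in>V. f x \<in> V) \<and> (\<forall>x\<in>V. \<forall>y\<in>V. f (x + y) = f x + f y) \<and> (\<forall>x\<in>V. \<forall>c. f (c *\<^sub>R x) = c *\<^sub>R f x)"

lemma endo_onD:
  assumes "endo_on V f" "x \<in> V"
  shows "f x \<in> V" "y \<in> V \<Longrightarrow> f (x + y) = f x + f y" "f (c *\<^sub>R x) = c *\<^sub>R f x"
  using assms unfolding endo_on_def by auto

lemma endo_on_sum:
  assumes f: "endo_on V f" and V: "subspace V" and "finite I" and x: "\<And>i. i \<in> I \<Longrightarrow> x i \<in> V"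
  shows "f (\<Sum>i\<in>I. c i *\<^sub>R x i) = (\<Sum>i\<in>I. c i *\<^sub>R f (x i))"
  using assms(3) x
proof (induction I rule: finite_induct)
  case empty
  have "0 \<in> V" by (rule subspace_0[OF V])
  from endo_onD(3)[OF f this, of 0] show ?case by simp
next
  case (insert i I)
  have "(\<Sum>i\<in>I. c i *\<^sub>R x i) \<in> V" "c i *\<^sub>R x i \<in> V"
    using insert by (auto intro!: subspace_sum subspace_scale V)
  then show ?case
    using insert by (simp add: endo_onD[OF f])
qed

lemma endo_on_comp: "endo_on V f \<Longrightarrow> endo_on V g \<Longrightarrow> endo_on V (\<lambda>x. f (g x))"
  unfolding endo_on_def by simp

definition trace_basis :: "'v::euclidean_space set \<Rightarrow> 'v set" where
  "trace_basis V = (SOME B. B \<subseteq> V \<and> independent B \<and> span B = V)"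

lemma trace_on_eq: "trace_on V f = (\<Sum>b\<in>trace_basis V. representation (trace_basis V) (f b) b)"
  unfolding trace_on_def trace_basis_def Let_def ..

lemma trace_basis:
  assumes "subspace V"
  shows "trace_basis V \<subseteq> V" "independent (trace_basis V)" "span (trace_basis V) = V" "finite (trace_basis V)"
proof -
  obtain B where "B \<subseteq> V" "independent B" "V \<subseteq> span B"
    using maximal_independent_subset[of V] by blast
  then have "B \<subseteq> V \<and> independent B \<and> span B = V"
    using assms span_minimal by blast
  then have "trace_basis V \<subseteq> V \<and> independent (trace_basis V) \<and> span (trace_basis V) = V"
    unfolding trace_basis_def by (rule someI)
  then show "trace_basis V \<subseteq> V" "independent (trace_basis V)" "span (trace_basis V) = V" "finite (trace_basis V)"
    using independent_imp_finite by auto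
qed

lemma trace_on_cong: "subspace (V :: 'v::euclidean_space set) \<Longrightarrow> (\<And>x. x \<in> V \<Longrightarrow> f x = g x) \<Longrightarrow> trace_on V f = trace_on V g"
  unfolding trace_on_eq by (intro sum.cong refl) (simp add: trace_basis(1)[THEN subsetD])

lemma trace_on_add:
  assumes "subspace V" "endo_on V f" "endo_on V g"
  shows "trace_on V (\<lambda>x. f x + g x) = trace_on V f + trace_on V g"
  unfolding trace_on_eq sum.distrib[symmetric]
  using trace_basis[OF assms(1)] assms
  by (intro sum.cong refl) (simp add: representation_add endo_onD(1) subset_iff)

lemma trace_on_scaleR:
  assumes "subspace V" "endo_on V f"
  shows "trace_on V (\<lambda>x. c *\<^sub>R f x) = c * trace_on V f"
  unfolding trace_on_eq sum_distrib_left
  using trace_basis[OF assms(1)] assms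
  by (intro sum.cong refl) (simp add: representation_scale endo_onD(1) subset_iff)

text \<open>Both sides are the sum of \<open>f\<^sub>b\<^sub>c g\<^sub>c\<^sub>b\<close> over pairs of elements of the one basis that \<open>trace_on V\<close> selects.
  Symmetry and invariance of the Killing form follow from this identity.\<close>

lemma trace_on_commute:
  assumes V: "subspace V" and f: "endo_on V f" and g: "endo_on V g"
  shows "trace_on V (\<lambda>x. f (g x)) = trace_on V (\<lambda>x. g (f x))"
proof -
  define B where "B = trace_basis V"
  note B = trace_basis[OF V, folded B_def]
  have expand: "(\<Sum>b\<in>B. representation B (f (g b)) b) =
      (\<Sum>b\<in>B. \<Sum>c\<in>B. representation B (g b) c * representation B (f c) b)"
    if f: "endo_on V f" and g: "endo_on V g" for f g
  proof (intro sum.cong refl)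
    fix b assume b: "b \<in> B"
    then have gb: "g b \<in> V" using B(1) endo_onD(1)[OF g] by blast
    have "f (g b) = f (\<Sum>c\<in>B. representation B (g b) c *\<^sub>R c)"
      using B gb by (simp add: real_vector.sum_representation_eq)
    also have "\<dots> = (\<Sum>c\<in>B. representation B (g b) c *\<^sub>R f c)"
      by (rule endo_on_sum[OF f V B(4)]) (use B in auto)
    finally have "representation B (f (g b)) = representation B (\<Sum>c\<in>B. representation B (g b) c *\<^sub>R f c)"
      by simp
    also have "\<dots> = (\<lambda>b'. \<Sum>c\<in>B. representation B (representation B (g b) c *\<^sub>R f c) b')"
      by (rule real_vector.representation_sum) (use B endo_onD(1)[OF f] V in \<open>auto intro!: subspace_scale\<close>)
    finally show "representation B (f (g b)) b = (\<Sum>c\<in>B. representation B (g b) c * representation B (f c) b)"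
      using B endo_onD(1)[OF f] by (auto intro!: sum.cong simp: representation_scale subset_iff)
  qed
  have "(\<Sum>b\<in>B. representation B (f (g b)) b) = (\<Sum>b\<in>B. representation B (g (f b)) b)"
    unfolding expand[OF f g] expand[OF g f] by (subst sum.swap) (simp add: mult.commute)
  then show ?thesis
    unfolding trace_on_eq B_def .
qed

locale lie_subalgebra =
  fixes \<gg> :: "'n::finite rmat set"
  assumes sub: "subspace \<gg>" and brk_mem: "X \<in> \<gg> \<Longrightarrow> Y \<in> \<gg> \<Longrightarrow> brk X Y \<in> \<gg>"
begin

abbreviation "\<kappa> \<equiv> killing_form \<gg>"

lemma g_add: "X \<in> \<gg> \<Longrightarrow> Y \<in> \<gg> \<Longrightarrow> X + Y \<in> \<gg>"
  and g_scaleR: "X \<in> \<gg> \<Longrightarrow> c *\<^sub>R X \<in> \<gg>"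
  and g_diff: "X \<in> \<gg> \<Longrightarrow> Y \<in> \<gg> \<Longrightarrow> X - Y \<in> \<gg>"
  and g_minus: "X \<in> \<gg> \<Longrightarrow> - X \<in> \<gg>"
  and g_zero: "0 \<in> \<gg>"
  using sub by (auto simp: subspace_add subspace_scale subspace_diff subspace_neg subspace_0)

lemma endo_ad: "X \<in> \<gg> \<Longrightarrow> endo_on \<gg> (brk X)"
  by (simp add: endo_on_def brk_mem brk_add_right brk_scaleR_right)

lemma endo_ad2: "X \<in> \<gg> \<Longrightarrow> Y \<in> \<gg> \<Longrightarrow> endo_on \<gg> (\<lambda>Z. brk X (brk Y Z))"
  by (rule endo_on_comp[OF endo_ad endo_ad])

lemma killing_sym: "X \<in> \<gg> \<Longrightarrow> Y \<in> \<gg> \<Longrightarrow> \<kappa> X Y = \<kappa> Y X"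
  unfolding killing_form_def by (intro trace_on_commute sub endo_ad)

lemma killing_add_left:
  assumes "X \<in> \<gg>" "X' \<in> \<gg>" "Y \<in> \<gg>"
  shows "\<kappa> (X + X') Y = \<kappa> X Y + \<kappa> X' Y"
  unfolding killing_form_def brk_add_left by (intro trace_on_add sub endo_ad2 assms)

lemma killing_scaleR_left:
  assumes "X \<in> \<gg>" "Y \<in> \<gg>"
  shows "\<kappa> (c *\<^sub>R X) Y = c * \<kappa> X Y"
  unfolding killing_form_def brk_scaleR_left by (intro trace_on_scaleR sub endo_ad2 assms)

lemma killing_add_right: "X \<in> \<gg> \<Longrightarrow> Y \<in> \<gg> \<Longrightarrow> Y' \<in> \<gg> \<Longrightarrow> \<kappa> X (Y + Y') = \<kappa> X Y + \<kappa> X Y'"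
  using killing_add_left[of Y Y' X] by (simp add: killing_sym[of X] g_add)

lemma killing_scaleR_right: "X \<in> \<gg> \<Longrightarrow> Y \<in> \<gg> \<Longrightarrow> \<kappa> X (c *\<^sub>R Y) = c * \<kappa> X Y"
  using killing_scaleR_left[of Y X c] by (simp add: killing_sym[of X] g_scaleR)

lemma killing_minus: "X \<in> \<gg> \<Longrightarrow> Y \<in> \<gg> \<Longrightarrow> \<kappa> (- X) Y = - \<kappa> X Y" "X \<in> \<gg> \<Longrightarrow> Y \<in> \<gg> \<Longrightarrow> \<kappa> X (- Y) = - \<kappa> X Y"
  using killing_scaleR_left[of X Y "-1"] killing_scaleR_right[of X Y "-1"] by simp_all

lemma killing_diff: 
  "X \<in> \<gg> \<Longrightarrow> X' \<in> \<gg> \<Longrightarrow> Y \<in> \<gg> \<Longrightarrow> \<kappa> (X - X') Y = \<kappa> X Y - \<kappa> X' Y"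
  "X \<in> \<gg> \<Longrightarrow> Y \<in> \<gg> \<Longrightarrow> Y' \<in> \<gg> \<Longrightarrow> \<kappa> X (Y - Y') = \<kappa> X Y - \<kappa> X Y'"
  using killing_add_left[of X "- X'" Y] killing_add_right[of X Y "- Y'"] by (simp_all add: g_minus killing_minus)

lemma killing_invariant:
  assumes "X \<in> \<gg>" "Y \<in> \<gg>" "Z \<in> \<gg>"
  shows "\<kappa> (brk X Y) Z = \<kappa> X (brk Y Z)"
proof -
  let ?t = "\<lambda>X Y Z. trace_on \<gg> (\<lambda>W. brk X (brk Y (brk Z W)))"
  have e: "endo_on \<gg> (\<lambda>W. brk X (brk Y (brk Z W)))" if "X \<in> \<gg>" "Y \<in> \<gg>" "Z \<in> \<gg>" for X Y Z
    by (rule endo_on_comp[OF endo_ad[OF that(1)] endo_ad2[OF that(2,3)]])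
  have em: "endo_on \<gg> (\<lambda>W. (-1) *\<^sub>R brk X (brk Y (brk Z W)))" if "X \<in> \<gg>" "Y \<in> \<gg>" "Z \<in> \<gg>" for X Y Z
    using e[OF that] by (auto simp: endo_on_def g_minus)
  have d: "trace_on \<gg> (\<lambda>W. brk X (brk Y (brk Z W)) - brk X' (brk Y' (brk Z' W))) = ?t X Y Z - ?t X' Y' Z'"
    if "X \<in> \<gg>" "Y \<in> \<gg>" "Z \<in> \<gg>" "X' \<in> \<gg>" "Y' \<in> \<gg>" "Z' \<in> \<gg>" for X Y Z X' Y' Z'
    using trace_on_add[OF sub e[OF that(1-3)] em[OF that(4-6)]] trace_on_scaleR[OF sub e[OF that(4-6)], of "-1"]
    by simp
  have "\<kappa> (brk X Y) Z = trace_on \<gg> (\<lambda>W. brk X (brk Y (brk Z W)) - brk Y (brk X (brk Z W)))"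
    unfolding killing_form_def
    by (rule trace_on_cong[OF sub]) (simp add: brk_jacobi[of X Y])
  also have "\<dots> = ?t X Y Z - ?t Y X Z"
    by (rule d) (use assms in auto)
  also have "?t Y X Z = ?t X Z Y"
    using trace_on_commute[OF sub endo_ad[OF assms(2)] endo_ad2[OF assms(1,3)]] .
  also have "?t X Y Z - ?t X Z Y = trace_on \<gg> (\<lambda>W. brk X (brk Y (brk Z W)) - brk X (brk Z (brk Y W)))"
    by (rule d[symmetric]) (use assms in auto)
  also have "\<dots> = \<kappa> X (brk Y Z)"
    unfolding killing_form_def
    by (rule trace_on_cong[OF sub]) (simp add: brk_jacobi[of Y Z] brk_diff_right[symmetric])
  finally show ?thesis .
qed

lemma killing_automorphism:
  assumes s: "endo_on \<gg> s" "\<And>X Y. X \<in> \<gg> \<Longrightarrow> Y \<in> \<gg> \<Longrightarrow> s (brk X Y) = brk (s X) (s Y)" "\<And>X. X \<in> \<gg> \<Longrightarrow> s (s X) = X"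
    and X: "X \<in> \<gg>" and Y: "Y \<in> \<gg>"
  shows "\<kappa> (s X) (s Y) = \<kappa> X Y"
proof -
  have "\<kappa> (s X) (s Y) = trace_on \<gg> (\<lambda>Z. s (brk X (brk Y (s Z))))"
    unfolding killing_form_def
    by (rule trace_on_cong[OF sub]) (simp add: s X Y brk_mem endo_onD(1)[OF s(1)])
  also have "\<dots> = trace_on \<gg> (\<lambda>Z. brk X (brk Y (s (s Z))))"
    by (rule trace_on_commute[OF sub s(1) endo_on_comp[OF endo_ad2[OF X Y] s(1)]])
  also have "\<dots> = \<kappa> X Y"
    unfolding killing_form_def by (rule trace_on_cong[OF sub]) (simp add: s)
  finally show ?thesis .
qed

end

text \<open>Gram-Schmidt for a form that is positive definite on a subspace.\<close>

lemma form_projection: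
  fixes \<beta> :: "'v::euclidean_space \<Rightarrow> 'v \<Rightarrow> real"
  assumes P: "subspace P" and S: "finite S" "S \<subseteq> P"
    and add: "\<And>x y z. x \<in> P \<Longrightarrow> y \<in> P \<Longrightarrow> z \<in> P \<Longrightarrow> \<beta> (x + y) z = \<beta> x z + \<beta> y z"
    and scale: "\<And>c x z. x \<in> P \<Longrightarrow> z \<in> P \<Longrightarrow> \<beta> (c *\<^sub>R x) z = c * \<beta> x z"
    and sym: "\<And>x y. x \<in> P \<Longrightarrow> y \<in> P \<Longrightarrow> \<beta> x y = \<beta> y x"
    and pos: "\<And>x. x \<in> P \<Longrightarrow> x \<noteq> 0 \<Longrightarrow> \<beta> x x > 0"
    and y: "y \<in> P"
  shows "\<exists>x\<in>span S. \<forall>z\<in>span S. \<beta> (y - x) z = 0"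
  using S y
proof (induction S arbitrary: y rule: finite_induct)
  case empty
  have "\<beta> y 0 = 0"
    using sym[of y 0] scale[of 0 y 0] empty subspace_0[OF P] by simp
  then show ?case by simp
next
  case (insert s S)
  have spanP: "span S \<subseteq> P" "s \<in> P"
    using insert span_minimal[OF _ P, of S] by auto
  have diff: "\<beta> (x - y) z = \<beta> x z - \<beta> y z" if "x \<in> P" "y \<in> P" "z \<in> P" for x y z
    using add[of x "(-1) *\<^sub>R y" z] scale[of y z "-1"] that by (simp add: subspace_neg[OF P])
  obtain s0 where s0: "s0 \<in> span S" "\<And>z. z \<in> span S \<Longrightarrow> \<beta> (s - s0) z = 0"
    using insert.IH[of s] insert.prems by auto
  obtain x0 where x0: "x0 \<in> span S" "\<And>z. z \<in> span S \<Longrightarrow> \<beta> (y - x0) z = 0"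
    using insert.IH[of y] insert.prems by auto
  define u where "u = s - s0"
  have mem: "s0 \<in> P" "x0 \<in> P" "u \<in> P" "y \<in> P"
    using s0 x0 spanP insert.prems subspace_diff[OF P] by (auto simp: u_def)
  \<comment> \<open>if \<open>u = 0\<close>, the span does not grow and \<open>x0\<close> can be kept\<close>
  define c where "c = (if u = 0 then 0 else \<beta> y u / \<beta> u u)"
  define x where "x = x0 + c *\<^sub>R u"
  have cu: "c *\<^sub>R u \<in> P" by (rule subspace_scale[OF P mem(3)])
  have sub: "span S \<subseteq> span (insert s S)"
    by (rule span_mono) blast
  have "x \<in> span (insert s S)"
    unfolding x_def u_def
    by (rule span_add[OF subsetD[OF sub x0(1)] span_scale[OF span_diff[OF span_base[OF insertI1] subsetD[OF sub s0(1)]]]])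
  moreover have "\<beta> (y - x) z = 0" if z: "z \<in> span (insert s S)" for z
  proof -
    obtain k where k: "z - k *\<^sub>R s \<in> span S"
      using z unfolding span_insert by auto
    define w where "w = z - k *\<^sub>R s + k *\<^sub>R s0"
    have w: "w \<in> span S" unfolding w_def by (intro span_add span_scale k s0)
    have zw: "z = w + k *\<^sub>R u" by (simp add: w_def u_def algebra_simps)
    have wP: "w \<in> P" using w spanP by blast
    have 0: "\<beta> x0 u = 0" 
      using sym[OF mem(2,3)] s0(2)[OF x0(1)] by (simp add: u_def)
    have yx: "y - x = (y - x0) - c *\<^sub>R u" by (simp add: x_def)
    have yx0: "y - x0 \<in> P" by (rule subspace_diff[OF P mem(4,2)])
    have d: "\<beta> (y - x) v = \<beta> (y - x0) v - c * \<beta> u v" if "v \<in> P" for v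
      unfolding yx using diff[OF yx0 cu that] scale[OF mem(3) that] by simp
    have "\<beta> (y - x) w = 0"
      using d[OF wP] x0(2)[OF w] s0(2)[OF w] by (simp add: u_def)
    moreover have "\<beta> (y - x) u = 0"
    proof (cases "u = 0")
      case True
      then show ?thesis
        using d[OF mem(3)] sym[OF yx0 mem(3)] scale[OF mem(3) yx0, of 0] by (simp add: c_def)
    next
      case False
      then show ?thesis
        using d[OF mem(3)] diff[OF mem(4,2,3)] 0 pos[OF mem(3) False] by (simp add: c_def)
    qed
    moreover have yxP: "y - x \<in> P" unfolding yx by (rule subspace_diff[OF P yx0 cu])
    moreover have kuP: "k *\<^sub>R u \<in> P" by (rule subspace_scale[OF P mem(3)])
    ultimately show ?thesis
      unfolding zw using sym[OF yxP subspace_add[OF P wP kuP]] add[OF wP kuP yxP] scale[OF mem(3) yxP, of k]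
        sym[OF yxP wP] sym[OF yxP mem(3)] by simp
  qed
  ultimately show ?case by blast
qed

lemma quadratic_nonneg_imp_zero:
  fixes a c :: real
  assumes "\<And>t. 2 * t * a + t\<^sup>2 * c \<ge> 0"
  shows "a = 0"
proof (rule ccontr)
  assume a: "a \<noteq> 0"
  define k where "k = \<bar>c\<bar> + 1"
  have k: "k > 0" "c < k" by (auto simp: k_def)
  have "2 * (- a / k) * a + (- a / k)\<^sup>2 * c = (a\<^sup>2 / k) * (c / k - 2)"
    using k by (simp add: power2_eq_square field_simps)
  moreover have "c / k - 2 < 0" using k by (simp add: field_simps)
  moreover have "a\<^sup>2 / k > 0" using a k by simp
  ultimately have "2 * (- a / k) * a + (- a / k)\<^sup>2 * c < 0"
    by (simp only: mult_pos_neg)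
  then show False
    using assms[of "- a / k"] by linarith
qed

section \<open>Hermitian symmetric Lie algebras\<close>

locale cartan_pair = lie_subalgebra \<gg> for \<gg> :: "'n::finite rmat set" +
  fixes \<theta> :: "'n rmat \<Rightarrow> 'n rmat"
  assumes simple: "simple_lie_algebra \<gg>"
    and \<theta>_endo: "endo_on \<gg> \<theta>" 
    and \<theta>_brk: "X \<in> \<gg> \<Longrightarrow> Y \<in> \<gg> \<Longrightarrow> \<theta> (brk X Y) = brk (\<theta> X) (\<theta> Y)"
    and \<theta>_\<theta>: "X \<in> \<gg> \<Longrightarrow> \<theta> (\<theta> X) = X"
    and cartan_pos: "X \<in> \<gg> \<Longrightarrow> X \<noteq> 0 \<Longrightarrow> - \<kappa> X (\<theta> X) > 0"
begin

definition "\<kk> = {X \<in> \<gg>. \<theta> X = X}"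
definition "\<pp> = {X \<in> \<gg>. \<theta> X = - X}"

lemma k_g: "X \<in> \<kk> \<Longrightarrow> X \<in> \<gg>" and p_g: "X \<in> \<pp> \<Longrightarrow> X \<in> \<gg>"
  by (simp_all add: \<kk>_def \<pp>_def)

lemma \<theta>_add: "X \<in> \<gg> \<Longrightarrow> Y \<in> \<gg> \<Longrightarrow> \<theta> (X + Y) = \<theta> X + \<theta> Y"
  and \<theta>_scaleR: "X \<in> \<gg> \<Longrightarrow> \<theta> (c *\<^sub>R X) = c *\<^sub>R \<theta> X"
  and \<theta>_mem: "X \<in> \<gg> \<Longrightarrow> \<theta> X \<in> \<gg>"
  using endo_onD[OF \<theta>_endo] by auto

lemma \<theta>_minus: "X \<in> \<gg> \<Longrightarrow> \<theta> (- X) = - \<theta> X"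
  using \<theta>_scaleR[of X "-1"] by simp

lemma \<theta>_diff: "X \<in> \<gg> \<Longrightarrow> Y \<in> \<gg> \<Longrightarrow> \<theta> (X - Y) = \<theta> X - \<theta> Y"
  using \<theta>_add[of X "- Y"] by (simp add: \<theta>_minus g_minus)

lemma \<theta>_zero: "\<theta> 0 = 0"
  using \<theta>_scaleR[OF g_zero, of 0] by simp

lemma subspace_k: "subspace \<kk>" and subspace_p: "subspace \<pp>"
  by (auto simp: subspace_def \<kk>_def \<pp>_def \<theta>_add \<theta>_scaleR \<theta>_zero g_zero g_add g_scaleR)

lemma brk_kk: "X \<in> \<kk> \<Longrightarrow> Y \<in> \<kk> \<Longrightarrow> brk X Y \<in> \<kk>"
  and brk_kp: "X \<in> \<kk> \<Longrightarrow> Y \<in> \<pp> \<Longrightarrow> brk X Y \<in> \<pp>"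
  and brk_pp: "X \<in> \<pp> \<Longrightarrow> Y \<in> \<pp> \<Longrightarrow> brk X Y \<in> \<kk>"
  by (simp_all add: \<kk>_def \<pp>_def brk_mem \<theta>_brk brk_minus_left brk_minus_right)

lemma k_p_zero:
  assumes "X \<in> \<kk>" "X \<in> \<pp>"
  shows "X = 0"
proof -
  have "X = - X" using assms by (simp add: \<kk>_def \<pp>_def)
  then have "2 *\<^sub>R X = 0" unfolding scaleR_2 by (simp only: eq_neg_iff_add_eq_0)
  then show ?thesis by simp
qed

definition "k_part X = (1/2) *\<^sub>R (X + \<theta> X)"
definition "p_part X = (1/2) *\<^sub>R (X - \<theta> X)"

lemma k_part: "X \<in> \<gg> \<Longrightarrow> k_part X \<in> \<kk>" and p_part: "X \<in> \<gg> \<Longrightarrow> p_part X \<in> \<pp>"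
  by (simp_all add: k_part_def p_part_def \<kk>_def \<pp>_def g_scaleR g_add g_diff \<theta>_mem \<theta>_scaleR \<theta>_add \<theta>_diff \<theta>_\<theta> add.commute
      flip: scaleR_minus_right)

lemma k_part_p_part: "k_part X + p_part X = X"
  by (simp add: k_part_def p_part_def flip: scaleR_add_right)

lemma killing_p_pos: "X \<in> \<pp> \<Longrightarrow> X \<noteq> 0 \<Longrightarrow> \<kappa> X X > 0"
  using cartan_pos[of X] by (simp add: \<pp>_def killing_minus)

lemma killing_k_neg: "X \<in> \<kk> \<Longrightarrow> X \<noteq> 0 \<Longrightarrow> \<kappa> X X < 0"
  using cartan_pos[of X] by (simp add: \<kk>_def)

lemma killing_skew:
  assumes "X \<in> \<gg>" "Y \<in> \<gg>" "Z \<in> \<gg>"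
  shows "\<kappa> (brk Z X) Y = - \<kappa> X (brk Z Y)"
  using killing_invariant[OF assms(1,3,2)] killing_minus(1)[OF brk_mem[OF assms(1,3)] assms(2)]
  by (simp add: brk_antisym[of Z X])

text \<open>
  A \<open>\<kk>\<close>-invariant subspace \<open>\<nn>\<close> of \<open>\<pp>\<close> commutes with its orthogonal complement in \<open>\<pp>\<close>: their bracket lies in
  \<open>\<kk>\<close>, where the Killing form is definite, and is orthogonal to \<open>\<kk>\<close> by invariance. Hence
  \<open>\<nn> + [\<nn>, \<nn>]\<close> is an ideal of the simple algebra \<open>\<gg>\<close>.
\<close>

theorem p_irreducible:
  assumes n: "subspace \<nn>" "\<nn> \<subseteq> \<pp>" and inv: "\<And>Z X. Z \<in> \<kk> \<Longrightarrow> X \<in> \<nn> \<Longrightarrow> brk Z X \<in> \<nn>"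
  shows "\<nn> = {0} \<or> \<nn> = \<pp>"
proof -
  define \<nn>' where "\<nn>' = {Y \<in> \<pp>. \<forall>X\<in>\<nn>. \<kappa> Y X = 0}"
  have np: "X \<in> \<pp>" "X \<in> \<gg>" if "X \<in> \<nn>" for X using that n(2) p_g by auto
  have n'p: "X \<in> \<pp>" "X \<in> \<gg>" if "X \<in> \<nn>'" for X using that p_g unfolding \<nn>'_def by auto
  have split: "\<exists>A\<in>\<nn>. \<exists>B\<in>\<nn>'. Y = A + B" if Y: "Y \<in> \<pp>" for Y
  proof -
    obtain S where S: "S \<subseteq> \<nn>" "independent S" "\<nn> \<subseteq> span S"
      using maximal_independent_subset[of \<nn>] by blast
    have span: "span S = \<nn>" using S span_minimal[OF S(1) n(1)] by blast
    have "finite S" using S(2) independent_imp_finite by blast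
    then have "\<exists>x\<in>span S. \<forall>z\<in>span S. \<kappa> (Y - x) z = 0"
      by (rule form_projection[OF subspace_p])
         (use S n p_g Y in \<open>auto simp: killing_add_left killing_scaleR_left killing_p_pos intro: killing_sym\<close>)
    then obtain A where A: "A \<in> \<nn>" "\<And>z. z \<in> \<nn> \<Longrightarrow> \<kappa> (Y - A) z = 0" unfolding span by blast
    have "Y - A \<in> \<nn>'"
      unfolding \<nn>'_def using A subspace_diff[OF subspace_p Y np(1)[OF A(1)]] by blast
    then show ?thesis using A(1) by (intro bexI[of _ A] bexI[of _ "Y - A"]) auto
  qed
  have inv': "brk Z Y \<in> \<nn>'" if Z: "Z \<in> \<kk>" and Y: "Y \<in> \<nn>'" for Z Y
  proof -
    have "\<kappa> (brk Z Y) X = 0" if X: "X \<in> \<nn>" for X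
    proof -
      have "\<kappa> (brk Z Y) X = - \<kappa> Y (brk Z X)"
        by (rule killing_skew[OF n'p(2)[OF Y] np(2)[OF X] k_g[OF Z]])
      then show ?thesis using Y inv[OF Z X] by (simp add: \<nn>'_def)
    qed
    then show ?thesis
      unfolding \<nn>'_def using brk_kp[OF Z n'p(1)[OF Y]] by simp
  qed
  have comm: "brk X Y = 0" if X: "X \<in> \<nn>" and Y: "Y \<in> \<nn>'" for X Y
  proof -
    define W where "W = brk X Y"
    have W: "W \<in> \<kk>" unfolding W_def by (rule brk_pp[OF np(1)[OF X] n'p(1)[OF Y]])
    have "\<kappa> W W = \<kappa> X (brk Y W)"
      using killing_invariant[OF np(2)[OF X] n'p(2)[OF Y] k_g[OF W]] unfolding W_def .
    also have "\<dots> = \<kappa> (brk Y W) X"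
      by (rule killing_sym[OF np(2)[OF X] brk_mem[OF n'p(2)[OF Y] k_g[OF W]]])
    also have "\<dots> = - \<kappa> (brk W Y) X"
      unfolding brk_antisym[of Y W]
      by (rule killing_minus(1)[OF brk_mem[OF k_g[OF W] n'p(2)[OF Y]] np(2)[OF X]])
    also have "\<dots> = 0"
      using inv'[OF W Y] X by (simp add: \<nn>'_def)
    finally show ?thesis
      using killing_k_neg[OF W] unfolding W_def by force
  qed
  define \<ss> where "\<ss> = span {brk X Y | X Y. X \<in> \<nn> \<and> Y \<in> \<nn>}"
  have s_k: "W \<in> \<kk>" if "W \<in> \<ss>" for W
  proof -
    have "{brk X Y | X Y. X \<in> \<nn> \<and> Y \<in> \<nn>} \<subseteq> \<kk>" using np brk_pp by blast
    from span_minimal[OF this subspace_k] show ?thesis using that unfolding \<ss>_def by blast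
  qed
  have s_base: "brk X Y \<in> \<ss>" if "X \<in> \<nn>" "Y \<in> \<nn>" for X Y
    unfolding \<ss>_def using that by (intro span_base) blast
  have s_sub: "subspace \<ss>" unfolding \<ss>_def by (rule subspace_span)
  have lin: "linear (brk U)" for U :: "'n rmat"
    by (intro linearI) (simp_all add: brk_add_right brk_scaleR_right)
  have s_inv: "brk U W \<in> T" 
    if "W \<in> \<ss>" "subspace T" "\<And>X Y. X \<in> \<nn> \<Longrightarrow> Y \<in> \<nn> \<Longrightarrow> brk U (brk X Y) \<in> T" for U W T
  proof -
    have "subspace (brk U -` T)"
      by (rule linear_subspace_vimage[OF lin that(2)])
    moreover have "{brk X Y | X Y. X \<in> \<nn> \<and> Y \<in> \<nn>} \<subseteq> brk U -` T"
      using that(3) by auto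
    ultimately have "\<ss> \<subseteq> brk U -` T"
      unfolding \<ss>_def by (intro span_minimal)
    then show ?thesis using that(1) by auto
  qed
  define I where "I = {X + W | X W. X \<in> \<nn> \<and> W \<in> \<ss>}"
  have I_sub: "subspace I"
    unfolding I_def by (rule subspace_sums[OF n(1) s_sub])
  have I_n: "X \<in> I" if "X \<in> \<nn>" for X
    unfolding I_def using that subspace_0[OF s_sub] by (intro CollectI exI[of _ X] exI[of _ 0]) auto
  have I_s: "W \<in> I" if "W \<in> \<ss>" for W
    unfolding I_def using that subspace_0[OF n(1)] by (intro CollectI exI[of _ 0] exI[of _ W]) auto
  have "brk U V \<in> I" if U: "U \<in> \<gg>" and V: "V \<in> I" for U V
  proof -
    obtain X W where XW: "X \<in> \<nn>" "W \<in> \<ss>" "V = X + W" using V unfolding I_def by blast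
    obtain P1 P2 where P: "P1 \<in> \<nn>" "P2 \<in> \<nn>'" "p_part U = P1 + P2" using split[OF p_part[OF U]] by blast
    define Z where "Z = k_part U"
    have Z: "Z \<in> \<kk>" unfolding Z_def by (rule k_part[OF U])
    have Ueq: "U = Z + (P1 + P2)" using k_part_p_part[of U] P(3) Z_def by simp
    have 1: "brk Z X \<in> I" by (rule I_n[OF inv[OF Z XW(1)]])
    have 2: "brk Z W \<in> I"
    proof (rule I_s, rule s_inv[OF XW(2) s_sub])
      fix A B assume AB: "A \<in> \<nn>" "B \<in> \<nn>"
      show "brk Z (brk A B) \<in> \<ss>"
        unfolding brk_jacobi[of Z A B]
        by (intro subspace_add[OF s_sub] s_base inv Z AB)
    qed
    have 3: "brk P1 X \<in> I" by (rule I_s[OF s_base[OF P(1) XW(1)]])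
    have 4: "brk P1 W \<in> I"
      using I_n[OF subspace_neg[OF n(1) inv[OF s_k[OF XW(2)] P(1)]]] by (simp add: brk_antisym[of P1 W])
    have c: "brk P2 A = 0" if "A \<in> \<nn>" for A
      using comm[OF that P(2)] by (simp add: brk_antisym[of P2 A])
    have 5: "brk P2 X = 0" by (rule c[OF XW(1)])
    have "brk P2 W \<in> {0}"
    proof (rule s_inv[OF XW(2)])
      fix A B assume AB: "A \<in> \<nn>" "B \<in> \<nn>"
      show "brk P2 (brk A B) \<in> {0}"
        unfolding brk_jacobi[of P2 A B] c[OF AB(1)] c[OF AB(2)] by simp
    qed (rule subspace_single_0)
    then have 6: "brk P2 W = 0" by simp
    have "brk U V = (brk Z X + brk Z W) + (brk P1 X + brk P1 W)"
      unfolding Ueq XW(3) brk_add_left brk_add_right 5 6 by simp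
    then show ?thesis
      using subspace_add[OF I_sub subspace_add[OF I_sub 1 2] subspace_add[OF I_sub 3 4]] by simp
  qed
  moreover have "I \<subseteq> \<gg>"
    unfolding I_def using np s_k k_g by (auto intro: g_add)
  ultimately have "I = {0} \<or> I = \<gg>"
    using simple I_sub unfolding simple_lie_algebra_def by blast
  then show ?thesis
  proof
    assume "I = {0}"
    then have "\<nn> = {0}" using I_n subspace_0[OF n(1)] by blast
    then show ?thesis ..
  next
    assume Ig: "I = \<gg>"
    have "P \<in> \<nn>" if P: "P \<in> \<pp>" for P
    proof -
      obtain X W where XW: "X \<in> \<nn>" "W \<in> \<ss>" "P = X + W" using Ig p_g[OF P] unfolding I_def by blast
      have "W \<in> \<pp>" using subspace_diff[OF subspace_p P np(1)[OF XW(1)]] XW(3) by simp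
      then have "W = 0" using k_p_zero s_k XW(2) by blast
      then show ?thesis using XW by simp
    qed
    then show ?thesis using n(2) by blast
  qed
qed

end

locale hermitian_pair = cartan_pair \<gg> \<theta> for \<gg> :: "'n::finite rmat set" and \<theta> +
  fixes J :: "'n rmat \<Rightarrow> 'n rmat"
  assumes J_mem: "X \<in> \<pp> \<Longrightarrow> J X \<in> \<pp>" and J_J: "X \<in> \<pp> \<Longrightarrow> J (J X) = - X"
    and J_linear: "X \<in> \<pp> \<Longrightarrow> Y \<in> \<pp> \<Longrightarrow> J (a *\<^sub>R X + b *\<^sub>R Y) = a *\<^sub>R J X + b *\<^sub>R J Y"
    and J_k: "Z \<in> \<kk> \<Longrightarrow> X \<in> \<pp> \<Longrightarrow> J (brk Z X) = brk Z (J X)"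
begin

lemma J_add: "X \<in> \<pp> \<Longrightarrow> Y \<in> \<pp> \<Longrightarrow> J (X + Y) = J X + J Y"
  using J_linear[of X Y 1 1] by simp
lemma J_scaleR: "X \<in> \<pp> \<Longrightarrow> J (c *\<^sub>R X) = c *\<^sub>R J X"
  using J_linear[of X X c 0] by simp
lemma J_minus: "X \<in> \<pp> \<Longrightarrow> J (- X) = - J X"
  using J_scaleR[of X "-1"] by simp
lemma J_diff: "X \<in> \<pp> \<Longrightarrow> Y \<in> \<pp> \<Longrightarrow> J (X - Y) = J X - J Y"
  using J_linear[of X Y 1 "-1"] by simp

text \<open>
  A real form of Schur's lemma. Let \<open>c\<close> be the minimum of \<open>\<kappa> (J X) (J X) / \<kappa> X X\<close>. The difference \<open>q\<close> of the
  pullback and \<open>c \<kappa>\<close> is positive semidefinite and vanishes at a minimum point, which therefore lies in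
  its radical; the radical is \<open>\<kk>\<close>-invariant, so it is all of \<open>\<pp>\<close>.
\<close>

lemma J_pullback_multiple:
  assumes "\<pp> \<noteq> {0}"
  shows "\<exists>c. \<forall>X\<in>\<pp>. \<forall>Y\<in>\<pp>. \<kappa> (J X) (J Y) = c * \<kappa> X Y"
proof -
  obtain P where P: "linear P" "\<And>v. P v \<in> \<pp>" "\<And>v. v \<in> \<pp> \<Longrightarrow> P v = v"
    using linear_subspace_projection[OF subspace_p] by blast
  note Pg = p_g[OF P(2)] and JPg = p_g[OF J_mem[OF P(2)]]
  have b: "bilinear (\<lambda>X Y. \<kappa> (P X) (P Y))"
    unfolding bilinear_def
    by (intro conjI allI linearI)
       (simp_all add: linear_add[OF P(1)] linear_scale[OF P(1)] killing_add_left killing_add_right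
          killing_scaleR_left killing_scaleR_right Pg)
  have bJ: "bilinear (\<lambda>X Y. \<kappa> (J (P X)) (J (P Y)))"
    unfolding bilinear_def
    by (intro conjI allI linearI)
       (simp_all add: linear_add[OF P(1)] linear_scale[OF P(1)] J_add J_scaleR P(2) killing_add_left killing_add_right
          killing_scaleR_left killing_scaleR_right JPg)
  note bl = b[unfolded bilinear_conv_bounded_bilinear] and blJ = bJ[unfolded bilinear_conv_bounded_bilinear]
  define f where "f = (\<lambda>X. \<kappa> (J (P X)) (J (P X)) / \<kappa> (P X) (P X))"
  define S where "S = {X \<in> \<pp>. norm X = 1}"
  have pos: "\<kappa> X X > 0" if "X \<in> S" for X
    using that killing_p_pos[of X] unfolding S_def by force
  have "S = sphere 0 1 \<inter> \<pp>" by (auto simp: S_def)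
  then have S_compact: "compact S"
    using compact_Int_closed[OF compact_sphere closed_subspace[OF subspace_p]] by simp
  have S_nonempty: "S \<noteq> {}"
  proof -
    obtain X where X: "X \<in> \<pp>" "X \<noteq> 0" using assms subspace_0[OF subspace_p] by blast
    then have "(inverse (norm X)) *\<^sub>R X \<in> S" by (simp add: S_def subspace_scale[OF subspace_p])
    then show ?thesis by blast
  qed
  have f_cont: "continuous_on S f"
    unfolding f_def
    by (intro continuous_on_divide bounded_bilinear.continuous_on[OF bl] bounded_bilinear.continuous_on[OF blJ] continuous_on_id ballI)
       (use pos P(3) in \<open>force simp: S_def\<close>)
  obtain X0 where X0: "X0 \<in> S" "\<And>X. X \<in> S \<Longrightarrow> f X0 \<le> f X"
    using continuous_attains_inf[OF S_compact S_nonempty f_cont] by blast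
  define c where "c = f X0"
  define q where "q = (\<lambda>X Y. \<kappa> (J X) (J Y) - c * \<kappa> X Y)"
  have X0p: "X0 \<in> \<pp>" using X0(1) by (simp add: S_def)
  note p = p_g p_g[OF J_mem] J_mem
  have q_add: "q (X + X') Y = q X Y + q X' Y" if "X \<in> \<pp>" "X' \<in> \<pp>" "Y \<in> \<pp>" for X X' Y
    using that by (simp add: q_def J_add killing_add_left p algebra_simps)
  have q_scale: "q (r *\<^sub>R X) Y = r * q X Y" if "X \<in> \<pp>" "Y \<in> \<pp>" for r X Y
    using that by (simp add: q_def J_scaleR killing_scaleR_left p algebra_simps)
  have q_sym: "q X Y = q Y X" if "X \<in> \<pp>" "Y \<in> \<pp>" for X Y
    using that killing_sym[of X Y] killing_sym[of "J X" "J Y"] by (simp add: q_def p)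
  have q_pos: "q X X \<ge> 0" if X: "X \<in> \<pp>" for X
  proof (cases "X = 0")
    case True
    then show ?thesis using q_scale[OF X X, of 0] by simp
  next
    case False
    define U where "U = (inverse (norm X)) *\<^sub>R X"
    have U: "U \<in> S" "U \<in> \<pp>" using False X by (simp_all add: S_def U_def subspace_scale[OF subspace_p])
    have "c \<le> \<kappa> (J U) (J U) / \<kappa> U U"
      using X0(2)[OF U(1)] by (simp add: c_def f_def P(3) U X0p)
    then have "q U U \<ge> 0"
      using pos[OF U(1)] by (simp add: q_def field_simps)
    moreover have XU: "X = norm X *\<^sub>R U" using False by (simp add: U_def)
    have nU: "norm X *\<^sub>R U \<in> \<pp>" by (rule subspace_scale[OF subspace_p U(2)])
    have "q (norm X *\<^sub>R U) (norm X *\<^sub>R U) = (norm X)\<^sup>2 * q U U"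
      unfolding q_scale[OF U(2) nU] q_sym[OF U(2) nU] q_scale[OF U(2) U(2)] by (simp add: power2_eq_square)
    then have "q X X = (norm X)\<^sup>2 * q U U"
      unfolding XU[symmetric] .
    ultimately show ?thesis by simp
  qed
  have q_X0: "q X0 X0 = 0"
    using pos[OF X0(1)] by (simp add: q_def c_def f_def P(3) X0p)
  have q_X0_orth: "q X0 Y = 0" if Y: "Y \<in> \<pp>" for Y
  proof (rule quadratic_nonneg_imp_zero)
    fix t :: real
    have tY: "t *\<^sub>R Y \<in> \<pp>" by (rule subspace_scale[OF subspace_p Y])
    have sum: "X0 + t *\<^sub>R Y \<in> \<pp>" by (rule subspace_add[OF subspace_p X0p tY])
    have "q (X0 + t *\<^sub>R Y) (X0 + t *\<^sub>R Y) = q (X0 + t *\<^sub>R Y) X0 + t * q (X0 + t *\<^sub>R Y) Y"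
      using q_add[OF X0p tY sum] q_scale[OF Y sum, of t] q_sym[OF X0p sum] q_sym[OF Y sum] by simp
    also have "\<dots> = 2 * t * q X0 Y + t\<^sup>2 * q Y Y"
      using q_add[OF X0p tY X0p] q_add[OF X0p tY Y] q_scale[OF Y X0p, of t] q_scale[OF Y Y, of t] q_sym[OF Y X0p] q_X0
      by (simp add: algebra_simps power2_eq_square)
    finally show "2 * t * q X0 Y + t\<^sup>2 * q Y Y \<ge> 0"
      using q_pos[OF sum] by simp
  qed
  define \<nn> where "\<nn> = {X \<in> \<pp>. \<forall>Y\<in>\<pp>. q X Y = 0}"
  have "q 0 Y = 0" if "Y \<in> \<pp>" for Y
    using q_scale[OF that that, of 0] by simp
  then have "subspace \<nn>"
    unfolding subspace_def \<nn>_def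
    by (auto simp: q_add q_scale subspace_0[OF subspace_p] subspace_add[OF subspace_p] subspace_scale[OF subspace_p])
  moreover have "\<nn> \<subseteq> \<pp>" by (auto simp: \<nn>_def)
  moreover have "brk Z X \<in> \<nn>" if Z: "Z \<in> \<kk>" and X: "X \<in> \<nn>" for Z X
  proof -
    have Xp: "X \<in> \<pp>" using X by (simp add: \<nn>_def)
    have "q (brk Z X) Y = 0" if Y: "Y \<in> \<pp>" for Y
    proof -
      have "q (brk Z X) Y = - q X (brk Z Y)"
        unfolding q_def J_k[OF Z Xp] J_k[OF Z Y]
          killing_skew[OF p_g[OF Xp] p_g[OF Y] k_g[OF Z]]
          killing_skew[OF p_g[OF J_mem[OF Xp]] p_g[OF J_mem[OF Y]] k_g[OF Z]] by simp
      then show ?thesis using X brk_kp[OF Z Y] by (simp add: \<nn>_def)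
    qed
    then show ?thesis using brk_kp[OF Z Xp] by (simp add: \<nn>_def)
  qed
  ultimately have "\<nn> = {0} \<or> \<nn> = \<pp>" by (rule p_irreducible)
  moreover have "X0 \<in> \<nn>" "X0 \<noteq> 0"
    using X0p q_X0_orth X0(1) by (auto simp: \<nn>_def S_def)
  ultimately have "\<nn> = \<pp>" by blast
  then have "\<forall>X\<in>\<pp>. \<forall>Y\<in>\<pp>. q X Y = 0" by (auto simp: \<nn>_def)
  then show ?thesis unfolding q_def by (intro exI[of _ c]) simp
qed

text \<open>The multiplier is positive with square \<open>1\<close>, as \<open>J\<^sup>2 = -1\<close>.\<close>

lemma J_orthogonal:
  assumes X: "X \<in> \<pp>" and Y: "Y \<in> \<pp>"
  shows "\<kappa> (J X) (J Y) = \<kappa> X Y"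
proof (cases "\<pp> = {0}")
  case True
  then have "J X = X" "J Y = Y" using J_mem[OF X] J_mem[OF Y] X Y by auto
  then show ?thesis by simp
next
  case False
  obtain c where c: "\<And>X Y. X \<in> \<pp> \<Longrightarrow> Y \<in> \<pp> \<Longrightarrow> \<kappa> (J X) (J Y) = c * \<kappa> X Y"
    using J_pullback_multiple[OF False] by blast
  obtain U where U: "U \<in> \<pp>" "U \<noteq> 0" using False subspace_0[OF subspace_p] by blast
  have "J U \<noteq> 0"
  proof
    assume "J U = 0"
    then have "- U = J 0" using J_J[OF U(1)] by simp
    also have "J 0 = 0" using J_scaleR[OF U(1), of 0] by simp
    finally show False using U(2) by simp
  qed
  then have 1: "\<kappa> (J U) (J U) > 0" "\<kappa> U U > 0"
    using killing_p_pos J_mem U by auto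
  then have "c > 0"
    using c[OF U(1) U(1)] by (simp add: zero_less_mult_iff)
  have "\<kappa> U U = \<kappa> (J (J U)) (J (J U))"
    using J_J[OF U(1)] p_g[OF U(1)] by (simp add: killing_minus g_minus)
  also have "\<dots> = c * c * \<kappa> U U"
    using c[OF J_mem[OF U(1)] J_mem[OF U(1)]] c[OF U(1) U(1)] by simp
  finally have "c * c = 1" using 1 by simp
  then have "c = 1" using \<open>c > 0\<close> by (simp add: square_eq_1_iff)
  then show ?thesis using c[OF X Y] by simp
qed

text \<open>This is what makes \<open>\<pp>\<^sup>+\<close> and \<open>\<pp>\<^sup>-\<close> abelian. Both sides lie in \<open>\<kk>\<close> and have the same Killing products with
  \<open>\<kk>\<close>.\<close>

theorem J_brk:
  assumes X: "X \<in> \<pp>" and Y: "Y \<in> \<pp>"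
  shows "brk (J X) (J Y) = brk X Y"
proof -
  have g: "X \<in> \<gg>" "Y \<in> \<gg>" "J X \<in> \<gg>" "J Y \<in> \<gg>" using X Y p_g J_mem by auto
  have eq: "\<kappa> (brk (J X) (J Y)) V = \<kappa> (brk X Y) V" if V: "V \<in> \<kk>" for V
  proof -
    have Vg: "V \<in> \<gg>" by (rule k_g[OF V])
    have 1: "\<kappa> (brk A B) V = - \<kappa> A (brk V B)" if "A \<in> \<gg>" "B \<in> \<gg>" for A B
      using killing_invariant[OF that Vg] killing_minus(2)[OF that(1) brk_mem[OF Vg that(2)]]
      by (simp add: brk_antisym[of B V])
    have "\<kappa> (brk (J X) (J Y)) V = - \<kappa> (J X) (J (brk V Y))"
      using 1[OF g(3,4)] J_k[OF V Y] by simp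
    also have "\<dots> = - \<kappa> X (brk V Y)"
      using J_orthogonal[OF X brk_kp[OF V Y]] by simp
    finally show ?thesis using 1[OF g(1,2)] by simp
  qed
  define W where "W = brk (J X) (J Y) - brk X Y"
  have W: "W \<in> \<kk>"
    unfolding W_def by (intro subspace_diff[OF subspace_k] brk_pp J_mem X Y)
  have "\<kappa> W W = 0"
    unfolding W_def[THEN arg_cong[where f = "\<lambda>A. \<kappa> A W"]]
    using killing_diff(1)[OF brk_mem[OF g(3,4)] brk_mem[OF g(1,2)] k_g[OF W]] eq[OF W] by simp
  then have "W = 0" using killing_k_neg[OF W] by force
  then show ?thesis by (simp add: W_def)
qed

text \<open>The \<open>-1\<close>-eigenspace of an automorphism \<open>s\<close> in \<open>\<pp>\<close> is the orthogonal complement of the \<open>+1\<close>-eigenspace,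
  and \<open>J\<close> is orthogonal.\<close>

lemma J_preserves_complement:
  assumes s: "endo_on \<gg> s" "\<And>X Y. X \<in> \<gg> \<Longrightarrow> Y \<in> \<gg> \<Longrightarrow> s (brk X Y) = brk (s X) (s Y)" "\<And>X. X \<in> \<gg> \<Longrightarrow> s (s X) = X"
    and comm: "\<And>X. X \<in> \<gg> \<Longrightarrow> s (\<theta> X) = \<theta> (s X)"
    and J_fixed: "\<And>X. X \<in> \<pp> \<Longrightarrow> s X = X \<Longrightarrow> s (J X) = J X"
    and X: "X \<in> \<pp>" "s X = - X"
  shows "s (J X) = - J X"
proof -
  have s_p: "s Y \<in> \<pp>" if "Y \<in> \<pp>" for Y
    using that comm[of Y] endo_onD(1)[OF s(1), of Y] endo_onD(3)[OF s(1), of Y "-1"] by (simp add: \<pp>_def)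
  define U where "U = J X + s (J X)"
  have JX: "J X \<in> \<pp>" "J X \<in> \<gg>" "s (J X) \<in> \<pp>" "s (J X) \<in> \<gg>"
    using X J_mem s_p p_g by auto
  have U: "U \<in> \<pp>" "U \<in> \<gg>" "s U = U"
    using JX subspace_add[OF subspace_p] p_g
    by (auto simp: U_def endo_onD(2)[OF s(1)] s(3) add.commute)
  have sign: "\<kappa> A B = 0" if "A \<in> \<gg>" "B \<in> \<gg>" "s A = A" "s B = - B" for A B
    using killing_automorphism[OF s that(1,2)] that killing_minus(2)[OF that(1,2)] by simp
  have "\<kappa> U (J X) = \<kappa> (J U) (J (J X))"
    using J_orthogonal[OF U(1) JX(1)] by simp
  also have "\<dots> = - \<kappa> (J U) X"
    using J_J[OF X(1)] killing_minus(2)[of "J U" X] X U J_mem p_g by simp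
  also have "\<dots> = 0"
    using sign[of "J U" X] J_fixed[OF U(1,3)] X U J_mem p_g by simp
  finally have 1: "\<kappa> U (J X) = 0" .
  have "\<kappa> U (s (J X)) = \<kappa> (s U) (s (J X))" using U by simp
  also have "\<dots> = \<kappa> U (J X)" by (rule killing_automorphism[OF s U(2) JX(2)])
  finally have "\<kappa> U U = 0"
    using 1 killing_add_right[OF U(2) JX(2,4)] by (simp add: U_def[symmetric])
  then have "U = 0" using killing_p_pos[OF U(1)] by force
  then show ?thesis by (simp add: U_def eq_neg_iff_add_eq_0 add.commute)
qed

end

section \<open>Derivations of a polynomial algebra\<close>

text \<open>The algebra generated by a set \<open>C\<close> of coordinates. Choosing \<open>C\<close> instead of all real linear functions
  allows complex linear coordinates only, so that derivations are complex linear in the vector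
  field.\<close>

inductive_set polys :: "('e::euclidean_space \<Rightarrow> complex) set \<Rightarrow> ('e \<Rightarrow> complex) set"
  for C :: "('e \<Rightarrow> complex) set" where
  const: "(\<lambda>_. c) \<in> polys C"
| coord: "l \<in> C \<Longrightarrow> l \<in> polys C"
| add: "f \<in> polys C \<Longrightarrow> g \<in> polys C \<Longrightarrow> (\<lambda>p. f p + g p) \<in> polys C"
| mult: "f \<in> polys C \<Longrightarrow> g \<in> polys C \<Longrightarrow> (\<lambda>p. f p * g p) \<in> polys C"

definition lie_deriv :: "('e::euclidean_space \<Rightarrow> 'e) \<Rightarrow> ('e \<Rightarrow> complex) \<Rightarrow> 'e \<Rightarrow> complex" where
  "lie_deriv X f p = frechet_derivative f (at p) (X p)"

locale polynomial_ring =
  fixes C :: "('e::euclidean_space \<Rightarrow> complex) set"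
  assumes coord_linear: "l \<in> C \<Longrightarrow> bounded_linear l"
begin

lemma polys_differentiable: "f \<in> polys C \<Longrightarrow> f differentiable (at p)"
  by (induction rule: polys.induct)
     (auto intro!: derivative_intros bounded_linear_imp_differentiable coord_linear)

lemma lie_deriv_eqI: "(f has_derivative f') (at p) \<Longrightarrow> lie_deriv X f p = f' (X p)"
  unfolding lie_deriv_def using frechet_derivative_at by metis

lemma polys_has_derivative:
  "f \<in> polys C \<Longrightarrow> (f has_derivative frechet_derivative f (at p)) (at p)"
  using polys_differentiable frechet_derivative_works by blast

lemma lie_deriv_const: "lie_deriv X (\<lambda>_. c) = (\<lambda>_. 0)"
  by (rule ext, rule lie_deriv_eqI) (rule derivative_intros)

lemma lie_deriv_coord: "l \<in> C \<Longrightarrow> lie_deriv X l = (\<lambda>p. l (X p))"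
  by (rule ext, rule lie_deriv_eqI) (rule bounded_linear_imp_has_derivative[OF coord_linear])

lemma lie_deriv_add:
  assumes "f \<in> polys C" "g \<in> polys C"
  shows "lie_deriv X (\<lambda>p. f p + g p) = (\<lambda>p. lie_deriv X f p + lie_deriv X g p)"
  using lie_deriv_eqI[OF has_derivative_add[OF polys_has_derivative[OF assms(1)] polys_has_derivative[OF assms(2)]]]
  by (auto simp: lie_deriv_def)

lemma lie_deriv_mult:
  assumes "f \<in> polys C" "g \<in> polys C"
  shows "lie_deriv X (\<lambda>p. f p * g p) = (\<lambda>p. f p * lie_deriv X g p + lie_deriv X f p * g p)"
  using lie_deriv_eqI[OF has_derivative_mult[OF polys_has_derivative[OF assms(1)] polys_has_derivative[OF assms(2)]]]
  by (auto simp: lie_deriv_def)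

lemma lie_deriv_cmult:
  assumes "f \<in> polys C"
  shows "lie_deriv X (\<lambda>p. c * f p) = (\<lambda>p. c * lie_deriv X f p)"
  using lie_deriv_mult[OF polys.const assms] by (simp add: lie_deriv_const)

lemma polys_sum: "(\<And>i. i \<in> I \<Longrightarrow> f i \<in> polys C) \<Longrightarrow> (\<lambda>p. \<Sum>i\<in>I. f i p) \<in> polys C"
  by (induction I rule: infinite_finite_induct) (auto intro: polys.intros)

definition polynomial_field :: "('e \<Rightarrow> 'e) \<Rightarrow> bool" where
  "polynomial_field X \<longleftrightarrow> (\<forall>l\<in>C. (\<lambda>p. l (X p)) \<in> polys C)"

lemma lie_deriv_polys: "f \<in> polys C \<Longrightarrow> polynomial_field X \<Longrightarrow> lie_deriv X f \<in> polys C"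
  by (induction rule: polys.induct)
     (auto simp: lie_deriv_const lie_deriv_coord lie_deriv_add lie_deriv_mult polynomial_field_def
       intro: polys.intros)

text \<open>The commutator of two derivations is a derivation, and a derivation is determined by its values
  on generators.\<close>

lemma lie_deriv_commutator:
  assumes "polynomial_field X" "polynomial_field Y" 
    and "\<And>l. l \<in> C \<Longrightarrow>
      lie_deriv X (\<lambda>p. l (Y p)) p - lie_deriv Y (\<lambda>p. l (X p)) p = l (Z p)"
    and "f \<in> polys C"
  shows "lie_deriv X (lie_deriv Y f) p - lie_deriv Y (lie_deriv X f) p = lie_deriv Z f p"
  using assms(4)
proof (induction rule: polys.induct)
  case (mult f g)
  have fg: "lie_deriv X f \<in> polys C" "lie_deriv Y f \<in> polys C" "lie_deriv X g \<in> polys C"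
    "lie_deriv Y g \<in> polys C"
    using mult assms lie_deriv_polys by auto
  have "lie_deriv X (lie_deriv Y (\<lambda>p. f p * g p)) p - lie_deriv Y (lie_deriv X (\<lambda>p. f p * g p)) p
     = f p * (lie_deriv X (lie_deriv Y g) p - lie_deriv Y (lie_deriv X g) p)
       + (lie_deriv X (lie_deriv Y f) p - lie_deriv Y (lie_deriv X f) p) * g p"
    using mult fg
    by (simp add: lie_deriv_mult lie_deriv_add polys.mult algebra_simps)
  then show ?case
    using mult by (simp add: lie_deriv_mult)
qed (use assms in \<open>simp_all add: lie_deriv_const lie_deriv_add lie_deriv_coord lie_deriv_polys add_diff_add\<close>)

lemma lie_deriv_linear_field:
  assumes "f \<in> polys C"
    and "\<And>l. l \<in> C \<Longrightarrow> l (Z p) = a * l (X p) + b * l (Y p)"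
  shows "lie_deriv Z f p = a * lie_deriv X f p + b * lie_deriv Y f p"
  using assms(1)
  by (induction rule: polys.induct)
     (use assms(2) in \<open>simp_all add: lie_deriv_const lie_deriv_add lie_deriv_mult lie_deriv_coord algebra_simps\<close>)

end

section \<open>Vector fields for an abelian complement of a subalgebra\<close>

text \<open>Functions of \<open>(x, w)\<close> that are linear in \<open>w \<in> W\<close> stand for functions of \<open>x\<close> with values in the
  dual of \<open>W\<close>. With \<open>w\<close> as an extra variable, the action of a Lie algebra on such functions is by
  vector fields alone, without a separate term for the action on \<open>W\<close>.\<close>

type_synonym ('n, 'm) vfield_space = "'n cmat \<times> (complex^'m)"

definition coordinates :: "(('n::finite, 'm::finite) vfield_space \<Rightarrow> complex) set" where
  "coordinates = {\<lambda>p. fst p $ i $ j | i j. True} \<union> {\<lambda>p. snd p $ k | k. True}"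

definition complex_linear :: "('n::finite cmat \<Rightarrow> 'm::finite cmat) \<Rightarrow> bool" where
  "complex_linear f \<longleftrightarrow> (\<forall>X Y. f (X + Y) = f X + f Y) \<and> (\<forall>c X. f (scale_mat c X) = scale_mat c (f X))"

lemma complex_linear_zero: "complex_linear f \<Longrightarrow> f 0 = 0"
  unfolding complex_linear_def by (metis add_cancel_right_right)
lemma complex_linear_add: "complex_linear f \<Longrightarrow> f (X + Y) = f X + f Y"
  and complex_linear_scale: "complex_linear f \<Longrightarrow> f (scale_mat c X) = scale_mat c (f X)"
  unfolding complex_linear_def by auto
lemma complex_linear_minus: "complex_linear f \<Longrightarrow> f (- X) = - f X"
  using complex_linear_scale[of f "-1" X] by (simp add: scale_mat_neg_one)
lemma complex_linear_diff: "complex_linear f \<Longrightarrow> f (X - Y) = f X - f Y"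
  using complex_linear_add[of f X "- Y"] by (simp add: complex_linear_minus)
lemma complex_linear_scaleR: "complex_linear f \<Longrightarrow> f (r *\<^sub>R X) = r *\<^sub>R f X"
  using complex_linear_scale[of f "of_real r" X] by (simp add: scale_mat_of_real)
lemma complex_linear_sum: "complex_linear f \<Longrightarrow> f (sum g I) = (\<Sum>i\<in>I. f (g i))"
  by (induction I rule: infinite_finite_induct) (simp_all add: complex_linear_zero complex_linear_add)
lemmas complex_linear_simps = complex_linear_zero complex_linear_add complex_linear_minus
  complex_linear_diff complex_linear_scaleR

definition matrix_unit :: "'n \<Rightarrow> 'n \<Rightarrow> 'n::finite cmat" where
  "matrix_unit i j = (\<chi> a b. if a = i \<and> b = j then 1 else 0)"

lemma matrix_unit_expansion: "X = (\<Sum>i\<in>UNIV. \<Sum>j\<in>UNIV. scale_mat (X $ i $ j) (matrix_unit i j))"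
proof -
  have "(\<Sum>i\<in>UNIV. \<Sum>j\<in>UNIV. scale_mat (X $ i $ j) (matrix_unit i j)) $ a $ b = X $ a $ b" for a b
  proof -
    have "(\<Sum>i\<in>UNIV. \<Sum>j\<in>UNIV. scale_mat (X $ i $ j) (matrix_unit i j)) $ a $ b
       = (\<Sum>i\<in>UNIV. \<Sum>j\<in>UNIV. if a = i \<and> b = j then X $ i $ j else 0)"
      by (simp add: scale_mat_def matrix_unit_def if_distrib[of "times _"] cong: if_cong)
    also have "\<dots> = (\<Sum>i\<in>UNIV. if a = i then \<Sum>j\<in>UNIV. if b = j then X $ i $ j else 0 else 0)"
      by (intro sum.cong refl) auto
    also have "\<dots> = X $ a $ b"
      by simp
    finally show ?thesis .
  qed
  then show ?thesis
    by (simp add: vec_eq_iff)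
qed

lemma coordinates_linear:
  fixes l :: "('n::finite, 'm::finite) vfield_space \<Rightarrow> complex"
  assumes "l \<in> coordinates"
  shows "bounded_linear l"
unfolding linear_conv_bounded_linear[symmetric]
proof -
  from assms consider i j where "l = (\<lambda>p. fst p $ i $ j)" | k where "l = (\<lambda>p. snd p $ k)"
    unfolding coordinates_def by blast
  then show "linear l"
    by cases (auto simp: linear_iff)
qed

interpretation vf: polynomial_ring coordinates
  by (rule polynomial_ring.intro) (rule coordinates_linear)

definition matrix_poly :: "(('n::finite, 'm::finite) vfield_space \<Rightarrow> 'k::finite cmat) \<Rightarrow> bool" where
  "matrix_poly F \<longleftrightarrow> (\<forall>i j. (\<lambda>p. F p $ i $ j) \<in> polys coordinates)"

lemma polys_diff: "f \<in> polys C \<Longrightarrow> g \<in> polys C \<Longrightarrow> (\<lambda>p. f p - g p) \<in> polys C"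
  using polys.add[OF _ polys.mult[OF polys.const[of "-1"]], of f C g] by simp

lemma matrix_poly_const: "matrix_poly (\<lambda>_. A)"
  by (simp add: matrix_poly_def polys.const)
lemma matrix_poly_fst: "matrix_poly (\<lambda>p. fst p)"
  by (auto simp: matrix_poly_def coordinates_def intro!: polys.coord)
lemma matrix_poly_add: "matrix_poly F \<Longrightarrow> matrix_poly G \<Longrightarrow> matrix_poly (\<lambda>p. F p + G p)"
  by (simp add: matrix_poly_def polys.add)
lemma matrix_poly_diff: "matrix_poly F \<Longrightarrow> matrix_poly G \<Longrightarrow> matrix_poly (\<lambda>p. F p - G p)"
  by (simp add: matrix_poly_def polys_diff)
lemma matrix_poly_scaleR: "matrix_poly F \<Longrightarrow> matrix_poly (\<lambda>p. r *\<^sub>R F p)"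
  by (simp add: matrix_poly_def scaleR_conv_of_real polys.mult polys.const)
lemma matrix_poly_mult: "matrix_poly F \<Longrightarrow> matrix_poly G \<Longrightarrow> matrix_poly (\<lambda>p. F p ** G p)"
  by (simp add: matrix_poly_def matrix_matrix_mult_def polys.mult vf.polys_sum)
lemma matrix_poly_brk: "matrix_poly F \<Longrightarrow> matrix_poly G \<Longrightarrow> matrix_poly (\<lambda>p. brk (F p) (G p))"
  unfolding brk_def by (intro matrix_poly_diff matrix_poly_mult)

lemma matrix_poly_linear:
  assumes "complex_linear f" "matrix_poly F"
  shows "matrix_poly (\<lambda>p. f (F p))"
proof -
  have "f (F p) $ i $ j = (\<Sum>a\<in>UNIV. \<Sum>b\<in>UNIV. F p $ a $ b * f (matrix_unit a b) $ i $ j)" for p i j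
    by (subst (1) matrix_unit_expansion[of "F p"])
       (simp add: complex_linear_sum[OF assms(1)] complex_linear_scale[OF assms(1)], simp add: scale_mat_def)
  then show ?thesis
    using assms(2) unfolding matrix_poly_def
    by (auto intro!: vf.polys_sum polys.mult polys.const)
qed

lemma polys_line_derivative:
  assumes "f \<in> polys coordinates"
  shows "((\<lambda>t::real. f (p + t *\<^sub>R X p)) has_vector_derivative lie_deriv X f p) (at 0)"
proof -
  have "(f has_derivative frechet_derivative f (at p)) (at (p + 0 *\<^sub>R X p))"
    using vf.polys_has_derivative[OF assms(1)] by simp
  then have "((\<lambda>t::real. f (p + t *\<^sub>R X p)) has_derivative (\<lambda>t. frechet_derivative f (at p) (t *\<^sub>R X p))) (at 0)"
    by (rule has_derivative_compose[rotated]) (auto intro!: derivative_eq_intros)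
  moreover have "linear (frechet_derivative f (at p))"
    using vf.polys_has_derivative[OF assms(1)] has_derivative_linear by blast
  ultimately show ?thesis
    by (simp add: has_vector_derivative_def lie_deriv_def linear_scale)
qed

text \<open>A Lie derivative can be read off as the linear coefficient in the parameter of a line; degree
  three is all that occurs below.\<close>

lemma lie_deriv_along_line:
  assumes "f \<in> polys coordinates"
    and "\<And>t::real. f (p + t *\<^sub>R X p) = a + of_real t * b + (of_real t)\<^sup>2 * c + (of_real t)^3 * d"
  shows "lie_deriv X f p = b"
proof -
  have "((\<lambda>t::real. f (p + t *\<^sub>R X p)) has_vector_derivative b) (at 0)"
    unfolding assms(2)
    by (auto intro!: derivative_eq_intros has_vector_derivative_real_field simp: has_vector_derivative_def scaleR_conv_of_real)
  then show ?thesis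
    using vector_derivative_unique_at[OF polys_line_derivative[OF assms(1)]] by blast
qed

text \<open>
  \<open>\<gg>\<close> is the direct sum of an abelian subalgebra \<open>\<nn>\<close> and a subalgebra \<open>\<qq>\<close>, which is the kernel in
  \<open>\<gg>\<close> of a projection \<open>pr\<close> onto \<open>\<nn>\<close>, and \<open>\<rho>\<close> is a representation of \<open>\<qq>\<close>. Both \<open>pr\<close> and \<open>\<rho>\<close> are
  extended linearly to all matrices, which makes the formulas below polynomial on the whole space.
  Since \<open>(ad x)\<^sup>2\<close> maps \<open>\<gg>\<close> into \<open>\<nn>\<close> for \<open>x \<in> \<nn>\<close>, the series of \<open>exp (- ad x)\<close> stops after the
  quadratic term.
\<close>

locale abelian_complement =
  fixes \<gg> \<nn> :: "'n::finite cmat set" and pr :: "'n cmat \<Rightarrow> 'n cmat" and \<rho> :: "'n cmat \<Rightarrow> 'm::finite cmat"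
  assumes add: "X \<in> \<gg> \<Longrightarrow> Y \<in> \<gg> \<Longrightarrow> X + Y \<in> \<gg>"
    and scale: "X \<in> \<gg> \<Longrightarrow> scale_mat c X \<in> \<gg>"
    and brk: "X \<in> \<gg> \<Longrightarrow> Y \<in> \<gg> \<Longrightarrow> brk X Y \<in> \<gg>"
    and sub: "\<nn> \<subseteq> \<gg>"
    and abelian: "X \<in> \<nn> \<Longrightarrow> Y \<in> \<nn> \<Longrightarrow> brk X Y = 0"
    and quadratic: "X \<in> \<nn> \<Longrightarrow> A \<in> \<gg> \<Longrightarrow> brk X (brk X A) \<in> \<nn>"
    and pr_linear: "complex_linear pr"
    and pr_mem: "pr X \<in> \<nn>"
    and pr_id: "X \<in> \<nn> \<Longrightarrow> pr X = X"
    and \<rho>_linear: "complex_linear \<rho>"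
    and ker_brk: "\<lbrakk>X \<in> \<gg>; Y \<in> \<gg>; pr X = 0; pr Y = 0\<rbrakk> \<Longrightarrow> pr (brk X Y) = 0"
    and \<rho>_brk: "\<lbrakk>X \<in> \<gg>; Y \<in> \<gg>; pr X = 0; pr Y = 0\<rbrakk> \<Longrightarrow> \<rho> (brk X Y) = brk (\<rho> X) (\<rho> Y)"
begin

lemma diff: "X \<in> \<gg> \<Longrightarrow> Y \<in> \<gg> \<Longrightarrow> X - Y \<in> \<gg>"
  using add[of X "- Y"] scale[of Y "-1"] by (simp add: scale_mat_neg_one)

lemma scaleR: "X \<in> \<gg> \<Longrightarrow> r *\<^sub>R X \<in> \<gg>"
  using scale[of X "of_real r"] by (simp add: scale_mat_of_real)

text \<open>\<open>twist y\<close> is \<open>exp (- ad y)\<close>.\<close>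

definition twist :: "'n cmat \<Rightarrow> 'n cmat \<Rightarrow> 'n cmat" where
  "twist y A = A - brk y A + (1/2) *\<^sub>R brk y (brk y A)"

text \<open>
  In a local group with Lie algebra \<open>\<gg>\<close> one has \<open>exp(tA) exp(x) = exp(x) exp(tB)\<close> with
  \<open>B = exp(- ad x) A\<close>. Hence left translation by \<open>exp(tA)\<close> moves the point \<open>x\<close> of the chart \<open>\<nn>\<close> of
  the quotient by \<open>exp \<qq>\<close> with velocity \<open>pr B\<close>, and the fibre by \<open>\<rho>\<close> of the remainder \<open>B - pr B\<close>.
  The field below is this formula, whose properties are then verified algebraically.
\<close>

definition vfield :: "'n cmat \<Rightarrow> ('n, 'm) vfield_space \<Rightarrow> ('n, 'm) vfield_space" where
  "vfield A p = (let T = twist (pr (fst p)) A in (pr T, \<rho> (T - pr T) *v snd p))"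

lemma twist_mem: "y \<in> \<nn> \<Longrightarrow> A \<in> \<gg> \<Longrightarrow> twist y A \<in> \<gg>"
  unfolding twist_def using sub by (intro add diff scaleR brk) auto

text \<open>\<open>exp (- ad y)\<close> is an automorphism of \<open>\<gg>\<close>. Beyond the Leibniz rule in degree at most two this
  needs the terms of degree three to cancel, by \<open>(ad y)\<^sup>3 = 0\<close>, and that of degree four to vanish, as
  \<open>\<nn>\<close> is abelian.\<close>

lemma twist_brk:
  assumes y: "y \<in> \<nn>" and A: "A \<in> \<gg>" and B: "B \<in> \<gg>"
  shows "twist y (brk A B) = brk (twist y A) (twist y B)"
proof -
  define A1 A2 B1 B2 where "A1 = brk y A" and "A2 = brk y A1" and "B1 = brk y B" and "B2 = brk y B1"
  have mem: "A2 \<in> \<nn>" "B2 \<in> \<nn>" 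
    using quadratic[OF y A] quadratic[OF y B] by (simp_all add: A1_def A2_def B1_def B2_def)
  then have 0: "brk y A2 = 0" "brk y B2 = 0" "brk A2 B2 = 0"
    using abelian y by auto
  have 1: "brk y (brk A B) = brk A1 B + brk A B1"
    unfolding A1_def B1_def by (rule brk_jacobi)
  have 2: "brk y (brk y (brk A B)) = brk A2 B + 2 *\<^sub>R brk A1 B1 + brk A B2"
    unfolding 1 brk_linear brk_jacobi[of y A1] brk_jacobi[of y A] A1_def[symmetric] B1_def[symmetric]
      A2_def[symmetric] B2_def[symmetric]
    by (simp add: scaleR_2 algebra_simps)
  have "brk y (brk y (brk A B)) \<in> \<nn>"
    using quadratic[OF y brk[OF A B]] .
  then have "brk y (brk y (brk y (brk A B))) = 0"
    using abelian y by auto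
  moreover have "brk y (brk y (brk y (brk A B))) = 3 *\<^sub>R (brk A2 B1 + brk A1 B2)"
    unfolding 2 brk_linear brk_scaleR_right brk_jacobi[of y A1] brk_jacobi[of y A] brk_jacobi[of y A2]
      A1_def[symmetric] B1_def[symmetric] A2_def[symmetric] B2_def[symmetric] 0
    by (simp add: vec_eq_iff) (simp add: scaleR_conv_of_real algebra_simps)
  ultimately have 3: "brk A2 B1 = - brk A1 B2"
    by (simp add: eq_neg_iff_add_eq_0)
  show ?thesis
    unfolding twist_def 1 2 A1_def[symmetric] B1_def[symmetric] A2_def[symmetric] B2_def[symmetric]
    unfolding brk_linear brk_scaleR_right brk_scaleR_left 3 0
      brk_jacobi[of y A1] brk_jacobi[of y A] A1_def[symmetric] B1_def[symmetric]
      A2_def[symmetric] B2_def[symmetric]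
    by (simp add: vec_eq_iff) (simp add: scaleR_conv_of_real algebra_simps)
qed

lemma twist_line:
  assumes y: "y \<in> \<nn>" and u: "u \<in> \<nn>" and A: "A \<in> \<gg>"
  shows "twist (y + t *\<^sub>R u) A =
    twist y A - t *\<^sub>R brk u (twist y A) + t\<^sup>2 *\<^sub>R ((1/2) *\<^sub>R brk u (brk u A))"
proof -
  have "brk u (brk y (brk y A)) = 0"
    using quadratic[OF y A] u abelian by auto
  moreover have "brk y (brk u A) = brk u (brk y A)"
    using brk_jacobi[of y u A] abelian[OF y u] by simp
  ultimately show ?thesis
    unfolding twist_def brk_linear brk_scaleR_left brk_scaleR_right
    by (simp add: vec_eq_iff) (simp add: scaleR_conv_of_real algebra_simps power2_eq_square)
qed

lemma twist_linear: "twist y (scale_mat a X + scale_mat b Y) = scale_mat a (twist y X) + scale_mat b (twist y Y)"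
  unfolding twist_def brk_linear brk_scale_right 
  by (simp add: scale_mat_add scale_mat_diff scale_mat_mult algebra_simps flip: scale_mat_of_real)

lemma matrix_poly_twist: "matrix_poly (\<lambda>p. twist (pr (fst p)) A)"
  unfolding twist_def
  by (intro matrix_poly_add matrix_poly_diff matrix_poly_scaleR matrix_poly_brk matrix_poly_const
      matrix_poly_linear[OF pr_linear] matrix_poly_fst)

lemma polynomial_vfield: "vf.polynomial_field (vfield A)"
proof -
  have "matrix_poly (\<lambda>p :: ('n, 'm) vfield_space. pr (twist (pr (fst p)) A) :: 'n cmat)"
    "matrix_poly (\<lambda>p :: ('n, 'm) vfield_space. \<rho> (twist (pr (fst p)) A - pr (twist (pr (fst p)) A)))"
    by (intro matrix_poly_diff matrix_poly_twist matrix_poly_linear[OF pr_linear] matrix_poly_linear[OF \<rho>_linear])+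
  moreover have "(\<lambda>p. snd p $ k) \<in> polys coordinates" for k
    by (auto simp: coordinates_def intro!: polys.coord)
  ultimately show ?thesis
    unfolding vf.polynomial_field_def vfield_def Let_def matrix_poly_def
    by (subst (1) coordinates_def) (auto simp: matrix_vector_mult_def intro!: vf.polys_sum polys.mult)
qed


definition defect :: "'n cmat \<Rightarrow> 'n cmat \<Rightarrow> 'n cmat" where
  "defect y A = twist y A - pr (twist y A)"

lemma defect_mem: "y \<in> \<nn> \<Longrightarrow> A \<in> \<gg> \<Longrightarrow> defect y A \<in> \<gg>"
  unfolding defect_def using sub pr_mem by (intro diff twist_mem) auto

lemma pr_defect: "pr (defect y A) = 0"
  by (simp add: defect_def complex_linear_simps[OF pr_linear] pr_id pr_mem)

text \<open>Since \<open>\<nn>\<close> is abelian, the derivative of \<open>exp (- ad y) B\<close> in a direction \<open>u \<in> \<nn>\<close> is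
  \<open>- [u, exp (- ad y) B]\<close>.\<close>

lemma lie_deriv_vfield:
  fixes p :: "('n, 'm) vfield_space"
  assumes A: "A \<in> \<gg>" and B: "B \<in> \<gg>" and l: "l \<in> coordinates"
  defines "y \<equiv> pr (fst p)"
  defines "C \<equiv> brk (pr (twist y A)) (twist y B)"
  shows "lie_deriv (vfield A) (\<lambda>p. l (vfield B p)) p =
    l (- pr C, \<rho> (defect y B) *v (\<rho> (defect y A) *v snd p) - \<rho> (C - pr C) *v snd p)"
proof (rule lie_deriv_along_line)
  show "(\<lambda>p. l (vfield B p)) \<in> polys coordinates"
    using polynomial_vfield l unfolding vf.polynomial_field_def by blast
  fix t :: real
  define u w v where "u = pr (twist y A)" and "w = snd p" and "v = \<rho> (defect y A) *v w"
  define D where "D = (1/2) *\<^sub>R brk u (brk u B)"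
  have yn: "y \<in> \<nn>" and un: "u \<in> \<nn>"
    by (auto simp: y_def u_def pr_mem)
  have "pr (fst (p + t *\<^sub>R vfield A p)) = y + t *\<^sub>R u"
    using un by (simp add: vfield_def Let_def complex_linear_simps[OF pr_linear] pr_id pr_mem u_def y_def)
  then have T: "twist (pr (fst (p + t *\<^sub>R vfield A p))) B = twist y B - t *\<^sub>R C + t\<^sup>2 *\<^sub>R D"
    using twist_line[OF yn un B, of t] by (simp add: C_def u_def D_def)
  have S: "snd (p + t *\<^sub>R vfield A p) = w + of_real t *s v"
    by (simp add: vfield_def Let_def w_def v_def defect_def y_def vec_eq_iff) (simp add: scaleR_conv_of_real)
  have "vfield B (p + t *\<^sub>R vfield A p) =
     (pr (twist y B) - t *\<^sub>R pr C + t\<^sup>2 *\<^sub>R pr D,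
      (\<rho> (defect y B) - t *\<^sub>R \<rho> (C - pr C) + t\<^sup>2 *\<^sub>R \<rho> (D - pr D)) *v (w + of_real t *s v))"
    unfolding vfield_def[of B] Let_def T S
    by (simp add: complex_linear_simps[OF pr_linear] defect_def) 
      (simp add: complex_linear_simps[OF \<rho>_linear] algebra_simps)
  also have "\<dots> = (pr (twist y B) - t *\<^sub>R pr C + t\<^sup>2 *\<^sub>R pr D,
      \<rho> (defect y B) *v w + of_real t *s (\<rho> (defect y B) *v v - \<rho> (C - pr C) *v w)
      + (of_real t)\<^sup>2 *s (\<rho> (D - pr D) *v w - \<rho> (C - pr C) *v v)
      + (of_real t)^3 *s (\<rho> (D - pr D) *v v))"
    by (simp add: vec_eq_iff matrix_vector_mult_def sum.distrib sum_subtractf sum_distrib_left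
        algebra_simps power2_eq_square power3_eq_cube)
      (simp add: scaleR_conv_of_real sum_distrib_left mult.assoc mult.left_commute)
  finally have *: "vfield B (p + t *\<^sub>R vfield A p) = \<dots>" .
  show "l (vfield B (p + t *\<^sub>R vfield A p)) = l (vfield B p)
      + of_real t * l (- pr C, \<rho> (defect y B) *v (\<rho> (defect y A) *v snd p) - \<rho> (C - pr C) *v snd p)
      + (of_real t)\<^sup>2 * l (pr D, \<rho> (D - pr D) *v w - \<rho> (C - pr C) *v v)
      + (of_real t)^3 * l (0, \<rho> (D - pr D) *v v)"
    unfolding * using l
    by (auto simp: coordinates_def vfield_def Let_def y_def[symmetric] defect_def[symmetric] w_def[symmetric]
        v_def[symmetric] algebra_simps)
      (auto simp: scaleR_conv_of_real)
qed

text \<open>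
  The fields define an antirepresentation, like the fundamental vector fields of a left action.
  Writing \<open>a + \<alpha>\<close> and \<open>b + \<beta>\<close> for the images of \<open>A\<close> and \<open>B\<close> under \<open>exp (- ad y)\<close>, with parts in \<open>\<nn>\<close>
  and \<open>\<qq>\<close>, the claim reduces to \<open>[b, a + \<alpha>] - [a, b + \<beta>] = [b + \<beta>, a + \<alpha>] - [\<beta>, \<alpha>]\<close> and to \<open>\<rho>\<close>
  being a representation.
\<close>

lemma vfield_commutator:
  fixes p :: "('n, 'm) vfield_space"
  assumes A: "A \<in> \<gg>" and B: "B \<in> \<gg>" and f: "f \<in> polys coordinates"
  shows "lie_deriv (vfield A) (lie_deriv (vfield B) f) p - lie_deriv (vfield B) (lie_deriv (vfield A) f) p
    = lie_deriv (vfield (brk B A)) f p"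
proof (rule vf.lie_deriv_commutator[OF polynomial_vfield polynomial_vfield _ f])
  fix l :: "('n, 'm) vfield_space \<Rightarrow> complex"
  assume l: "l \<in> coordinates"
  define y w where "y = pr (fst p)" and "w = snd p"
  have yn: "y \<in> \<nn>" 
    by (simp add: y_def pr_mem)
  define a b \<alpha> \<beta> where "a = pr (twist y A)" and "b = pr (twist y B)"
    and "\<alpha> = defect y A" and "\<beta> = defect y B"
  have ab: "twist y A = a + \<alpha>" "twist y B = b + \<beta>"
    by (simp_all add: a_def b_def \<alpha>_def \<beta>_def defect_def)
  have mem: "\<alpha> \<in> \<gg>" "\<beta> \<in> \<gg>" "pr \<alpha> = 0" "pr \<beta> = 0"
    using defect_mem yn A B pr_defect by (auto simp: \<alpha>_def \<beta>_def)
  define P Q where "P = brk a (b + \<beta>)" and "Q = brk b (a + \<alpha>)"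
  have "brk b a = 0"
    using abelian by (simp add: a_def b_def pr_mem)
  then have QP: "Q - P = twist y (brk B A) - brk \<beta> \<alpha>"
    unfolding twist_brk[OF yn B A] ab P_def Q_def brk_linear
    using brk_antisym[of a b] brk_antisym[of a \<beta>] by simp
  have 1: "pr (Q - P) = pr (twist y (brk B A))"
    unfolding QP by (simp add: complex_linear_simps[OF pr_linear] ker_brk mem)
  have 2: "\<rho> ((Q - P) - pr (Q - P)) = \<rho> (defect y (brk B A)) - brk (\<rho> \<beta>) (\<rho> \<alpha>)"
    unfolding 1 unfolding QP defect_def using \<rho>_brk[of \<beta> \<alpha>] mem
    by (simp add: complex_linear_simps[OF \<rho>_linear])
  have "lie_deriv (vfield A) (\<lambda>p. l (vfield B p)) p - lie_deriv (vfield B) (\<lambda>p. l (vfield A p)) p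
     = l (- pr P, \<rho> \<beta> *v (\<rho> \<alpha> *v w) - \<rho> (P - pr P) *v w)
       - l (- pr Q, \<rho> \<alpha> *v (\<rho> \<beta> *v w) - \<rho> (Q - pr Q) *v w)"
    unfolding lie_deriv_vfield[OF A B l] lie_deriv_vfield[OF B A l] 
      y_def[symmetric] w_def[symmetric] 
    unfolding a_def[symmetric] b_def[symmetric] \<alpha>_def[symmetric] \<beta>_def[symmetric]
    unfolding P_def Q_def ab ..
  also have "\<dots> = l (pr (Q - P), brk (\<rho> \<beta>) (\<rho> \<alpha>) *v w + \<rho> ((Q - P) - pr (Q - P)) *v w)"
  proof -
    have "\<rho> ((Q - P) - pr (Q - P)) *v w = \<rho> (Q - pr Q) *v w - \<rho> (P - pr P) *v w"
      by (simp add: complex_linear_simps[OF \<rho>_linear] complex_linear_simps[OF pr_linear]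
          matrix_vector_mult_diff_rdistrib)
    moreover have "brk (\<rho> \<beta>) (\<rho> \<alpha>) *v w = \<rho> \<beta> *v (\<rho> \<alpha> *v w) - \<rho> \<alpha> *v (\<rho> \<beta> *v w)"
      by (simp add: brk_def matrix_vector_mult_diff_rdistrib matrix_vector_mul_assoc)
    ultimately have "\<rho> \<beta> *v (\<rho> \<alpha> *v w) - \<rho> (P - pr P) *v w - (\<rho> \<alpha> *v (\<rho> \<beta> *v w) - \<rho> (Q - pr Q) *v w)
        = brk (\<rho> \<beta>) (\<rho> \<alpha>) *v w + \<rho> ((Q - P) - pr (Q - P)) *v w"
      by simp
    moreover have "- pr P - - pr Q = pr (Q - P)"
      by (simp add: complex_linear_simps[OF pr_linear])
    ultimately show ?thesis
      by (simp only: linear_diff[OF bounded_linear.linear[OF coordinates_linear[OF l]], symmetric] diff_Pair)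
  qed
  also have "\<dots> = l (vfield (brk B A) p)"
    unfolding 2 unfolding 1 vfield_def Let_def y_def[symmetric] w_def[symmetric] defect_def
    by (simp add: matrix_vector_mult_diff_rdistrib)
  finally show "lie_deriv (vfield A) (\<lambda>p. l (vfield B p)) p - lie_deriv (vfield B) (\<lambda>p. l (vfield A p)) p
     = l (vfield (brk B A) p)" .
qed

lemma vfield_linear:
  fixes p :: "('n, 'm) vfield_space"
  assumes "f \<in> polys coordinates"
  shows "lie_deriv (vfield (scale_mat a X + scale_mat b Y)) f p = 
    a * lie_deriv (vfield X) f p + b * lie_deriv (vfield Y) f p"
proof (rule vf.lie_deriv_linear_field[OF assms])
  fix l :: "('n, 'm) vfield_space \<Rightarrow> complex"
  define y where "y = pr (fst p)"
  assume "l \<in> coordinates"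
  moreover have "pr (twist y (scale_mat a X + scale_mat b Y)) = scale_mat a (pr (twist y X)) + scale_mat b (pr (twist y Y))"
    by (simp add: twist_linear complex_linear_add[OF pr_linear] complex_linear_scale[OF pr_linear])
  moreover from this have "\<rho> (defect y (scale_mat a X + scale_mat b Y)) =
     scale_mat a (\<rho> (defect y X)) + scale_mat b (\<rho> (defect y Y))"
    by (simp add: defect_def twist_linear complex_linear_simps[OF \<rho>_linear] complex_linear_scale[OF \<rho>_linear]
       scale_mat_diff algebra_simps)
  ultimately show "l (vfield (scale_mat a X + scale_mat b Y) p) = a * l (vfield X p) + b * l (vfield Y p)"
    unfolding vfield_def Let_def y_def[symmetric] defect_def[symmetric]
    by (auto simp: coordinates_def scale_mat_vector matrix_vector_mult_add_rdistrib)
      (auto simp: scale_mat_def)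
qed

end

section \<open>The free algebra acting by differential operators\<close>

lemma times_monomial: "Poly_Mapping.single xs a * Poly_Mapping.single ys b = Poly_Mapping.single (xs @ ys) (a * b)"
  by (simp add: mult_single plus_list_def)

lemma free_alg_expansion: "D = (\<Sum>w\<in>Poly_Mapping.keys D. Poly_Mapping.single w (Poly_Mapping.lookup D w))"
  by (rule poly_mapping_eqI) (simp add: lookup_sum lookup_single when_def in_keys_iff)

lemma scalar_mult_commute: "scalar c * (D :: 'n::finite free_alg) = D * scalar c"
proof -
  have "scalar c * (Poly_Mapping.single w a :: 'n free_alg) = Poly_Mapping.single w a * scalar c" for w a
    by (simp add: scalar_def times_monomial mult.commute)
  then show ?thesis
    by (subst (1 2) free_alg_expansion[of D]) (simp only: sum_distrib_left sum_distrib_right)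
qed

lemma scalar_one [simp]: "scalar 1 = 1"
  and scalar_zero [simp]: "scalar 0 = 0"
  and scalar_minus: "scalar (- a) = - scalar a"
  by (simp_all add: scalar_def single_uminus) (simp add: zero_list_def flip: single_one)

lemma free_algebra_add: "D \<in> free_algebra \<aa> \<Longrightarrow> E \<in> free_algebra \<aa> \<Longrightarrow> D + E \<in> free_algebra \<aa>"
  unfolding free_algebra_def using keys_add[of D E] by blast
lemma free_algebra_minus: "D \<in> free_algebra \<aa> \<Longrightarrow> - D \<in> free_algebra \<aa>"
  unfolding free_algebra_def by simp
lemma free_algebra_diff: "D \<in> free_algebra \<aa> \<Longrightarrow> E \<in> free_algebra \<aa> \<Longrightarrow> D - E \<in> free_algebra \<aa>"
  using free_algebra_add[of D \<aa> "- E"] free_algebra_minus[of E] by simp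
lemma free_algebra_mult: "D \<in> free_algebra \<aa> \<Longrightarrow> E \<in> free_algebra \<aa> \<Longrightarrow> D * E \<in> free_algebra \<aa>"
  unfolding free_algebra_def using keys_mult[of D E] by (fastforce simp: plus_list_def)
lemma free_algebra_scalar [simp]: "scalar c \<in> free_algebra \<aa>"
  by (auto simp: free_algebra_def scalar_def)
lemma free_algebra_one [simp]: "1 \<in> free_algebra \<aa>"
  using free_algebra_scalar[of 1] by simp
lemma free_algebra_zero [simp]: "0 \<in> free_algebra \<aa>"
  by (simp add: free_algebra_def)
lemma free_algebra_letter: "X \<in> \<aa> \<Longrightarrow> letter X \<in> free_algebra \<aa>"
  by (auto simp: free_algebra_def letter_def)
lemma free_algebra_mono: "\<aa> \<subseteq> \<bb> \<Longrightarrow> free_algebra \<aa> \<subseteq> free_algebra \<bb>"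
  unfolding free_algebra_def using lists_mono by blast

lemma free_algebra_induct [consumes 1, case_names zero scalar letter add]:
  assumes "D \<in> free_algebra \<aa>"
    and "Q 0"
    and "\<And>c. Q (scalar c)"
    and "\<And>X D. X \<in> \<aa> \<Longrightarrow> D \<in> free_algebra \<aa> \<Longrightarrow> Q D \<Longrightarrow> Q (letter X * D)"
    and "\<And>D E. D \<in> free_algebra \<aa> \<Longrightarrow> E \<in> free_algebra \<aa> \<Longrightarrow> Q D \<Longrightarrow> Q E \<Longrightarrow> Q (D + E)"
  shows "Q D"
proof -
  have word: "Q (Poly_Mapping.single w c) \<and> Poly_Mapping.single w c \<in> free_algebra \<aa>" if "w \<in> lists \<aa>" for w c
    using that
  proof (induction w)
    case Nil
    then show ?case using assms(3)[of c] free_algebra_scalar[of c \<aa>] by (simp add: scalar_def)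
  next
    case (Cons X w)
    have "Poly_Mapping.single (X # w) c = letter X * Poly_Mapping.single w c"
      by (simp add: letter_def times_monomial)
    then show ?case
      using Cons assms(4)[of X] by (auto intro: free_algebra_mult free_algebra_letter)
  qed
  have "Q (\<Sum>w\<in>W. Poly_Mapping.single w (Poly_Mapping.lookup D w)) \<and>
      (\<Sum>w\<in>W. Poly_Mapping.single w (Poly_Mapping.lookup D w)) \<in> free_algebra \<aa>"
    if "finite W" "W \<subseteq> lists \<aa>" for W
    using that
  proof (induction W)
    case empty
    then show ?case using assms(2) by simp
  next
    case (insert w W)
    then show ?case
      using word[of w] assms(5) by (auto intro: free_algebra_add)
  qed
  from this[of "Poly_Mapping.keys D"] show ?thesis
    using assms(1) free_alg_expansion[of D] by (simp add: free_algebra_def)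
qed

lemma pretensor_add: "pretensor (D + E) w = pretensor D w + pretensor E w"
  by (simp add: pretensor_def vec_eq_iff distrib_right)
lemma pretensor_mult: "pretensor (D * E) w = D *s pretensor E w"
  by (simp add: pretensor_def vec_eq_iff mult.assoc)
lemma pretensor_zero [simp]: "pretensor 0 w = 0" "pretensor D 0 = 0"
  by (simp_all add: pretensor_def vec_eq_iff)

lemma pretensor_expansion: "f = (\<Sum>i\<in>UNIV. pretensor (f $ i) (axis i 1))"
proof -
  have "(\<Sum>i\<in>UNIV. pretensor (f $ i) (axis i 1)) $ j = f $ j" for j
  proof -
    have "(\<Sum>i\<in>UNIV. pretensor (f $ i) (axis i 1)) $ j = (\<Sum>i\<in>UNIV. if i = j then f $ i else 0)"
      unfolding pretensor_def sum_component by (intro sum.cong refl) (auto simp: axis_def)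
    then show ?thesis by simp
  qed
  then show ?thesis
    by (simp add: vec_eq_iff)
qed

context abelian_complement
begin

definition word_op :: "'n cmat list \<Rightarrow> (('n, 'm) vfield_space \<Rightarrow> complex) \<Rightarrow> ('n, 'm) vfield_space \<Rightarrow> complex" where
  "word_op w = fold (\<lambda>A. lie_deriv (vfield A)) w"

lemma word_op_polys: "f \<in> polys coordinates \<Longrightarrow> word_op w f \<in> polys coordinates"
  unfolding word_op_def
  by (induction w arbitrary: f) (simp_all add: vf.lie_deriv_polys polynomial_vfield)

lemma word_op_add:
  "f \<in> polys coordinates \<Longrightarrow> g \<in> polys coordinates \<Longrightarrow>
    word_op w (\<lambda>p. f p + g p) = (\<lambda>p. word_op w f p + word_op w g p)"
  unfolding word_op_def
  by (induction w arbitrary: f g) (simp_all add: vf.lie_deriv_add vf.lie_deriv_polys polynomial_vfield)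

lemma word_op_cmult:
  "f \<in> polys coordinates \<Longrightarrow> word_op w (\<lambda>p. c * f p) = (\<lambda>p. c * word_op w f p)"
  unfolding word_op_def
  by (induction w arbitrary: f) (simp_all add: vf.lie_deriv_cmult vf.lie_deriv_polys polynomial_vfield)

lemma word_op_zero: "word_op w (\<lambda>p. 0) = (\<lambda>p. 0)"
  using word_op_cmult[OF polys.const[of 0], of w 0] by simp

lemma word_op_sum:
  assumes "\<And>i. i \<in> I \<Longrightarrow> f i \<in> polys coordinates"
  shows "word_op w (\<lambda>p. \<Sum>i\<in>I. f i p) = (\<lambda>p. \<Sum>i\<in>I. word_op w (f i) p)"
  using assms
  by (induction I rule: infinite_finite_induct)
     (simp_all add: word_op_zero word_op_add vf.polys_sum)

definition alg_op :: "'n free_alg \<Rightarrow> (('n, 'm) vfield_space \<Rightarrow> complex) \<Rightarrow> ('n, 'm) vfield_space \<Rightarrow> complex" where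
  "alg_op D f p = (\<Sum>w\<in>Poly_Mapping.keys D. Poly_Mapping.lookup D w * word_op w f p)"

lemma alg_op_superset:
  assumes "finite S" "Poly_Mapping.keys D \<subseteq> S"
  shows "alg_op D f p = (\<Sum>w\<in>S. Poly_Mapping.lookup D w * word_op w f p)"
  unfolding alg_op_def using assms by (intro sum.mono_neutral_left) (auto simp: in_keys_iff)

lemma alg_op_add: "alg_op (D + E) f p = alg_op D f p + alg_op E f p"
proof -
  define S where "S = Poly_Mapping.keys D \<union> Poly_Mapping.keys E"
  have "finite S" "Poly_Mapping.keys (D + E) \<subseteq> S" "Poly_Mapping.keys D \<subseteq> S" "Poly_Mapping.keys E \<subseteq> S"
    using keys_add[of D E] by (auto simp: S_def)
  then show ?thesis
    by (simp add: alg_op_superset[of S] lookup_add distrib_right sum.distrib)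
qed

lemma alg_op_zero [simp]: "alg_op 0 f p = 0"
  by (simp add: alg_op_def)

lemma alg_op_sum: "alg_op (sum D I) f p = (\<Sum>i\<in>I. alg_op (D i) f p)"
  by (induction I rule: infinite_finite_induct) (simp_all add: alg_op_add)

lemma alg_op_minus: "alg_op (- D) f p = - alg_op D f p"
  using alg_op_add[of D "- D" f p] by (simp add: eq_neg_iff_add_eq_0 add.commute)

lemma alg_op_diff: "alg_op (D - E) f p = alg_op D f p - alg_op E f p"
  using alg_op_add[of D "- E" f p] by (simp add: alg_op_minus)

lemma alg_op_single: "alg_op (Poly_Mapping.single w c) f p = c * word_op w f p"
  by (simp add: alg_op_def)

lemma alg_op_scalar: "alg_op (scalar c) f p = c * f p"
  by (simp add: scalar_def alg_op_single word_op_def)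

lemma alg_op_letter: "alg_op (letter X) f = lie_deriv (vfield X) f"
  by (rule ext) (simp add: letter_def alg_op_single word_op_def)

lemma alg_op_polys: "f \<in> polys coordinates \<Longrightarrow> alg_op D f \<in> polys coordinates"
  unfolding alg_op_def[abs_def] by (intro vf.polys_sum polys.mult polys.const word_op_polys)

text \<open>Words act in reverse order, so that the antirepresentation by vector fields becomes compatible with
  the bracket relations of the enveloping algebra.\<close>

lemma alg_op_mult:
  assumes f: "f \<in> polys coordinates"
  shows "alg_op (D * E) f = alg_op E (alg_op D f)"
proof
  fix p
  have "D * E = (\<Sum>v\<in>Poly_Mapping.keys D. \<Sum>w\<in>Poly_Mapping.keys E.
      Poly_Mapping.single (v @ w) (Poly_Mapping.lookup D v * Poly_Mapping.lookup E w))"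
    by (subst (1) free_alg_expansion[of D], subst (1) free_alg_expansion[of E])
       (simp add: sum_product times_monomial)
  then have "alg_op (D * E) f p = (\<Sum>v\<in>Poly_Mapping.keys D. \<Sum>w\<in>Poly_Mapping.keys E.
      Poly_Mapping.lookup D v * Poly_Mapping.lookup E w * word_op w (word_op v f) p)"
    by (simp add: alg_op_sum alg_op_single word_op_def)
  also have "\<dots> = (\<Sum>w\<in>Poly_Mapping.keys E. Poly_Mapping.lookup E w * 
      (\<Sum>v\<in>Poly_Mapping.keys D. Poly_Mapping.lookup D v * word_op w (word_op v f) p))"
    by (subst sum.swap) (simp add: sum_distrib_left mult_ac)
  also have "\<dots> = alg_op E (alg_op D f) p"
    unfolding alg_op_def alg_op_def[abs_def]
    by (simp add: word_op_sum word_op_cmult word_op_polys polys.mult polys.const f)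
  finally show "alg_op (D * E) f p = alg_op E (alg_op D f) p" .
qed

lemma alg_op_ideal:
  "D \<in> enveloping_ideal \<gg> \<Longrightarrow> f \<in> polys coordinates \<Longrightarrow> alg_op D f = (\<lambda>p. 0)"
proof (induction arbitrary: f rule: enveloping_ideal.induct)
  case (linear X Y a b)
  then show ?case
    by (auto simp: alg_op_diff alg_op_mult alg_op_scalar alg_op_letter vfield_linear 
      scalar_mult_commute alg_op_polys vf.lie_deriv_polys polynomial_vfield)
next
  case (bracket X Y)
  show ?case
    using vfield_commutator[OF bracket(2,1,3)]
    by (auto simp: alg_op_diff alg_op_mult[OF bracket(3)] alg_op_letter)
next
  case (add D E)
  then show ?case by (auto simp: alg_op_add)
next
  case (mult D A B)
  have "alg_op B (\<lambda>p. 0) p = 0" for p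
    by (simp add: alg_op_def word_op_zero)
  then show ?case
    using mult by (auto simp: alg_op_mult alg_op_polys)
qed auto

text \<open>The functions that correspond to sections with values in the dual of \<open>W\<close>. The fields preserve
  them because their fibre components are linear in \<open>w\<close> and their base components do not
  depend on \<open>w\<close>.\<close>

definition fibre_linear :: "(('n, 'm) vfield_space \<Rightarrow> complex) \<Rightarrow> bool" where
  "fibre_linear f \<longleftrightarrow> (\<forall>x c v w. f (x, c *s v + w) = c * f (x, v) + f (x, w))"

lemma fibre_linear_zero: "fibre_linear f \<Longrightarrow> f (x, 0) = 0"
  unfolding fibre_linear_def by (drule spec[of _ x], drule spec[of _ 1], drule spec[of _ 0], drule spec[of _ 0]) simp

lemma fibre_linear_lie_deriv:
  assumes f: "f \<in> polys coordinates" and lin: "fibre_linear f"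
  shows "fibre_linear (lie_deriv (vfield A) f)"
  unfolding fibre_linear_def
proof (intro allI)
  fix x c v w
  define u M where "u = pr (twist (pr x) A)" and "M = \<rho> (twist (pr x) A - pr (twist (pr x) A))"
  have V: "vfield A (x, z) = (u, M *v z)" for z
    by (simp add: vfield_def Let_def u_def M_def)
  have L: "(x, z) + t *\<^sub>R vfield A (x, z) = (x + t *\<^sub>R u, z + of_real t *s (M *v z))" for z and t :: real
    by (simp add: V vec_eq_iff) (simp add: scaleR_conv_of_real)
  have eq: "f ((x, c *s v + w) + t *\<^sub>R vfield A (x, c *s v + w)) =
      c * f ((x, v) + t *\<^sub>R vfield A (x, v)) + f ((x, w) + t *\<^sub>R vfield A (x, w))" for t :: real
  proof -
    have "c *s v + w + of_real t *s (M *v (c *s v + w)) = 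
        c *s (v + of_real t *s (M *v v)) + (w + of_real t *s (M *v w))"
      by (simp add: vec_eq_iff matrix_vector_right_distrib vector_scalar_commute algebra_simps)
    then show ?thesis
      using lin unfolding L fibre_linear_def by metis
  qed
  have "((\<lambda>t::real. f ((x, c *s v + w) + t *\<^sub>R vfield A (x, c *s v + w))) has_vector_derivative
      c * lie_deriv (vfield A) f (x, v) + lie_deriv (vfield A) f (x, w)) (at 0)"
    unfolding eq by (intro derivative_intros polys_line_derivative[OF f])
  then show "lie_deriv (vfield A) f (x, c *s v + w) =
      c * lie_deriv (vfield A) f (x, v) + lie_deriv (vfield A) f (x, w)"
    using vector_derivative_unique_at[OF polys_line_derivative[OF f]] by blast
qed

lemma fibre_linear_alg_op:
  assumes f: "f \<in> polys coordinates" and lin: "fibre_linear f"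
  shows "fibre_linear (alg_op D f)"
proof -
  have "fibre_linear (word_op w f)" for w
    using assms unfolding word_op_def
    by (induction w arbitrary: f) (simp_all add: vf.lie_deriv_polys polynomial_vfield fibre_linear_lie_deriv)
  then show ?thesis
    unfolding fibre_linear_def alg_op_def
    by (simp add: algebra_simps sum.distrib sum_distrib_left)
qed

text \<open>A function \<open>f\<close> pairs with \<open>D \<otimes> w\<close> by applying \<open>D\<close> to it and evaluating at the base point \<open>(0, w)\<close>.\<close>

definition pairing :: "(('n, 'm) vfield_space \<Rightarrow> complex) \<Rightarrow> ('n, 'm) pretensor \<Rightarrow> complex" where
  "pairing f h = (\<Sum>i\<in>UNIV. alg_op (h $ i) f (0, axis i 1))"

lemma fibre_linear_expansion:
  assumes "fibre_linear f"
  shows "f (x, w) = (\<Sum>i\<in>UNIV. w $ i * f (x, axis i 1))"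
proof -
  have "f (x, \<Sum>i\<in>I. (w $ i) *s axis i 1) = (\<Sum>i\<in>I. w $ i * f (x, axis i 1))" for I :: "'m set"
    using assms by (induction I rule: infinite_finite_induct) (simp_all add: fibre_linear_zero fibre_linear_def)
  from this[of UNIV] show ?thesis
    by (simp only: basis_expansion)
qed

lemma pairing_pretensor:
  assumes "f \<in> polys coordinates" "fibre_linear f"
  shows "pairing f (pretensor D w) = alg_op D f (0, w)"
  unfolding fibre_linear_expansion[OF fibre_linear_alg_op[OF assms], of D 0 w]
  by (simp add: pairing_def pretensor_def alg_op_mult[OF assms(1)] alg_op_scalar)

text \<open>The pairing descends to the induced module: the field of \<open>Z \<in> \<qq>\<close> is tangent to the fibre over \<open>0\<close>,
  where it acts by \<open>\<rho> Z\<close>.\<close>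

lemma pairing_relations:
  assumes h: "h \<in> tensor_relations \<gg> \<qq> \<rho>'"
    and \<qq>: "\<And>Z. Z \<in> \<qq> \<Longrightarrow> Z \<in> \<gg> \<and> pr Z = 0 \<and> \<rho>' Z = \<rho> Z"
    and f: "f \<in> polys coordinates" "fibre_linear f"
  shows "pairing f h = 0"
  using h
proof (induction rule: tensor_relations.induct)
  case (ideal D w)
  then show ?case
    by (simp add: pairing_pretensor[OF f] alg_op_ideal[OF _ f(1)])
next
  case (balanced D Z w)
  define g where "g = alg_op D f"
  have g: "g \<in> polys coordinates" "fibre_linear g"
    unfolding g_def using f by (simp_all add: alg_op_polys fibre_linear_alg_op)
  have Z: "Z \<in> \<gg>" "pr Z = 0" "\<rho>' Z = \<rho> Z"
    using \<qq> balanced by auto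
  have "vfield Z (0, w) = (0, \<rho> Z *v w)"
    by (simp add: vfield_def twist_def complex_linear_simps[OF pr_linear] Z)
  then have L: "(0, w) + t *\<^sub>R vfield Z (0, w) = (0, w + of_real t *s (\<rho> Z *v w))" for t :: real
    by (simp add: vec_eq_iff) (simp add: scaleR_conv_of_real)
  have "((\<lambda>t. g (0, w + of_real t *s (\<rho> Z *v w))) has_vector_derivative lie_deriv (vfield Z) g (0, w)) (at 0)"
    using polys_line_derivative[OF g(1), of "(0, w)" "vfield Z"] L by simp
  moreover have "g (0, w + of_real t *s (\<rho> Z *v w)) = g (0, w) + of_real t * g (0, \<rho> Z *v w)" for t :: real
    using g(2) unfolding fibre_linear_def by (metis add.commute)
  ultimately have "((\<lambda>t. g (0, w) + of_real t * g (0, \<rho> Z *v w)) has_vector_derivative lie_deriv (vfield Z) g (0, w)) (at 0)"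
    by simp
  moreover have "((\<lambda>t. g (0, w) + of_real t * g (0, \<rho> Z *v w)) has_vector_derivative g (0, \<rho> Z *v w)) (at 0)"
    by (auto intro!: derivative_eq_intros simp: has_vector_derivative_def scaleR_conv_of_real)
  ultimately have "lie_deriv (vfield Z) g (0, w) = g (0, \<rho> Z *v w)"
    using vector_derivative_unique_at by blast
  moreover have "pairing f (u - v) = pairing f u - pairing f v" for u v
    by (simp add: pairing_def alg_op_diff sum_subtractf)
  ultimately show ?case
    by (simp add: pairing_pretensor[OF f] alg_op_mult[OF f(1)] alg_op_letter g_def Z)
next
  case (scale h c)
  have "alg_op (scalar c * D) f p = c * alg_op D f p" for D p
    unfolding scalar_mult_commute by (simp add: alg_op_mult[OF f(1)] alg_op_scalar)
  then have "pairing f (scalar c *s h) = c * pairing f h"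
    by (simp add: pairing_def sum_distrib_left)
  then show ?case
    using scale by simp
qed (simp_all add: pairing_def alg_op_add sum.distrib)

text \<open>The independence half of the Poincare-Birkhoff-Witt theorem in degree one: the functions \<open>x\<^sub>i\<^sub>j w\<^sub>k\<close> separate the
  elements \<open>Z \<otimes> w\<close> with \<open>Z \<in> \<nn>\<close>.\<close>

theorem no_relations_in_first_layer:
  assumes \<qq>: "\<And>Z. Z \<in> \<qq> \<Longrightarrow> Z \<in> \<gg> \<and> pr Z = 0 \<and> \<rho>' Z = \<rho> Z"
    and Z: "Z \<in> \<nn>" "\<And>w. pretensor (letter Z) w \<in> tensor_relations \<gg> \<qq> \<rho>'"
  shows "Z = 0"
proof -
  fix k0 :: 'm
  have "Z $ i $ j = 0" for i j
  proof -
    define f :: "('n, 'm) vfield_space \<Rightarrow> complex" where "f = (\<lambda>p. fst p $ i $ j * snd p $ k0)"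
    have f: "f \<in> polys coordinates" "fibre_linear f"
      unfolding f_def fibre_linear_def
      by (rule polys.mult; rule polys.coord; auto simp: coordinates_def) (simp add: algebra_simps)
    have V: "vfield Z (0, axis k0 1) = (Z, 0)"
      using Z by (simp add: vfield_def twist_def complex_linear_simps[OF pr_linear] complex_linear_simps[OF \<rho>_linear] pr_id)
    have "0 = pairing f (pretensor (letter Z) (axis k0 1))"
      using pairing_relations[OF Z(2) \<qq> f] by simp
    also have "\<dots> = lie_deriv (vfield Z) f (0, axis k0 1)"
      by (simp add: pairing_pretensor[OF f] alg_op_letter)
    also have "\<dots> = Z $ i $ j"
      by (rule lie_deriv_along_line[OF f(1), where a = 0 and c = 0 and d = 0], unfold V)
         (simp add: f_def axis_def, simp add: scaleR_conv_of_real)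
    finally show ?thesis by simp
  qed
  then show ?thesis
    by (simp add: vec_eq_iff)
qed

end

section \<open>The induced module\<close>

text \<open>The relations of the module are stated for iterated actions \<open>D *s (E *s f)\<close>, which are therefore kept in
  this form.\<close>

declare vector_smult_assoc [simp del]

lemma smult_diff: "D *s (f - g) = D *s f - D *s (g :: ('n::finite, 'm::finite) pretensor)"
  by (simp add: vec_eq_iff right_diff_distrib)
lemma smult_add: "D *s (f + g) = D *s f + D *s (g :: ('n::finite, 'm::finite) pretensor)"
  by (simp add: vec_eq_iff distrib_left)
lemma smult_diff_left: "(D - E) *s f = D *s f - E *s (f :: ('n::finite, 'm::finite) pretensor)"
  by (simp add: vec_eq_iff left_diff_distrib)
lemma smult_add_left: "(D + E) *s f = D *s f + E *s (f :: ('n::finite, 'm::finite) pretensor)"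
  by (simp add: vec_eq_iff distrib_right)
lemma smult_mult: "(D * E) *s f = D *s (E *s (f :: ('n::finite, 'm::finite) pretensor))"
  by (simp add: vec_eq_iff mult.assoc)
lemma smult_one [simp]: "1 *s f = (f :: ('n::finite, 'm::finite) pretensor)"
  by (simp add: vec_eq_iff)
lemma smult_zero [simp]: "0 *s f = (0 :: ('n::finite, 'm::finite) pretensor)" "D *s 0 = (0 :: ('n::finite, 'm::finite) pretensor)"
  by (simp_all add: vec_eq_iff)
lemma smult_minus_left: "(- D) *s f = - (D *s (f :: ('n::finite, 'm::finite) pretensor))"
  by (simp add: vec_eq_iff)
lemma smult_scalar_commute: "D *s (scalar c *s f) = scalar c *s (D *s (f :: ('n::finite, 'm::finite) pretensor))"
  by (metis smult_mult scalar_mult_commute)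

lemma pretensor_one: "pretensor D w = D *s pretensor 1 w"
  using pretensor_mult[of D 1 w] by simp

lemma pretensor_space_add: "f \<in> pretensor_space \<gg> \<Longrightarrow> g \<in> pretensor_space \<gg> \<Longrightarrow> f + g \<in> pretensor_space \<gg>"
  by (simp add: pretensor_space_def free_algebra_add)
lemma pretensor_space_diff: "f \<in> pretensor_space \<gg> \<Longrightarrow> g \<in> pretensor_space \<gg> \<Longrightarrow> f - g \<in> pretensor_space \<gg>"
  by (simp add: pretensor_space_def free_algebra_diff)
lemma pretensor_space_zero [simp]: "0 \<in> pretensor_space \<gg>"
  by (simp add: pretensor_space_def)
lemma pretensor_space_smult: "D \<in> free_algebra \<gg> \<Longrightarrow> f \<in> pretensor_space \<gg> \<Longrightarrow> D *s f \<in> pretensor_space \<gg>"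
  by (simp add: pretensor_space_def free_algebra_mult)
lemma pretensor_space_pretensor: "D \<in> free_algebra \<gg> \<Longrightarrow> pretensor D w \<in> pretensor_space \<gg>"
  by (simp add: pretensor_space_def pretensor_def free_algebra_mult)

text \<open>Computations in the induced module are carried out on representatives, modulo the subspace \<open>R\<close> of
  relations.\<close>

locale induced_module =
  fixes \<gg> \<qq> :: "'n::finite cmat set" and \<rho> :: "'n cmat \<Rightarrow> 'm::finite cmat"
  assumes g_zero: "0 \<in> \<gg>"
    and g_add: "X \<in> \<gg> \<Longrightarrow> Y \<in> \<gg> \<Longrightarrow> X + Y \<in> \<gg>"
    and g_scale: "X \<in> \<gg> \<Longrightarrow> scale_mat c X \<in> \<gg>"
    and g_brk: "X \<in> \<gg> \<Longrightarrow> Y \<in> \<gg> \<Longrightarrow> brk X Y \<in> \<gg>"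
    and q_sub: "\<qq> \<subseteq> \<gg>"
begin

abbreviation "R \<equiv> tensor_relations \<gg> \<qq> \<rho>"
abbreviation "P \<equiv> (pretensor_space \<gg> :: ('n, 'm) pretensor set)"

lemma enveloping_ideal_subset: "D \<in> enveloping_ideal \<gg> \<Longrightarrow> D \<in> free_algebra \<gg>"
  by (induction rule: enveloping_ideal.induct)
     (auto intro!: free_algebra_diff free_algebra_add free_algebra_mult free_algebra_letter g_add g_scale g_brk)

lemma R_subset: "f \<in> R \<Longrightarrow> f \<in> P"
  by (induction rule: tensor_relations.induct)
     (auto intro!: pretensor_space_add pretensor_space_smult pretensor_space_diff pretensor_space_pretensor
       free_algebra_mult free_algebra_letter subsetD[OF q_sub] dest: enveloping_ideal_subset)

lemma R_minus: "f \<in> R \<Longrightarrow> - f \<in> R"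
  using tensor_relations.scale[of f \<gg> \<qq> \<rho> "-1"] by (simp add: scalar_minus smult_minus_left)

lemma R_diff: "f \<in> R \<Longrightarrow> g \<in> R \<Longrightarrow> f - g \<in> R"
  using tensor_relations.add[of f \<gg> \<qq> \<rho> "- g"] R_minus[of g] by simp

lemma R_cong: "f - g \<in> R \<Longrightarrow> f \<in> R \<longleftrightarrow> g \<in> R"
  using R_diff[of f "f - g"] tensor_relations.add[of "f - g" \<gg> \<qq> \<rho> g] by auto

lemma R_sum: "(\<And>i. i \<in> I \<Longrightarrow> f i \<in> R) \<Longrightarrow> sum f I \<in> R"
  by (induction I rule: infinite_finite_induct) (simp_all add: tensor_relations.zero tensor_relations.add)

lemma R_smult:
  assumes D: "D \<in> free_algebra \<gg>"
  shows "f \<in> R \<Longrightarrow> D *s f \<in> R"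
proof (induction rule: tensor_relations.induct)
  case (ideal E w)
  have "D * E \<in> enveloping_ideal \<gg>"
    using enveloping_ideal.mult[OF ideal D free_algebra_one] by simp
  then show ?case
    unfolding pretensor_mult[symmetric] by (rule tensor_relations.ideal)
next
  case (balanced E Z w)
  have "pretensor ((D * E) * letter Z) w - pretensor (D * E) (\<rho> Z *v w) \<in> R"
    by (rule tensor_relations.balanced[OF free_algebra_mult[OF D balanced(1)] balanced(2)])
  then show ?case
    by (simp only: smult_diff pretensor_mult mult.assoc)
next
  case zero
  then show ?case by (simp add: tensor_relations.zero)
next
  case (add f f')
  then show ?case unfolding smult_add by (intro tensor_relations.add)
next
  case (scale f c)
  then show ?case unfolding smult_scalar_commute[of D] by (intro tensor_relations.scale)
qed

lemma ideal_smult: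
  assumes D: "D \<in> enveloping_ideal \<gg>" and f: "f \<in> P"
  shows "D *s f \<in> R"
proof -
  have ideal: "D * (f $ i) \<in> enveloping_ideal \<gg>" for i
  proof -
    have "f $ i \<in> free_algebra \<gg>"
      using f unfolding pretensor_space_def by blast
    from enveloping_ideal.mult[OF D free_algebra_one this] show ?thesis
      unfolding mult_1_left .
  qed
  have "(\<Sum>i\<in>UNIV. pretensor (D * (f $ i)) (axis i 1)) \<in> R"
    by (rule R_sum) (rule tensor_relations.ideal[OF ideal])
  also have "(\<Sum>i\<in>UNIV. pretensor (D * (f $ i)) (axis i 1)) = (\<Sum>i\<in>UNIV. pretensor ((D *s f) $ i) (axis i 1))"
    unfolding vector_smult_component ..
  also have "\<dots> = D *s f"
    by (rule pretensor_expansion[symmetric])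
  finally show ?thesis .
qed

lemma letter_linear:
  assumes "X \<in> \<gg>" "Y \<in> \<gg>" "f \<in> P"
  shows "letter (scale_mat a X + scale_mat b Y) *s f -
    (scalar a *s (letter X *s f) + scalar b *s (letter Y *s f)) \<in> R"
  using ideal_smult[OF enveloping_ideal.linear[OF assms(1,2), of a b] assms(3)]
  unfolding diff_diff_eq smult_diff_left smult_add_left smult_mult .

lemma letter_add:
  assumes "X \<in> \<gg>" "Y \<in> \<gg>" "f \<in> P"
  shows "letter (X + Y) *s f - (letter X *s f + letter Y *s f) \<in> R"
  using letter_linear[OF assms, of 1 1] unfolding scalar_one smult_one scale_mat_one .

lemma letter_minus:
  assumes "X \<in> \<gg>" "f \<in> P"
  shows "letter (- X) *s f + letter X *s f \<in> R"
  using letter_linear[OF assms(1,1,2), of "-1" 0] 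
  unfolding scale_mat_neg_one scale_mat_zero scalar_minus smult_minus_left scalar_one scalar_zero smult_one
    smult_zero add_0_right diff_minus_eq_add .
 
lemma letter_zero:
  assumes "f \<in> P"
  shows "letter 0 *s f \<in> R"
  using letter_linear[OF g_zero g_zero assms, of 0 0]
  unfolding scale_mat_zero scalar_zero smult_zero add_0_right diff_0_right .

lemma letter_swap:
  assumes "X \<in> \<gg>" "Y \<in> \<gg>" "f \<in> P"
  shows "letter X *s (letter Y *s f) - (letter Y *s (letter X *s f) + letter (brk X Y) *s f) \<in> R"
  using ideal_smult[OF enveloping_ideal.bracket[OF assms(1,2)] assms(3)]
  unfolding diff_diff_eq smult_diff_left smult_add_left smult_mult .

lemma letter_P: "X \<in> \<gg> \<Longrightarrow> f \<in> P \<Longrightarrow> letter X *s f \<in> P"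
  by (intro pretensor_space_smult free_algebra_letter)

lemma letter_R: "X \<in> \<gg> \<Longrightarrow> f \<in> R \<Longrightarrow> letter X *s f \<in> R"
  by (intro R_smult free_algebra_letter)

lemma letter_balanced:
  assumes "Z \<in> \<qq>"
  shows "letter Z *s pretensor 1 w - pretensor 1 (\<rho> Z *v w) \<in> R"
  using tensor_relations.balanced[OF free_algebra_one assms, where w = w and \<rho> = \<rho>] by (simp flip: pretensor_one)

subsection \<open>Classes\<close>

definition cls :: "('n, 'm) pretensor \<Rightarrow> ('n, 'm) pretensor set" where
  "cls f = tensor_eq \<gg> \<qq> \<rho> `` {f}"

lemma cls_mem: "f \<in> P \<Longrightarrow> f' \<in> cls f \<longleftrightarrow> f' \<in> P \<and> f - f' \<in> R"
  by (simp add: cls_def tensor_eq_def)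

lemma cls_eq_iff: 
  assumes "f \<in> P" "f' \<in> P" 
  shows "cls f = cls f' \<longleftrightarrow> f - f' \<in> R"
proof
  assume "cls f = cls f'"
  then show "f - f' \<in> R"
    using cls_mem[OF assms(1), of f'] cls_mem[OF assms(2), of f'] assms by (simp add: tensor_relations.zero)
next
  assume *: "f - f' \<in> R"
  have "f - h \<in> R \<longleftrightarrow> f' - h \<in> R" for h
    by (rule R_cong) (use * in simp)
  then show "cls f = cls f'"
    using assms by (auto simp: cls_mem)
qed

lemma cls_zero_iff: "f \<in> P \<Longrightarrow> cls f = ind_zero \<gg> \<qq> \<rho> \<longleftrightarrow> f \<in> R"
  using cls_eq_iff[of f 0] by (simp add: ind_zero_def cls_def)

lemma ind_module_eq: "ind_module \<gg> \<qq> \<rho> = cls ` P"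
  by (auto simp: ind_module_def quotient_def cls_def)

lemma ind_zero_eq: "ind_zero \<gg> \<qq> \<rho> = cls 0"
  by (simp add: ind_zero_def cls_def)

lemma tensor_class_eq: "tensor_class \<gg> \<qq> \<rho> D w = cls (pretensor D w)"
  by (simp add: tensor_class_def cls_def)

lemma ind_add_cls:
  assumes "f \<in> P" "f' \<in> P"
  shows "ind_add \<gg> \<qq> \<rho> (cls f) (cls f') = cls (f + f')"
proof -
  have "cls (h + h') = cls (f + f')" if "h \<in> cls f" "h' \<in> cls f'" for h h'
  proof -
    have "f - h \<in> R" "f' - h' \<in> R" "h \<in> P" "h' \<in> P"
      using that assms by (simp_all add: cls_mem)
    then have "(f - h) + (f' - h') \<in> R"
      by (intro tensor_relations.add)
    then have "(f + f') - (h + h') \<in> R"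
      by (simp add: add_diff_add)
    then show ?thesis
      using assms \<open>h \<in> P\<close> \<open>h' \<in> P\<close> by (metis cls_eq_iff pretensor_space_add)
  qed
  moreover have "f \<in> cls f" "f' \<in> cls f'"
    using assms by (simp_all add: cls_mem tensor_relations.zero)
  ultimately show ?thesis
    unfolding ind_add_def cls_def[symmetric] by blast
qed

lemma ind_act_cls:
  assumes "f \<in> P" "D \<in> free_algebra \<gg>"
  shows "ind_act \<gg> \<qq> \<rho> D (cls f) = cls (D *s f)"
proof -
  have "cls (D *s h) = cls (D *s f)" if "h \<in> cls f" for h
  proof -
    have "f - h \<in> R" "h \<in> P"
      using that assms by (simp_all add: cls_mem)
    then have "D *s f - D *s h \<in> R"
      using R_smult[OF assms(2)] by (metis smult_diff)
    then show ?thesis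
      using assms \<open>h \<in> P\<close> by (metis cls_eq_iff pretensor_space_smult)
  qed
  moreover have "f \<in> cls f"
    using assms by (simp add: cls_mem tensor_relations.zero)
  ultimately show ?thesis
    unfolding ind_act_def cls_def[symmetric] by blast
qed

lemma ind_subspace_image:
  assumes "S \<subseteq> P" "0 \<in> S" "\<And>f f'. f \<in> S \<Longrightarrow> f' \<in> S \<Longrightarrow> f + f' \<in> S"
    and "\<And>c f. f \<in> S \<Longrightarrow> scalar c *s f \<in> S"
  shows "ind_subspace \<gg> \<qq> \<rho> (cls ` S)"
  unfolding ind_subspace_def ind_module_eq ind_zero_eq
  using assms by (auto simp: ind_add_cls ind_act_cls subset_iff)

lemma ind_subspace_module: "ind_subspace \<gg> \<qq> \<rho> (ind_module \<gg> \<qq> \<rho>)"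
  unfolding ind_module_eq
  by (rule ind_subspace_image) (auto intro: pretensor_space_add pretensor_space_smult)

lemma ind_subspace_span:
  assumes "S \<subseteq> ind_module \<gg> \<qq> \<rho>"
  shows "ind_subspace \<gg> \<qq> \<rho> (ind_span \<gg> \<qq> \<rho> S)"
proof -
  define F where "F = {T. ind_subspace \<gg> \<qq> \<rho> T \<and> S \<subseteq> T}"
  have span: "ind_span \<gg> \<qq> \<rho> S = \<Inter>F"
    by (simp add: ind_span_def hull_def F_def)
  have M: "ind_module \<gg> \<qq> \<rho> \<in> F"
    using assms ind_subspace_module by (simp add: F_def)
  have F: "ind_zero \<gg> \<qq> \<rho> \<in> T" "\<And>u v. u \<in> T \<Longrightarrow> v \<in> T \<Longrightarrow> ind_add \<gg> \<qq> \<rho> u v \<in> T"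
    "\<And>c v. v \<in> T \<Longrightarrow> ind_act \<gg> \<qq> \<rho> (scalar c) v \<in> T" if "T \<in> F" for T
    using that unfolding F_def ind_subspace_def by blast+
  show ?thesis
    unfolding span ind_subspace_def using M F by blast
qed

lemma ind_span_subset: "S \<subseteq> T \<Longrightarrow> ind_subspace \<gg> \<qq> \<rho> T \<Longrightarrow> ind_span \<gg> \<qq> \<rho> S \<subseteq> T"
  unfolding ind_span_def by (rule hull_minimal)

lemma ind_span_superset: "S \<subseteq> ind_span \<gg> \<qq> \<rho> S"
  unfolding ind_span_def by (rule hull_subset)


lemma P_one: "pretensor 1 w \<in> P"
  by (rule pretensor_space_pretensor) simp

text \<open>Representatives of the elements of \<open>\<U>(\<aa>)W\<close>. Closure under \<open>R\<close> makes membership a property of the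
  class.\<close>

inductive_set generated :: "'n cmat set \<Rightarrow> ('n, 'm) pretensor set" for \<aa> :: "'n cmat set" where
  unit: "pretensor 1 w \<in> generated \<aa>"
| act: "X \<in> \<aa> \<Longrightarrow> f \<in> generated \<aa> \<Longrightarrow> letter X *s f \<in> generated \<aa>"
| add: "f \<in> generated \<aa> \<Longrightarrow> f' \<in> generated \<aa> \<Longrightarrow> f + f' \<in> generated \<aa>"
| scale: "f \<in> generated \<aa> \<Longrightarrow> scalar c *s f \<in> generated \<aa>"
| relation: "f \<in> R \<Longrightarrow> f \<in> generated \<aa>"

lemma generated_subset:
  assumes \<aa>: "\<aa> \<subseteq> \<gg>" and f: "f \<in> generated \<aa>"
  shows "f \<in> P"
  using f
proof (induction rule: generated.induct)
  case (act X f)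
  then show ?case using \<aa> letter_P by blast
qed (simp_all add: P_one pretensor_space_add pretensor_space_smult R_subset)

lemma generated_cong:
  assumes d: "f - f' \<in> R"
  shows "f \<in> generated \<aa> \<longleftrightarrow> f' \<in> generated \<aa>"
proof
  {
    assume "f \<in> generated \<aa>"
    from generated.add[OF this generated.relation[OF R_minus[OF d]]]
    show "f' \<in> generated \<aa>" by simp
  next
    assume "f' \<in> generated \<aa>"
    from generated.add[OF this generated.relation[OF d]]
    show "f \<in> generated \<aa>" by simp
  }
qed

lemma generated_pretensor:
  assumes "D \<in> free_algebra \<aa>"
  shows "pretensor D w \<in> generated \<aa>"
  using assms
proof (induction rule: free_algebra_induct)
  case zero
  then show ?case using generated.relation[OF tensor_relations.zero] by simp
next
  case (scalar c)
  then show ?case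
    unfolding pretensor_one[of "scalar c"] by (intro generated.intros)
next
  case (letter X D)
  then show ?case unfolding pretensor_mult by (intro generated.act)
next
  case (add D E)
  then show ?case unfolding pretensor_add by (intro generated.add)
qed

lemma generated_full: "f \<in> P \<Longrightarrow> f \<in> generated \<gg>"
proof -
  assume f: "f \<in> P"
  have 1: "pretensor (f $ i) (axis i 1) \<in> generated \<gg>" for i
    by (rule generated_pretensor) (use f in \<open>simp add: pretensor_space_def\<close>)
  have 0: "0 \<in> generated \<gg>"
    by (rule generated.relation[OF tensor_relations.zero])
  have "(\<Sum>i\<in>I. pretensor (f $ i) (axis i 1)) \<in> generated \<gg>" for I
    by (induction I rule: infinite_finite_induct) (simp_all add: 0 generated.add[OF 1])
  then show ?thesis
    by (subst pretensor_expansion)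
qed

lemma enveloping_orbit_eq:
  assumes "\<aa> \<subseteq> \<gg>"
  shows "enveloping_orbit \<gg> \<qq> \<rho> \<aa> = cls ` generated \<aa>"
proof
  define S where "S = {ind_act \<gg> \<qq> \<rho> D (tensor_class \<gg> \<qq> \<rho> 1 w) | D w. D \<in> free_algebra \<aa>}"
  have S: "S = {cls (pretensor D w) | D w. D \<in> free_algebra \<aa>}"
  proof -
    have "ind_act \<gg> \<qq> \<rho> D (tensor_class \<gg> \<qq> \<rho> 1 w) = cls (pretensor D w)" if "D \<in> free_algebra \<aa>" for D w
      unfolding tensor_class_eq pretensor_one[of D]
      by (rule ind_act_cls[OF P_one]) (use that free_algebra_mono[OF assms] in blast)
    then show ?thesis
      unfolding S_def by (intro Collect_cong) metis
  qed
  have sub: "ind_subspace \<gg> \<qq> \<rho> (cls ` generated \<aa>)"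
    by (rule ind_subspace_image)
       (auto intro: generated.intros generated_subset[OF assms] generated.relation[OF tensor_relations.zero])
  show "enveloping_orbit \<gg> \<qq> \<rho> \<aa> \<subseteq> cls ` generated \<aa>"
    unfolding enveloping_orbit_def S_def[symmetric]
    by (rule ind_span_subset[OF _ sub]) (auto simp: S generated_pretensor)
  have SM: "S \<subseteq> ind_module \<gg> \<qq> \<rho>"
    unfolding S ind_module_eq using free_algebra_mono[OF assms] by (auto intro!: pretensor_space_pretensor)
  define U where "U = ind_span \<gg> \<qq> \<rho> S"
  have U: "ind_subspace \<gg> \<qq> \<rho> U"
    unfolding U_def by (rule ind_subspace_span[OF SM])
  have UM: "U \<subseteq> cls ` P"
    using U unfolding ind_subspace_def ind_module_eq by blast
  have add: "cls (f + f') \<in> U" if "cls f \<in> U" "cls f' \<in> U" "f \<in> P" "f' \<in> P" for f f'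
    using U that ind_add_cls[of f f'] unfolding ind_subspace_def by metis
  have scale: "cls (scalar c *s f) \<in> U" if "cls f \<in> U" "f \<in> P" for c f
    using U that ind_act_cls[of f "scalar c"] unfolding ind_subspace_def by (metis free_algebra_scalar)
  have zero: "cls 0 \<in> U"
    using U unfolding ind_subspace_def ind_zero_eq by blast
  have act: "cls (letter X *s f) \<in> U" if X: "X \<in> \<aa>" and f: "cls f \<in> U" "f \<in> P" for X f
  proof -
    have Xg: "X \<in> \<gg>" using X assms by blast
    define T where "T = cls ` {f \<in> P. cls (letter X *s f) \<in> U}"
    have "ind_subspace \<gg> \<qq> \<rho> T"
      unfolding T_def
      by (rule ind_subspace_image)
         (auto simp: zero smult_add smult_scalar_commute intro!: add scale pretensor_space_add pretensor_space_smult letter_P Xg)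
    moreover have "S \<subseteq> T"
    proof
      fix v assume "v \<in> S"
      then obtain D w where D: "v = cls (pretensor D w)" "D \<in> free_algebra \<aa>"
        unfolding S by blast
      have "cls (pretensor (letter X * D) w) \<in> S"
        unfolding S using D X by (auto intro!: free_algebra_mult free_algebra_letter)
      then have "cls (letter X *s pretensor D w) \<in> U"
        unfolding pretensor_mult U_def using ind_span_superset[of S] by blast
      moreover have "pretensor D w \<in> P"
        using D free_algebra_mono[OF assms] by (auto intro!: pretensor_space_pretensor)
      ultimately show "v \<in> T"
        unfolding T_def D(1) by blast
    qed
    ultimately have "U \<subseteq> T"
      unfolding U_def by (intro ind_span_subset)
    then obtain f' where f': "cls f = cls f'" "f' \<in> P" "cls (letter X *s f') \<in> U"
      using f unfolding T_def by blast
    then have "letter X *s f - letter X *s f' \<in> R"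
      using letter_R[OF Xg] cls_eq_iff[OF f(2) f'(2)] by (metis smult_diff)
    then show ?thesis
      using f'(3) cls_eq_iff[OF letter_P[OF Xg f(2)] letter_P[OF Xg f'(2)]] by simp
  qed
  have "cls f \<in> U" if "f \<in> generated \<aa>" for f
    using that
  proof (induction rule: generated.induct)
    case (unit w)
    have "cls (pretensor 1 w) \<in> S"
      unfolding S using free_algebra_one by blast
    then show ?case
      using ind_span_superset[of S] unfolding U_def by blast
  next
    case (relation f)
    then show ?case using zero cls_eq_iff[of f 0] R_subset by simp
  qed (auto intro: add scale act generated_subset[OF assms])
  then show "cls ` generated \<aa> \<subseteq> enveloping_orbit \<gg> \<qq> \<rho> \<aa>"
    unfolding enveloping_orbit_def S_def[symmetric] U_def[symmetric] by blast
qed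

definition annihilated :: "'n cmat set \<Rightarrow> ('n, 'm) pretensor set" where
  "annihilated \<aa> = {f \<in> P. \<forall>X\<in>\<aa>. letter X *s f \<in> R}"

lemma annihilated_vectors_eq:
  assumes "\<aa> \<subseteq> \<gg>"
  shows "annihilated_vectors \<gg> \<qq> \<rho> \<aa> = cls ` annihilated \<aa>"
proof -
  have "ind_act \<gg> \<qq> \<rho> (letter X) (cls f) = ind_zero \<gg> \<qq> \<rho> \<longleftrightarrow> letter X *s f \<in> R"
    if "X \<in> \<aa>" "f \<in> P" for X f
    using that assms by (auto simp: ind_act_cls free_algebra_letter subset_iff cls_zero_iff letter_P)
  then show ?thesis
    unfolding annihilated_vectors_def ind_module_eq annihilated_def by auto
qed

lemma annihilated_cong:
  assumes "\<aa> \<subseteq> \<gg>" "f - f' \<in> R" "f \<in> P" "f' \<in> P"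
  shows "f \<in> annihilated \<aa> \<longleftrightarrow> f' \<in> annihilated \<aa>"
proof -
  have "letter X *s f \<in> R \<longleftrightarrow> letter X *s f' \<in> R" if "X \<in> \<aa>" for X
    by (rule R_cong, unfold smult_diff[symmetric], rule letter_R) (use assms that in auto)
  then show ?thesis
    using assms unfolding annihilated_def by auto
qed

lemma cls_image_eq_iff:
  assumes "A \<subseteq> P" "B \<subseteq> P"
    and "\<And>f f'. f - f' \<in> R \<Longrightarrow> f \<in> P \<Longrightarrow> f' \<in> P \<Longrightarrow> f \<in> A \<longleftrightarrow> f' \<in> A"
    and "\<And>f f'. f - f' \<in> R \<Longrightarrow> f \<in> P \<Longrightarrow> f' \<in> P \<Longrightarrow> f \<in> B \<longleftrightarrow> f' \<in> B"
  shows "cls ` A = cls ` B \<longleftrightarrow> A = B"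
proof
  assume eq: "cls ` A = cls ` B"
  show "A = B"
  proof (intro equalityI subsetI)
    fix f assume f: "f \<in> A"
    then obtain f' where "f' \<in> B" "cls f = cls f'" using eq by blast
    then show "f \<in> B" using assms f cls_eq_iff[of f f'] by blast
  next
    fix f assume f: "f \<in> B"
    then obtain f' where "f' \<in> A" "cls f = cls f'" using eq by blast
    then show "f \<in> A" using assms f cls_eq_iff[of f f'] by blast
  qed
qed simp

text \<open>The spanning half of the Poincare-Birkhoff-Witt theorem: words in \<open>\<nn>\<close> suffice, because an element of
  \<open>\<qq>\<close> can be moved to the right until it acts on \<open>W\<close>.\<close>

lemma generated_complement:
  assumes \<nn>: "\<nn> \<subseteq> \<gg>" and dec: "\<And>Z. Z \<in> \<gg> \<Longrightarrow> \<exists>Y\<in>\<nn>. \<exists>Q\<in>\<qq>. Z = Y + Q" and f: "f \<in> P"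
  shows "f \<in> generated \<nn>"
proof -
  have full: "letter Z *s f \<in> generated \<nn>"
    if f: "f \<in> generated \<nn>" and q: "\<And>Q. Q \<in> \<qq> \<Longrightarrow> letter Q *s f \<in> generated \<nn>" and Z: "Z \<in> \<gg>" for f Z
  proof -
    obtain Y Q where YQ: "Y \<in> \<nn>" "Q \<in> \<qq>" "Z = Y + Q"
      using dec[OF Z] by blast
    then have "letter Z *s f - (letter Y *s f + letter Q *s f) \<in> R"
      using letter_add[of Y Q f] \<nn> q_sub generated_subset[OF \<nn> f] by auto
    then show ?thesis
      using generated_cong YQ q f generated.act generated.add by meson
  qed
  have "letter Q *s f \<in> generated \<nn>" if "f \<in> generated \<nn>" "Q \<in> \<qq>" for f Q
    using that
  proof (induction arbitrary: Q rule: generated.induct)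
    case (unit w)
    show ?case
      using generated_cong[OF letter_balanced[OF unit]] generated.unit by blast
  next
    case (act X f)
    have mem: "X \<in> \<gg>" "Q \<in> \<gg>" "f \<in> P"
      using act \<nn> q_sub generated_subset[OF \<nn>] by auto
    have "letter X *s (letter Q *s f) + letter (brk Q X) *s f \<in> generated \<nn>"
      by (rule generated.add[OF generated.act[OF act.hyps(1) act.IH[OF act.prems]]
            full[OF act.hyps(2) act.IH g_brk[OF mem(2,1)]]])
    then show ?case
      using generated_cong[OF letter_swap[OF mem(2,1,3)]] by blast
  next
    case (relation f)
    then show ?case using letter_R q_sub by (blast intro: generated.relation)
  next
    case (add f f')
    then show ?case unfolding smult_add by (intro generated.add)
  next
    case (scale f c)
    then show ?case unfolding smult_scalar_commute by (intro generated.scale)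
  qed
  then have full': "letter Z *s f \<in> generated \<nn>" if "f \<in> generated \<nn>" "Z \<in> \<gg>" for f Z
    using full that by blast
  from generated_full[OF f] show ?thesis
  proof (induction rule: generated.induct)
    case (act X f)
    then show ?case by (intro full')
  qed (auto intro: generated.intros)
qed

end

section \<open>Annihilated vectors and the orbit of the associated subalgebra\<close>

text \<open>
  The brackets of the pieces of a symmetric pair that matter. Here \<open>ap\<close>, \<open>am\<close> are the parts of
  \<open>\<pp>\<^sup>+\<close>, \<open>\<pp>\<^sup>-\<close> in \<open>\<hh>\<close>, and \<open>bp\<close>, \<open>bm\<close> those in \<open>\<hh>\<^sub>0 = \<ll> + bp + bm\<close>, while \<open>\<nn>\<close> is \<open>\<pp>\<^sup>- = am + bm\<close>. The
  representation \<open>\<rho>\<close> of \<open>\<qq>\<close> is accompanied by a linear extension \<open>\<sigma>\<close> to all matrices.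
\<close>

locale symmetric_pair_module = abelian_complement \<gg> \<nn> pr \<sigma>
  for \<gg> \<nn> :: "'n::finite cmat set" and pr :: "'n cmat \<Rightarrow> 'n cmat" and \<sigma> :: "'n cmat \<Rightarrow> 'm::finite cmat" +
  fixes \<qq> \<hh>\<^sub>0 \<ll> ap am bp bm :: "'n cmat set" and \<rho> :: "'n cmat \<Rightarrow> 'm cmat"
  assumes q_eq: "\<qq> = {Z \<in> \<gg>. pr Z = 0}" and \<rho>_eq: "Z \<in> \<qq> \<Longrightarrow> \<rho> Z = \<sigma> Z"
    and ap_q: "ap \<subseteq> \<qq>" and \<rho>_ap: "X \<in> ap \<Longrightarrow> \<rho> X = 0"
    and am_n: "am \<subseteq> \<nn>" and bm_n: "bm \<subseteq> \<nn>" and n_dec: "Y \<in> \<nn> \<Longrightarrow> \<exists>A\<in>am. \<exists>B\<in>bm. Y = A + B"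
    and h0_g: "\<hh>\<^sub>0 \<subseteq> \<gg>" and bm_h0: "bm \<subseteq> \<hh>\<^sub>0" 
    and l_g: "\<ll> \<subseteq> \<gg>" and bp_g: "bp \<subseteq> \<gg>"
    and h0_dec: "Z \<in> \<hh>\<^sub>0 \<Longrightarrow> \<exists>C\<in>\<ll>. \<exists>B\<in>bp. \<exists>B'\<in>bm. Z = C + (B + B')"
    and l_ap: "X \<in> ap \<Longrightarrow> C \<in> \<ll> \<Longrightarrow> brk X C \<in> ap"
    and l_bm: "Y \<in> bm \<Longrightarrow> C \<in> \<ll> \<Longrightarrow> brk Y C \<in> bm"
    and ap_bp: "X \<in> ap \<Longrightarrow> B \<in> bp \<Longrightarrow> brk X B = 0"
    and bm_bp: "Y \<in> bm \<Longrightarrow> B \<in> bp \<Longrightarrow> brk Y B \<in> \<ll>"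
    and ap_bm_bm: "\<lbrakk>X \<in> ap; Y \<in> bm; Y' \<in> bm\<rbrakk> \<Longrightarrow> brk (brk X Y) Y' \<in> \<nn>"
    and n_nonempty: "0 \<in> \<nn>"
begin

sublocale induced_module \<gg> \<qq> \<rho>
  by standard (use add scale brk sub n_nonempty q_eq in auto)

lemma subsets: "ap \<subseteq> \<gg>" "am \<subseteq> \<gg>" "bm \<subseteq> \<gg>"
  using ap_q am_n bm_n sub q_eq by auto

lemma subsetsD: "X \<in> ap \<Longrightarrow> X \<in> \<gg>" "X \<in> am \<Longrightarrow> X \<in> \<gg>" "X \<in> bm \<Longrightarrow> X \<in> \<gg>" "X \<in> bp \<Longrightarrow> X \<in> \<gg>"
  "X \<in> \<ll> \<Longrightarrow> X \<in> \<gg>" "X \<in> \<hh>\<^sub>0 \<Longrightarrow> X \<in> \<gg>" "X \<in> \<nn> \<Longrightarrow> X \<in> \<gg>"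
  using subsets bp_g l_g h0_g sub by auto

abbreviation "orbit \<equiv> generated \<hh>\<^sub>0"
abbreviation "lowest \<equiv> annihilated ap"

lemma orbit_P: "f \<in> orbit \<Longrightarrow> f \<in> P"
  by (rule generated_subset[OF h0_g])

lemma R_cancel: "x - (y + z) \<in> R \<Longrightarrow> x \<in> R \<Longrightarrow> y \<in> R \<Longrightarrow> z \<in> R"
  using R_diff[OF R_diff, of x "x - (y + z)" y] by simp

lemma ap_unit: "X \<in> ap \<Longrightarrow> letter X *s pretensor 1 w \<in> R"
  using letter_balanced[of X w] ap_q \<rho>_ap[of X] R_cong tensor_relations.zero
  by (metis matrix_vector_mult_0 pretensor_zero(2) subsetD)

lemma ap_bm_unit:
  assumes "\<And>X Y w. X \<in> ap \<Longrightarrow> Y \<in> bm \<Longrightarrow> letter X *s (letter Y *s pretensor 1 w) \<in> R"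
    and "X \<in> ap" "Y \<in> bm"
  shows "letter (brk X Y) *s pretensor 1 w \<in> R"
proof -
  have g: "X \<in> \<gg>" "Y \<in> \<gg>" using assms subsetsD by auto
  have "letter Y *s (letter X *s pretensor 1 w) \<in> R"
    using ap_unit assms g letter_R by blast
  then show ?thesis
    by (rule R_cancel[OF letter_swap[OF g P_one] assms(1)[OF assms(2,3)]])
qed

text \<open>
  If \<open>[ap, bm]\<close> commutes with \<open>bm\<close>, then applying \<open>\<hh>\<^sub>0\<close> to \<open>W\<close> never leaves the space \<open>T\<close> of vectors that are
  annihilated by \<open>ap\<close> and by \<open>[ap, bm]\<close>. Asking for both makes \<open>T\<close> stable under \<open>\<hh>\<^sub>0\<close>.
\<close>

lemma orbit_subset_lowest:
  assumes first: "\<And>X Y w. X \<in> ap \<Longrightarrow> Y \<in> bm \<Longrightarrow> letter X *s (letter Y *s pretensor 1 w) \<in> R"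
    and zero: "\<And>X Y Y'. X \<in> ap \<Longrightarrow> Y \<in> bm \<Longrightarrow> Y' \<in> bm \<Longrightarrow> brk (brk X Y) Y' = 0"
  shows "orbit \<subseteq> lowest"
proof -
  define T where "T = {f \<in> P. (\<forall>X\<in>ap. letter X *s f \<in> R) \<and> (\<forall>X\<in>ap. \<forall>Y\<in>bm. letter (brk X Y) *s f \<in> R)}"
  have TP: "f \<in> P" if "f \<in> T" for f using that by (simp add: T_def)
  have T1: "letter X *s f \<in> R" if "f \<in> T" "X \<in> ap" for f X using that by (simp add: T_def)
  have T2: "letter (brk X Y) *s f \<in> R" if "f \<in> T" "X \<in> ap" "Y \<in> bm" for f X Y using that by (simp add: T_def)
  have T0: "letter 0 *s f \<in> R" if "f \<in> T" for f using TP[OF that] by (rule letter_zero)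
  \<comment> \<open>moving \<open>Z\<close> past an element that annihilates \<open>f\<close>\<close>
  have move: "letter X *s (letter Z *s f) \<in> R"
    if "X \<in> \<gg>" "Z \<in> \<gg>" "f \<in> P" "letter X *s f \<in> R" "letter (brk X Z) *s f \<in> R" for X Z f
    using R_cong[OF letter_swap[OF that(1-3)]] letter_R[OF that(2,4)] that(5) tensor_relations.add by blast
  have Tadd: "f + f' \<in> T" if "f \<in> T" "f' \<in> T" for f f'
    using that unfolding T_def by (auto simp: smult_add intro: pretensor_space_add tensor_relations.add)
  have Tcong: "f' \<in> T" if "f - f' \<in> R" "f \<in> T" "f' \<in> P" for f f'
  proof -
    have "letter X *s f' \<in> R" if "letter X *s f \<in> R" "X \<in> \<gg>" for X
      using R_cong[of "letter X *s f" "letter X *s f'"] letter_R[OF that(2) \<open>f - f' \<in> R\<close>] that(1)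
      by (simp add: smult_diff)
    then show ?thesis
      using that unfolding T_def by (simp add: subsetsD brk)
  qed
  have Tbm: "letter Y' *s f \<in> T" if f: "f \<in> T" and Y': "Y' \<in> bm" for f Y'
    unfolding T_def using f Y'
    by (auto intro!: move letter_P brk simp: subsetsD TP T1 T2 T0 zero)
  have Tl: "letter C *s f \<in> T" if f: "f \<in> T" and C: "C \<in> \<ll>" for f C
  proof -
    have "letter (brk (brk X Y) C) *s f \<in> R" if "X \<in> ap" "Y \<in> bm" for X Y
    proof -
      have eq: "brk (brk X Y) C = brk X (brk Y C) + brk (brk X C) Y"
        using brk_jacobi[of X Y C] brk_antisym[of Y "brk X C"] by simp
      have mem: "brk X (brk Y C) \<in> \<gg>" "brk (brk X C) Y \<in> \<gg>"
        using that C subsetsD by (auto intro!: brk)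
      show ?thesis
        unfolding eq using R_cong[OF letter_add[OF mem TP[OF f]]] 
          T2[OF f that(1) l_bm[OF that(2) C]] T2[OF f l_ap[OF that(1) C] that(2)]
          tensor_relations.add by blast
    qed
    then show ?thesis
      unfolding T_def using f C
      by (auto intro!: move letter_P brk simp: subsetsD TP T1 T2 l_ap)
  qed
  have Tbp: "letter B *s f \<in> T" if f: "f \<in> T" and B: "B \<in> bp" for f B
  proof -
    have "letter (brk (brk X Y) B) *s f \<in> R" if "X \<in> ap" "Y \<in> bm" for X Y
    proof -
      have eq: "brk (brk X Y) B = brk X (brk Y B)"
        using brk_jacobi[of X Y B] ap_bp[OF that(1) B] by simp
      show ?thesis
        unfolding eq using T1[OF f] l_ap bm_bp that B by blast
    qed
    then show ?thesis
      unfolding T_def using f B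
      by (auto intro!: move letter_P brk simp: subsetsD TP T1 T2 T0 ap_bp)
  qed
  have "f \<in> T" if "f \<in> orbit" for f
    using that
  proof (induction rule: generated.induct)
    case (unit w)
    then show ?case
      unfolding T_def using ap_unit ap_bm_unit[OF first] P_one by blast
  next
    case (act Z f)
    obtain C B B' where Z: "C \<in> \<ll>" "B \<in> bp" "B' \<in> bm" "Z = C + (B + B')"
      using h0_dec act by blast
    have g: "C \<in> \<gg>" "B \<in> \<gg>" "B' \<in> \<gg>" "f \<in> P"
      using Z subsetsD TP act by auto
    have BB': "B + B' \<in> \<gg>" by (rule g_add[OF g(2,3)])
    have "(letter B *s f + letter B' *s f) - letter (B + B') *s f \<in> R"
      using R_minus[OF letter_add[OF g(2,3,4)]] by simp
    then have "letter (B + B') *s f \<in> T"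
      by (rule Tcong[OF _ Tadd[OF Tbp[OF act.IH Z(2)] Tbm[OF act.IH Z(3)]] letter_P[OF BB' g(4)]])
    note * = Tadd[OF Tl[OF act.IH Z(1)] this]
    have "(letter C *s f + letter (B + B') *s f) - letter Z *s f \<in> R"
      using R_minus[OF letter_add[OF g(1) BB' g(4)]] unfolding Z(4) by simp
    then show ?case
      by (rule Tcong[OF _ * letter_P[OF g_add[OF g(1) BB', folded Z(4)] g(4)]])
  next
    case (scale f c)
    then show ?case
      unfolding T_def
      by (auto simp: smult_scalar_commute
          intro: tensor_relations.scale pretensor_space_smult)
  next
    case (relation f)
    then show ?case unfolding T_def by (auto intro!: R_subset letter_R brk simp: subsetsD)
  qed (rule Tadd)
  then show ?thesis
    unfolding annihilated_def T_def by auto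
qed

text \<open>Representatives of the elements of \<open>am M\<close>.\<close>

inductive_set moved :: "('n, 'm) pretensor set" where
  zero: "0 \<in> moved"
| step: "A \<in> am \<Longrightarrow> f \<in> P \<Longrightarrow> s \<in> moved \<Longrightarrow> letter A *s f + s \<in> moved"

lemma moved_P: "s \<in> moved \<Longrightarrow> s \<in> P"
  by (induction rule: moved.induct) (auto intro!: pretensor_space_add letter_P simp: subsetsD)

lemma moved_add: "s \<in> moved \<Longrightarrow> t \<in> moved \<Longrightarrow> s + t \<in> moved"
  by (induction rule: moved.induct) (auto simp: add.assoc intro: moved.step)

lemma moved_act:
  assumes B: "B \<in> \<nn>"
  shows "s \<in> moved \<Longrightarrow> \<exists>t\<in>moved. letter B *s s - t \<in> R"
proof (induction rule: moved.induct)
  case zero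
  then show ?case using moved.zero by (auto intro!: bexI[of _ 0] simp: tensor_relations.zero)
next
  case (step A f s)
  then obtain t where t: "t \<in> moved" "letter B *s s - t \<in> R" by blast
  have g: "A \<in> \<gg>" "B \<in> \<gg>" using step B subsetsD by auto
  have "brk B A = 0" using B step am_n abelian by blast
  then have "letter B *s (letter A *s f) - letter A *s (letter B *s f) \<in> R"
    using tensor_relations.add[OF letter_swap[OF g(2,1) step(2)] letter_zero[OF step(2)]] by simp
  from tensor_relations.add[OF this t(2)]
  have "letter B *s (letter A *s f + s) - (letter A *s (letter B *s f) + t) \<in> R"
    by (simp only: smult_add add_diff_add)
  then show ?case
    using moved.step[OF step(1) letter_P[OF g(2) step(2)] t(1)] by blast
qed

text \<open>\<open>M = \<U>(\<hh>\<^sub>0)W + am M\<close>: the module is spanned by words in \<open>\<nn> = am + bm\<close>, and since \<open>\<nn>\<close> is abelian, a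
  letter from \<open>am\<close> can be moved to the front.\<close>

lemma module_decomposition:
  assumes "f \<in> P"
  shows "\<exists>u\<in>orbit. \<exists>s\<in>moved. f - (u + s) \<in> R"
proof -
  have dec: "\<exists>Y\<in>\<nn>. \<exists>Q\<in>\<qq>. Z = Y + Q" if "Z \<in> \<gg>" for Z
  proof -
    have "Z - pr Z \<in> \<qq>"
      unfolding q_eq using that pr_mem sub by (auto intro!: diff simp: complex_linear_simps[OF pr_linear] pr_id)
    then show ?thesis
      using pr_mem by (intro bexI[of _ "pr Z"] bexI[of _ "Z - pr Z"]) auto
  qed
  have "f \<in> generated \<nn>"
    by (rule generated_complement[OF sub dec assms])
  then show ?thesis
  proof (induction rule: generated.induct)
    case (unit w)
    have "pretensor 1 w - (pretensor 1 w + 0) \<in> R" by (simp add: tensor_relations.zero)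
    then show ?case using generated.unit moved.zero by blast
  next
    case (act Y f)
    then obtain u s where us: "u \<in> orbit" "s \<in> moved" "f - (u + s) \<in> R" by blast
    obtain A B where AB: "A \<in> am" "B \<in> bm" "Y = A + B" using n_dec act by blast
    have g: "A \<in> \<gg>" "B \<in> \<gg>" "Y \<in> \<gg>" using AB act subsetsD by auto
    have f: "f \<in> P" using generated_subset[OF sub] act by blast
    obtain t where t: "t \<in> moved" "letter B *s s - t \<in> R"
      using moved_act us AB bm_n by blast
    have 1: "letter Y *s f - (letter A *s f + letter B *s f) \<in> R"
      using letter_add g f AB by blast
    have 2: "letter B *s f - (letter B *s u + letter B *s s) \<in> R"
      using letter_R[OF g(2) us(3)] by (simp only: smult_diff smult_add)
    have 3: "letter Y *s f - (letter B *s u + (letter A *s f + t)) \<in> R"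
      using tensor_relations.add[OF tensor_relations.add[OF 1 2] t(2)] by (simp add: algebra_simps)
    have "letter B *s u \<in> orbit"
      using AB bm_h0 us by (auto intro: generated.act)
    moreover have "letter A *s f + t \<in> moved"
      using AB f t by (auto intro: moved.step)
    ultimately show ?case using 3 by blast
  next
    case (add f f')
    then obtain u s u' s' where us: "u \<in> orbit" "s \<in> moved" "f - (u + s) \<in> R"
      "u' \<in> orbit" "s' \<in> moved" "f' - (u' + s') \<in> R" by blast
    have "(f + f') - ((u + u') + (s + s')) \<in> R"
      using tensor_relations.add[OF us(3,6)] by (simp add: algebra_simps)
    then show ?case using us moved_add generated.add by blast
  next
    case (scale f c)
    then obtain u s where us: "u \<in> orbit" "s \<in> moved" "f - (u + s) \<in> R" by blast
    have "\<exists>t\<in>moved. scalar c *s s = t" 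
      using us(2)
    proof (induction rule: moved.induct)
      case zero then show ?case using moved.zero by auto
    next
      case (step A f s)
      then have "letter A *s (scalar c *s f) + scalar c *s s \<in> moved"
        by (auto intro!: moved.step pretensor_space_smult)
      then show ?case by (simp only: smult_add smult_scalar_commute[of "letter A"]) blast
    qed
    moreover have "scalar c *s f - (scalar c *s u + scalar c *s s) \<in> R"
      using tensor_relations.scale[OF us(3), of c] by (simp only: smult_diff smult_add)
    ultimately show ?case using generated.scale[OF us(1)] by blast
  next
    case (relation f)
    then have "f - (0 + 0) \<in> R" by simp
    then show ?case using moved.zero generated.relation[OF tensor_relations.zero] by blast
  qed
qed

text \<open>
  The vectors \<open>YY'w\<close> lie in the orbit, so \<open>X\<close> annihilates them. Moving \<open>X\<close> to the right leaves only
  \<open>[[X, Y], Y']w\<close>, since all terms in which \<open>X\<close> meets at most one factor vanish by the first layer.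
\<close>

lemma brackets_vanish:
  assumes first: "\<And>X Y w. X \<in> ap \<Longrightarrow> Y \<in> bm \<Longrightarrow> letter X *s (letter Y *s pretensor 1 w) \<in> R"
    and sub_lowest: "orbit \<subseteq> lowest"
    and X: "X \<in> ap" and Y: "Y \<in> bm" "Y' \<in> bm"
  shows "brk (brk X Y) Y' = 0"
proof (rule no_relations_in_first_layer)
  show "Z \<in> \<qq> \<Longrightarrow> Z \<in> \<gg> \<and> pr Z = 0 \<and> \<rho> Z = \<sigma> Z" for Z
    using q_eq \<rho>_eq by auto
  show "brk (brk X Y) Y' \<in> \<nn>" by (rule ap_bm_bm[OF X Y])
  fix w :: "complex^'m"
  define e where "e = pretensor (1 :: 'n free_alg) w"
  have g: "X \<in> \<gg>" "Y \<in> \<gg>" "Y' \<in> \<gg>" using X Y subsetsD by auto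
  have e: "e \<in> P" unfolding e_def by (rule P_one)
  have "letter Y *s (letter Y' *s e) \<in> orbit"
    unfolding e_def using Y bm_h0 by (auto intro!: generated.act generated.unit)
  then have 1: "letter X *s (letter Y *s (letter Y' *s e)) \<in> R"
    using sub_lowest X unfolding annihilated_def by blast
  have "letter Y *s (letter X *s (letter Y' *s e)) \<in> R"
    unfolding e_def by (rule letter_R[OF g(2) first[OF X Y(2)]])
  then have 2: "letter (brk X Y) *s (letter Y' *s e) \<in> R"
    by (rule R_cancel[OF letter_swap[OF g(1,2) letter_P[OF g(3) e]] 1])
  have "letter Y' *s (letter (brk X Y) *s e) \<in> R"
    unfolding e_def by (rule letter_R[OF g(3) ap_bm_unit[OF first X Y(1)]])
  then have "letter (brk (brk X Y) Y') *s e \<in> R"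
    by (rule R_cancel[OF letter_swap[OF brk[OF g(1,2)] g(3) e] 2])
  then show "pretensor (letter (brk (brk X Y) Y')) w \<in> R"
    unfolding e_def by (simp flip: pretensor_one)
qed

end

text \<open>\<open>\<Phi>\<close> is the inclusion of \<open>M\<close> into a Hilbert space, lifted to representatives, and \<open>conj\<close> is the complex
  conjugation of \<open>\<gg>\<close> with respect to the real form that acts by skew operators.\<close>

locale unitary_symmetric_pair_module = symmetric_pair_module \<gg> \<nn> pr \<sigma> \<qq> \<hh>\<^sub>0 \<ll> ap am bp bm \<rho>
  for \<gg> \<nn> :: "'n::finite cmat set" and pr :: "'n cmat \<Rightarrow> 'n cmat" and \<sigma> :: "'n cmat \<Rightarrow> 'm::finite cmat"
  and \<qq> \<hh>\<^sub>0 \<ll> ap am bp bm :: "'n cmat set" and \<rho> :: "'n cmat \<Rightarrow> 'm cmat" +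
  fixes conj :: "'n cmat \<Rightarrow> 'n cmat" and \<Phi> :: "('n, 'm) pretensor \<Rightarrow> 'h::real_inner"
  assumes conj: "A \<in> am \<Longrightarrow> conj A \<in> ap"
    and \<Phi>_add: "f \<in> P \<Longrightarrow> f' \<in> P \<Longrightarrow> \<Phi> (f + f') = \<Phi> f + \<Phi> f'"
    and \<Phi>_zero_iff: "f \<in> P \<Longrightarrow> \<Phi> f = 0 \<longleftrightarrow> f \<in> R"
    and \<Phi>_adjoint: "A \<in> am \<Longrightarrow> f \<in> P \<Longrightarrow> f' \<in> P \<Longrightarrow>
      inner (\<Phi> (letter A *s f)) (\<Phi> f') = - inner (\<Phi> f) (\<Phi> (letter (conj A) *s f'))"
begin

lemma lowest_orthogonal_moved:
  assumes "v \<in> lowest"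
  shows "s \<in> moved \<Longrightarrow> inner (\<Phi> s) (\<Phi> v) = 0"
proof (induction rule: moved.induct)
  case zero
  have "\<Phi> 0 = 0" using \<Phi>_zero_iff[of 0] tensor_relations.zero by simp
  then show ?case by simp
next
  case (step A f s)
  have v: "v \<in> P" "letter (conj A) *s v \<in> R"
    using assms conj step unfolding annihilated_def by auto
  have "\<Phi> (letter (conj A) *s v) = 0"
    using \<Phi>_zero_iff v R_subset by blast
  then show ?case
    using step \<Phi>_adjoint[OF step(1,2) v(1)] moved_P letter_P subsetsD v
    by (simp add: \<Phi>_add inner_add_left)
qed

text \<open>Split \<open>v = u + s\<close> along \<open>M = \<U>(\<hh>\<^sub>0)W + am M\<close>. If \<open>u\<close> is annihilated by \<open>ap\<close> as well, then so is \<open>s\<close>, which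
  is therefore orthogonal to itself.\<close>

lemma lowest_subset_orbit:
  assumes "orbit \<subseteq> lowest"
  shows "lowest \<subseteq> orbit"
proof
  fix v assume v: "v \<in> lowest"
  then have vP: "v \<in> P" by (simp add: annihilated_def)
  obtain u s where us: "u \<in> orbit" "s \<in> moved" "v - (u + s) \<in> R"
    using module_decomposition[OF vP] by blast
  have P: "u \<in> P" "s \<in> P" using us orbit_P moved_P by auto
  have "v - u - s \<in> R" using us by (simp add: diff_diff_eq)
  moreover have "v - u \<in> lowest"
    using v us assms unfolding annihilated_def
    by (auto simp: smult_diff intro: R_diff pretensor_space_diff)
  ultimately have s: "s \<in> lowest"
    using annihilated_cong[OF subsets(1)] P vP pretensor_space_diff by blast
  have "inner (\<Phi> s) (\<Phi> s) = 0"
    by (rule lowest_orthogonal_moved[OF s us(2)])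
  then have "s \<in> R"
    using \<Phi>_zero_iff[OF P(2)] by simp
  then have "v - u \<in> R"
    using tensor_relations.add[OF \<open>v - u - s \<in> R\<close> \<open>s \<in> R\<close>] by simp
  then show "v \<in> orbit"
    using generated_cong us by blast
qed

theorem lowest_eq_orbit_iff:
  assumes first_layer: "ind_layer \<gg> \<qq> \<rho> \<nn> 1 \<inter> annihilated_vectors \<gg> \<qq> \<rho> ap =
      ind_layer \<gg> \<qq> \<rho> \<nn> 1 \<inter> enveloping_orbit \<gg> \<qq> \<rho> \<hh>\<^sub>0"
  shows "annihilated_vectors \<gg> \<qq> \<rho> ap = enveloping_orbit \<gg> \<qq> \<rho> \<hh>\<^sub>0 \<longleftrightarrow>
    (\<forall>X\<in>ap. \<forall>Y\<in>bm. \<forall>Y'\<in>bm. brk (brk X Y) Y' = 0)"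
proof -
  have Lc: "annihilated_vectors \<gg> \<qq> \<rho> ap = cls ` lowest"
    by (rule annihilated_vectors_eq[OF subsets(1)])
  have UW: "enveloping_orbit \<gg> \<qq> \<rho> \<hh>\<^sub>0 = cls ` orbit"
    by (rule enveloping_orbit_eq[OF h0_g])
  have first: "letter X *s (letter Y *s pretensor 1 w) \<in> R" if X: "X \<in> ap" and Y: "Y \<in> bm" for X Y w
  proof -
    have Yg: "Y \<in> \<gg>" using Y subsetsD by auto
    have Yw: "letter Y *s pretensor 1 w \<in> P"
      by (intro letter_P Yg P_one)
    have "tensor_class \<gg> \<qq> \<rho> (prod_list (map letter [Y])) w \<in> ind_layer \<gg> \<qq> \<rho> \<nn> 1"
      unfolding ind_layer_def
      by (rule subsetD[OF ind_span_superset], rule CollectI, rule exI[of _ "[Y]"], rule exI[of _ w]) (use Y bm_n in auto)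
    then have "cls (letter Y *s pretensor 1 w) \<in> ind_layer \<gg> \<qq> \<rho> \<nn> 1"
      by (simp add: tensor_class_eq flip: pretensor_one)
    moreover have "cls (letter Y *s pretensor 1 w) \<in> cls ` orbit"
      using Y bm_h0 by (auto intro!: imageI generated.act generated.unit)
    ultimately have "cls (letter Y *s pretensor 1 w) \<in> cls ` lowest"
      using first_layer unfolding Lc UW by blast
    then obtain f where "f \<in> lowest" "cls (letter Y *s pretensor 1 w) = cls f" by blast
    then have "letter Y *s pretensor 1 w \<in> lowest"
      using annihilated_cong[OF subsets(1) _ Yw] cls_eq_iff[OF Yw] unfolding annihilated_def by blast
    then show ?thesis
      using X unfolding annihilated_def by blast
  qed
  have "cls ` lowest = cls ` orbit \<longleftrightarrow> lowest = orbit"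
  proof (rule cls_image_eq_iff)
    show "lowest \<subseteq> P" "orbit \<subseteq> P"
      using orbit_P by (auto simp: annihilated_def)
  qed (rule annihilated_cong[OF subsets(1)] generated_cong; assumption)+
  also have "\<dots> \<longleftrightarrow> orbit \<subseteq> lowest"
    using lowest_subset_orbit by blast
  also have "\<dots> \<longleftrightarrow> (\<forall>X\<in>ap. \<forall>Y\<in>bm. \<forall>Y'\<in>bm. brk (brk X Y) Y' = 0)"
    using brackets_vanish[OF first] orbit_subset_lowest[OF first] by blast
  finally show ?thesis
    unfolding Lc UW .
qed

end

section \<open>Complexification\<close>

definition cplx :: "'n::finite rmat \<Rightarrow> 'n rmat \<Rightarrow> 'n cmat" where
  "cplx X Y = of_real_mat X + scale_mat \<i> (of_real_mat Y)"

definition re_mat :: "'n::finite cmat \<Rightarrow> 'n rmat" where "re_mat Z = (\<chi> i j. Re (Z $ i $ j))"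
definition im_mat :: "'n::finite cmat \<Rightarrow> 'n rmat" where "im_mat Z = (\<chi> i j. Im (Z $ i $ j))"

lemma cplx_nth: "cplx X Y $ i $ j = Complex (X $ i $ j) (Y $ i $ j)"
  by (simp add: cplx_def of_real_mat_def scale_mat_def complex_eq_iff)

lemma re_cplx [simp]: "re_mat (cplx X Y) = X" and im_cplx [simp]: "im_mat (cplx X Y) = Y"
  by (simp_all add: re_mat_def im_mat_def cplx_nth vec_eq_iff)

lemma cplx_re_im: "cplx (re_mat Z) (im_mat Z) = Z"
  by (simp add: re_mat_def im_mat_def cplx_nth vec_eq_iff)

lemma cplx_inject [simp]: "cplx X Y = cplx X' Y' \<longleftrightarrow> X = X' \<and> Y = Y'"
  by (metis re_cplx im_cplx)

lemma cplx_zero: "cplx 0 0 = 0"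
  by (simp add: cplx_nth vec_eq_iff complex_eq_iff)

lemma cplx_add: "cplx X Y + cplx X' Y' = cplx (X + X') (Y + Y')"
  and cplx_minus: "- cplx X Y = cplx (- X) (- Y)"
  and cplx_scaleR: "r *\<^sub>R cplx X Y = cplx (r *\<^sub>R X) (r *\<^sub>R Y)"
  and cplx_scale: "scale_mat c (cplx X Y) = cplx (Re c *\<^sub>R X - Im c *\<^sub>R Y) (Re c *\<^sub>R Y + Im c *\<^sub>R X)"
  by (simp_all add: cplx_nth vec_eq_iff complex_eq_iff scale_mat_def)

lemma brk_cplx: "brk (cplx X Y) (cplx X' Y') = cplx (brk X X' - brk Y Y') (brk X Y' + brk Y X')"
  by (simp add: brk_def cplx_nth vec_eq_iff complex_eq_iff matrix_matrix_mult_def sum.distrib sum_subtractf)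

lemma re_add: "re_mat (Z + Z') = re_mat Z + re_mat Z'" and im_add: "im_mat (Z + Z') = im_mat Z + im_mat Z'"
  and re_scaleR: "re_mat (r *\<^sub>R Z) = r *\<^sub>R re_mat Z" and im_scaleR: "im_mat (r *\<^sub>R Z) = r *\<^sub>R im_mat Z"
  and re_ii: "re_mat (scale_mat \<i> Z) = - im_mat Z" and im_ii: "im_mat (scale_mat \<i> Z) = re_mat Z"
  by (simp_all add: re_mat_def im_mat_def vec_eq_iff scale_mat_def)

lemma complexify_eq: "complexify V = {cplx X Y | X Y. X \<in> V \<and> Y \<in> V}"
  by (simp add: complexify_def cplx_def)

lemma cplx_mem_complexify: "cplx X Y \<in> complexify V \<longleftrightarrow> X \<in> V \<and> Y \<in> V"
  unfolding complexify_eq by auto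

lemma complexify_map_eq: "complexify_map f Z = f (re_mat Z) + scale_mat \<i> (f (im_mat Z))"
  by (simp add: complexify_map_def re_mat_def im_mat_def)

lemma complex_linearI:
  assumes add: "\<And>X Y. f (X + Y) = f X + f Y" and scale: "\<And>r X. f (r *\<^sub>R X) = r *\<^sub>R f X"
    and ii: "\<And>X. f (scale_mat \<i> X) = scale_mat \<i> (f X)"
  shows "complex_linear f"
  unfolding complex_linear_def
proof (intro conjI allI add)
  fix c X
  have dec: "scale_mat c Z = Re c *\<^sub>R Z + Im c *\<^sub>R scale_mat \<i> Z" for Z :: "'k::finite cmat"
    by (simp add: scale_mat_def vec_eq_iff complex_eq_iff)
  show "f (scale_mat c X) = scale_mat c (f X)"
    unfolding dec add scale ii ..
qed

definition conj_mat :: "'n::finite cmat \<Rightarrow> 'n cmat" where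
  "conj_mat Z = cplx (re_mat Z) (- im_mat Z)"

lemma conj_cplx [simp]: "conj_mat (cplx X Y) = cplx X (- Y)"
  by (simp add: conj_mat_def)

lemma conj_brk: "conj_mat (brk Z Z') = brk (conj_mat Z) (conj_mat Z')"
  by (subst (1 2) cplx_re_im[symmetric, of Z], subst (1 2) cplx_re_im[symmetric, of Z'])
     (simp add: brk_cplx brk_linear)

lemma conj_conj [simp]: "conj_mat (conj_mat Z) = Z"
  by (simp add: conj_mat_def cplx_re_im)

lemma conj_zero_iff: "conj_mat Z = 0 \<longleftrightarrow> Z = 0"
  by (metis conj_conj conj_cplx cplx_zero minus_zero)

text \<open>
  \<open>s\<close> is the differential of an involution that commutes with \<open>\<theta>\<close>, such that \<open>J\<close> preserves the fixed points
  of \<open>s\<close> in \<open>\<pp>\<close>, and \<open>T\<close> is a representation of \<open>\<kk>\<close>.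
\<close>

locale hermitian_symmetric_pair = hermitian_pair \<gg> \<theta> J
  for \<gg> :: "'n::finite rmat set" and \<theta> J +
  fixes s :: "'n rmat \<Rightarrow> 'n rmat" and T :: "'n rmat \<Rightarrow> 'm::finite cmat"
  assumes s_endo: "endo_on \<gg> s" 
    and s_brk: "X \<in> \<gg> \<Longrightarrow> Y \<in> \<gg> \<Longrightarrow> s (brk X Y) = brk (s X) (s Y)"
    and s_s: "X \<in> \<gg> \<Longrightarrow> s (s X) = X"
    and s_\<theta>: "X \<in> \<gg> \<Longrightarrow> s (\<theta> X) = \<theta> (s X)"
    and J_fixed: "X \<in> \<pp> \<Longrightarrow> s X = X \<Longrightarrow> s (J X) = J X"
    and T_add: "X \<in> \<kk> \<Longrightarrow> Y \<in> \<kk> \<Longrightarrow> T (X + Y) = T X + T Y"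
    and T_scaleR: "X \<in> \<kk> \<Longrightarrow> T (c *\<^sub>R X) = c *\<^sub>R T X"
    and T_brk: "X \<in> \<kk> \<Longrightarrow> Y \<in> \<kk> \<Longrightarrow> T (brk X Y) = brk (T X) (T Y)"
begin

lemma s_add: "X \<in> \<gg> \<Longrightarrow> Y \<in> \<gg> \<Longrightarrow> s (X + Y) = s X + s Y"
  and s_scaleR: "X \<in> \<gg> \<Longrightarrow> s (c *\<^sub>R X) = c *\<^sub>R s X"
  and s_mem: "X \<in> \<gg> \<Longrightarrow> s X \<in> \<gg>"
  using endo_onD[OF s_endo] by auto

lemma s_minus: "X \<in> \<gg> \<Longrightarrow> s (- X) = - s X"
  using s_scaleR[of X "-1"] by simp

lemma s_diff: "X \<in> \<gg> \<Longrightarrow> Y \<in> \<gg> \<Longrightarrow> s (X - Y) = s X - s Y"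
  using s_add[of X "- Y"] by (simp add: s_minus g_minus)

lemma J_skew_fixed: "X \<in> \<pp> \<Longrightarrow> s X = - X \<Longrightarrow> s (J X) = - J X"
  using J_preserves_complement[OF s_endo s_brk s_s s_\<theta> J_fixed] by blast

definition "\<hh> = {X \<in> \<gg>. s X = X}"
definition "\<hh>\<^sub>0 = {X \<in> \<gg>. s (\<theta> X) = X}"

definition "\<gg>C = complexify \<gg>"
definition "\<pp>plus = p_plus \<pp> J"
definition "\<pp>minus = p_minus \<pp> J"

definition ep :: "'n rmat \<Rightarrow> 'n cmat" where "ep X = cplx X (- J X)"
definition em :: "'n rmat \<Rightarrow> 'n cmat" where "em X = cplx X (J X)"

lemma p_add: "X \<in> \<pp> \<Longrightarrow> Y \<in> \<pp> \<Longrightarrow> X + Y \<in> \<pp>"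
  and p_diff: "X \<in> \<pp> \<Longrightarrow> Y \<in> \<pp> \<Longrightarrow> X - Y \<in> \<pp>"
  and p_scaleR: "X \<in> \<pp> \<Longrightarrow> c *\<^sub>R X \<in> \<pp>"
  and p_minus_mem: "X \<in> \<pp> \<Longrightarrow> - X \<in> \<pp>"
  and p_zero: "0 \<in> \<pp>"
  using subspace_p by (auto simp: subspace_add subspace_diff subspace_scale subspace_neg subspace_0)

lemma k_add: "X \<in> \<kk> \<Longrightarrow> Y \<in> \<kk> \<Longrightarrow> X + Y \<in> \<kk>"
  and k_diff: "X \<in> \<kk> \<Longrightarrow> Y \<in> \<kk> \<Longrightarrow> X - Y \<in> \<kk>"
  and k_scaleR: "X \<in> \<kk> \<Longrightarrow> c *\<^sub>R X \<in> \<kk>"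
  and k_zero: "0 \<in> \<kk>"
  using subspace_k by (auto simp: subspace_add subspace_diff subspace_scale subspace_0)

lemma J_zero: "J 0 = 0"
  using J_scaleR[OF p_zero, of 0] by simp

lemma T_zero: "T 0 = 0"
  using T_scaleR[OF k_zero, of 0] by simp

lemma pplus_eq: "\<pp>plus = ep ` \<pp>"
  unfolding \<pp>plus_def p_plus_def image_def ep_def cplx_def
  by (auto simp: of_real_mat_def scale_mat_def vec_eq_iff)

lemma pminus_eq: "\<pp>minus = em ` \<pp>"
  unfolding \<pp>minus_def p_minus_def image_def em_def cplx_def by auto

lemma em_add: "X \<in> \<pp> \<Longrightarrow> Y \<in> \<pp> \<Longrightarrow> em (X + Y) = em X + em Y"
  by (simp add: em_def J_add cplx_add)

lemma em_zero: "em 0 = 0"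
  by (simp add: em_def J_zero cplx_zero)

lemma ep_minus: "X \<in> \<pp> \<Longrightarrow> - ep X = ep (- X)" and em_minus: "X \<in> \<pp> \<Longrightarrow> - em X = em (- X)"
  by (simp_all add: ep_def em_def J_minus cplx_minus)

lemma J_brk_left: "X \<in> \<pp> \<Longrightarrow> Y \<in> \<pp> \<Longrightarrow> brk (J X) Y = - brk X (J Y)"
  using J_brk[of "J X" Y] by (simp add: J_mem J_J brk_minus_left)

lemma brk_ep_ep: "X \<in> \<pp> \<Longrightarrow> Y \<in> \<pp> \<Longrightarrow> brk (ep X) (ep Y) = 0"
  and brk_em_em: "X \<in> \<pp> \<Longrightarrow> Y \<in> \<pp> \<Longrightarrow> brk (em X) (em Y) = 0"
  by (simp_all add: ep_def em_def brk_cplx brk_minus_left brk_minus_right J_brk J_brk_left cplx_zero)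

lemma brk_k_em:
  assumes "A \<in> \<kk>" "B \<in> \<kk>" "X \<in> \<pp>"
  shows "brk (cplx A B) (em X) = em (brk A X - brk B (J X))"
  using assms by (simp add: em_def brk_cplx J_diff J_k J_mem J_J brk_kp brk_minus_right)

lemma brk_k_ep:
  assumes "A \<in> \<kk>" "B \<in> \<kk>" "X \<in> \<pp>"
  shows "brk (cplx A B) (ep X) = ep (brk A X + brk B (J X))"
  using assms by (simp add: ep_def brk_cplx J_add J_k J_mem J_J brk_kp brk_minus_right)

lemma brk_ep_em:
  assumes "X \<in> \<pp>" "Y \<in> \<pp>"
  shows "brk (ep X) (em Y) = cplx (2 *\<^sub>R brk X Y) (2 *\<^sub>R brk X (J Y))"
  using assms by (simp add: ep_def em_def brk_cplx brk_minus_left J_brk J_brk_left scaleR_2)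

subsection \<open>The projections\<close>

text \<open>The projections of \<open>\<gg>\<close> onto \<open>\<kk>\<close> and \<open>\<pp>\<close>, and after complexification onto \<open>\<pp>\<^sup>-\<close>, are preceded by a projection
  of all matrices onto \<open>\<gg>\<close>.\<close>

definition "proj = (SOME P. linear P \<and> (\<forall>v. P v \<in> \<gg>) \<and> (\<forall>v\<in>\<gg>. P v = v))"

lemma proj: "linear proj" "proj v \<in> \<gg>" "v \<in> \<gg> \<Longrightarrow> proj v = v"
  using someI_ex[OF linear_subspace_projection[OF sub]] unfolding proj_def by auto

definition "kproj X = k_part (proj X)"
definition "pproj X = p_part (proj X)"

lemma kproj_mem: "kproj X \<in> \<kk>" and pproj_mem: "pproj X \<in> \<pp>"
  by (simp_all add: kproj_def pproj_def k_part p_part proj)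

lemma kproj_add: "kproj (X + Y) = kproj X + kproj Y" and pproj_add: "pproj (X + Y) = pproj X + pproj Y"
  and kproj_scaleR: "kproj (c *\<^sub>R X) = c *\<^sub>R kproj X" and pproj_scaleR: "pproj (c *\<^sub>R X) = c *\<^sub>R pproj X"
  by (simp_all add: kproj_def pproj_def k_part_def p_part_def linear_add[OF proj(1)] linear_scale[OF proj(1)]
      \<theta>_add \<theta>_scaleR proj(2) algebra_simps)

lemma kproj_minus: "kproj (- X) = - kproj X" and pproj_minus: "pproj (- X) = - pproj X"
  using kproj_scaleR[of "-1" X] pproj_scaleR[of "-1" X] by simp_all

lemma kproj_k: "X \<in> \<kk> \<Longrightarrow> kproj X = X" and pproj_k: "X \<in> \<kk> \<Longrightarrow> pproj X = 0"
  and kproj_p: "X \<in> \<pp> \<Longrightarrow> kproj X = 0" and pproj_p: "X \<in> \<pp> \<Longrightarrow> pproj X = X"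
  by (simp_all add: kproj_def pproj_def k_part_def p_part_def \<kk>_def \<pp>_def proj flip: scaleR_2)

lemma kproj_pproj: "X \<in> \<gg> \<Longrightarrow> kproj X + pproj X = X"
  by (simp add: kproj_def pproj_def k_part_p_part proj)

text \<open>\<open>em (minus_part (cplx X Y))\<close> is the \<open>\<pp>\<^sup>-\<close>-part of \<open>cplx X Y\<close>: for \<open>X, Y \<in> \<pp>\<close> the equation
  \<open>cplx X Y = ep U + em V\<close> has the solution \<open>U = (X + J Y)/2\<close>, \<open>V = (X - J Y)/2\<close>.\<close>

definition minus_part :: "'n cmat \<Rightarrow> 'n rmat" where
  "minus_part Z = (1/2) *\<^sub>R (pproj (re_mat Z) - J (pproj (im_mat Z)))"

definition pr :: "'n cmat \<Rightarrow> 'n cmat" where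
  "pr Z = em (minus_part Z)"

lemma minus_part_mem: "minus_part Z \<in> \<pp>"
  unfolding minus_part_def by (intro p_scaleR p_diff J_mem pproj_mem)

lemma pr_linear: "complex_linear pr"
proof (rule complex_linearI)
  fix X Y r
  have "minus_part (X + Y) = minus_part X + minus_part Y"
    by (simp add: minus_part_def re_add im_add pproj_add J_add pproj_mem algebra_simps)
  then show "pr (X + Y) = pr X + pr Y"
    by (simp add: pr_def em_add minus_part_mem)
  have "minus_part (r *\<^sub>R X) = r *\<^sub>R minus_part X"
    by (simp add: minus_part_def re_scaleR im_scaleR pproj_scaleR J_scaleR pproj_mem algebra_simps)
  then show "pr (r *\<^sub>R X) = r *\<^sub>R pr X"
    by (simp add: pr_def em_def J_scaleR minus_part_mem cplx_scaleR)
  have JS: "J (minus_part X) = (1/2) *\<^sub>R (J (pproj (re_mat X)) + pproj (im_mat X))"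
  proof -
    have "J (minus_part X) = (1/2) *\<^sub>R J (pproj (re_mat X) - J (pproj (im_mat X)))"
      unfolding minus_part_def by (rule J_scaleR) (intro p_diff J_mem pproj_mem)
    also have "J (pproj (re_mat X) - J (pproj (im_mat X))) = J (pproj (re_mat X)) - J (J (pproj (im_mat X)))"
      by (rule J_diff) (intro J_mem pproj_mem)+
    also have "J (J (pproj (im_mat X))) = - pproj (im_mat X)"
      by (rule J_J[OF pproj_mem])
    finally show ?thesis by simp
  qed
  have "minus_part (scale_mat \<i> X) = - J (minus_part X)"
    unfolding JS unfolding minus_part_def by (simp add: re_ii im_ii pproj_minus algebra_simps)
  then show "pr (scale_mat \<i> X) = scale_mat \<i> (pr X)"
    by (simp add: pr_def em_def cplx_scale J_minus J_J J_mem minus_part_mem)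
qed

lemma pr_mem: "pr Z \<in> \<pp>minus"
  unfolding pr_def pminus_eq using minus_part_mem by blast

lemma pr_em: "X \<in> \<pp> \<Longrightarrow> pr (em X) = em X"
  by (simp add: pr_def minus_part_def em_def pproj_p J_mem J_J flip: scaleR_2)

lemma pr_ep: "X \<in> \<pp> \<Longrightarrow> pr (ep X) = 0"
  by (simp add: pr_def minus_part_def ep_def pproj_p pproj_minus J_minus J_mem J_J em_zero[unfolded em_def] em_def J_zero cplx_zero)

lemma pr_k: "A \<in> \<kk> \<Longrightarrow> B \<in> \<kk> \<Longrightarrow> pr (cplx A B) = 0"
  by (simp add: pr_def minus_part_def pproj_k J_zero em_zero)

text \<open>The extension of \<open>T\<close> by zero to \<open>\<pp>\<^sup>+\<close>, continued linearly to all matrices.\<close>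

definition \<sigma> :: "'n cmat \<Rightarrow> 'm cmat" where
  "\<sigma> Z = T (kproj (re_mat Z)) + scale_mat \<i> (T (kproj (im_mat Z)))"

lemma T_minus: "X \<in> \<kk> \<Longrightarrow> T (- X) = - T X"
  using T_scaleR[of X "-1"] by simp

lemma \<sigma>_linear: "complex_linear \<sigma>"
proof (rule complex_linearI)
  fix X Y r
  show "\<sigma> (X + Y) = \<sigma> X + \<sigma> Y"
    by (simp add: \<sigma>_def re_add im_add kproj_add T_add kproj_mem scale_mat_add)
  show "\<sigma> (r *\<^sub>R X) = r *\<^sub>R \<sigma> X"
    by (simp add: \<sigma>_def re_scaleR im_scaleR kproj_scaleR T_scaleR kproj_mem scaleR_add_right)
       (simp add: scale_mat_mult mult.commute flip: scale_mat_of_real)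
  show "\<sigma> (scale_mat \<i> X) = scale_mat \<i> (\<sigma> X)"
    by (simp add: \<sigma>_def re_ii im_ii kproj_minus T_minus kproj_mem scale_mat_add scale_mat_mult scale_mat_neg_one)
qed

lemma \<sigma>_ep: "X \<in> \<pp> \<Longrightarrow> \<sigma> (ep X) = 0"
  by (simp add: \<sigma>_def ep_def kproj_p kproj_minus J_mem T_zero)

lemma \<sigma>_k: "A \<in> \<kk> \<Longrightarrow> B \<in> \<kk> \<Longrightarrow> \<sigma> (cplx A B) = T A + scale_mat \<i> (T B)"
  by (simp add: \<sigma>_def kproj_k)

lemma \<sigma>_k_brk:
  assumes "A \<in> \<kk>" "B \<in> \<kk>" "A' \<in> \<kk>" "B' \<in> \<kk>"
  shows "\<sigma> (brk (cplx A B) (cplx A' B')) = brk (\<sigma> (cplx A B)) (\<sigma> (cplx A' B'))"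
proof -
  have "T (brk A A' - brk B B') = T (brk A A') - T (brk B B')"
    using T_add[of "brk A A'" "- brk B B'"] T_minus[of "brk B B'"] assms 
    by (simp add: brk_kk subspace_neg[OF subspace_k])
  then show ?thesis
    using assms
    by (simp add: brk_cplx \<sigma>_k brk_kk k_add k_diff T_add T_brk brk_add_left brk_add_right
       brk_scale_left brk_scale_right scale_mat_add scale_mat_mult scale_mat_neg_one algebra_simps)
qed

definition "\<qq> = {Y + X | Y X. Y \<in> complexify \<kk> \<and> X \<in> \<pp>plus}"

lemma q_cases:
  assumes "Z \<in> \<qq>"
  obtains A B X where "A \<in> \<kk>" "B \<in> \<kk>" "X \<in> \<pp>" "Z = cplx A B + ep X"
  using assms unfolding \<qq>_def complexify_eq pplus_eq by blast

lemma g_cases: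
  assumes "Z \<in> \<gg>C"
  obtains A B X Y where "A \<in> \<kk>" "B \<in> \<kk>" "X \<in> \<pp>" "Y \<in> \<pp>" "Z = cplx A B + ep X + em Y"
proof -
  obtain U V where UV: "U \<in> \<gg>" "V \<in> \<gg>" "Z = cplx U V" using assms unfolding \<gg>C_def complexify_eq by blast
  define X where "X = (1/2) *\<^sub>R (pproj U + J (pproj V))"
  define Y where "Y = (1/2) *\<^sub>R (pproj U - J (pproj V))"
  have mem: "X \<in> \<pp>" "Y \<in> \<pp>"
    unfolding X_def Y_def by (intro p_scaleR p_add p_diff J_mem pproj_mem)+
  have XY: "X + Y = pproj U" unfolding X_def Y_def by (simp flip: scaleR_add_right scaleR_2)
  have "J X = (1/2) *\<^sub>R (J (pproj U) - pproj V)" "J Y = (1/2) *\<^sub>R (J (pproj U) + pproj V)"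
    unfolding X_def Y_def by (simp_all add: J_scaleR J_add J_diff J_J J_mem p_add p_diff pproj_mem)
  then have "- J X + J Y = pproj V"
    by (simp add: scaleR_diff_right scaleR_add_right flip: scaleR_add_left)
  then have "ep X + em Y = cplx (pproj U) (pproj V)"
    by (simp add: ep_def em_def cplx_add XY)
  then have "Z = cplx (kproj U) (kproj V) + ep X + em Y"
    using kproj_pproj[OF UV(1)] kproj_pproj[OF UV(2)] UV(3) by (simp add: add.assoc cplx_add)
  then show ?thesis using that mem kproj_mem by blast
qed

lemma k_gC: "A \<in> \<kk> \<Longrightarrow> B \<in> \<kk> \<Longrightarrow> cplx A B \<in> \<gg>C"
  and ep_gC: "X \<in> \<pp> \<Longrightarrow> ep X \<in> \<gg>C" and em_gC: "X \<in> \<pp> \<Longrightarrow> em X \<in> \<gg>C"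
  by (simp_all add: \<gg>C_def cplx_mem_complexify k_g p_g ep_def em_def g_minus J_mem)

lemma gC_add: "Z \<in> \<gg>C \<Longrightarrow> Z' \<in> \<gg>C \<Longrightarrow> Z + Z' \<in> \<gg>C"
  unfolding \<gg>C_def complexify_eq using g_add by (force simp: cplx_add)

lemma gC_scale: "Z \<in> \<gg>C \<Longrightarrow> scale_mat c Z \<in> \<gg>C"
  unfolding \<gg>C_def complexify_eq using g_add g_diff g_scaleR by (force simp: cplx_scale)

lemma gC_brk: "Z \<in> \<gg>C \<Longrightarrow> Z' \<in> \<gg>C \<Longrightarrow> brk Z Z' \<in> \<gg>C"
  unfolding \<gg>C_def complexify_eq using g_add g_diff brk_mem by (force simp: brk_cplx)

lemma q_eq: "\<qq> = {Z \<in> \<gg>C. pr Z = 0}"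
proof (intro equalityI subsetI)
  fix Z assume "Z \<in> \<qq>"
  then show "Z \<in> {Z \<in> \<gg>C. pr Z = 0}"
    by (elim q_cases) (simp add: gC_add k_gC ep_gC complex_linear_add[OF pr_linear] pr_k pr_ep)
next
  fix Z assume Z: "Z \<in> {Z \<in> \<gg>C. pr Z = 0}"
  then obtain A B X Y where *: "A \<in> \<kk>" "B \<in> \<kk>" "X \<in> \<pp>" "Y \<in> \<pp>" "Z = cplx A B + ep X + em Y"
    using g_cases[of Z] by blast
  then have "em Y = 0"
    using Z by (simp add: complex_linear_add[OF pr_linear] pr_k pr_ep pr_em)
  then show "Z \<in> \<qq>"
    using * unfolding \<qq>_def pplus_eq
    by (intro CollectI exI[of _ "cplx A B"] exI[of _ "ep X"]) (simp add: cplx_mem_complexify)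
qed

lemma \<sigma>_brk:
  assumes "Z \<in> \<qq>" "Z' \<in> \<qq>"
  shows "pr (brk Z Z') = 0" "\<sigma> (brk Z Z') = brk (\<sigma> Z) (\<sigma> Z')"
proof -
  obtain A B X where 1: "A \<in> \<kk>" "B \<in> \<kk>" "X \<in> \<pp>" "Z = cplx A B + ep X" using q_cases assms(1) by blast
  obtain A' B' X' where 2: "A' \<in> \<kk>" "B' \<in> \<kk>" "X' \<in> \<pp>" "Z' = cplx A' B' + ep X'" using q_cases assms(2) by blast
  define U where "U = brk A X' + brk B (J X')"
  define V where "V = - (brk A' X + brk B' (J X))"
  have UV: "U \<in> \<pp>" "V \<in> \<pp>"
    unfolding U_def V_def by (intro p_minus_mem p_add brk_kp J_mem 1 2)+
  have "brk (cplx A B) (ep X') = ep U"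
    unfolding U_def by (rule brk_k_ep) (use 1 2 in auto)
  moreover have "brk (ep X) (cplx A' B') = ep V"
    unfolding V_def brk_antisym[of "ep X"] using 1 2
    by (subst ep_minus[symmetric]) (auto simp: brk_k_ep intro!: p_add brk_kp J_mem)
  ultimately have eq: "brk Z Z' = brk (cplx A B) (cplx A' B') + (ep U + ep V)"
    unfolding 1(4) 2(4) brk_add_left brk_add_right using brk_ep_ep 1 2 by simp
  have k: "brk (cplx A B) (cplx A' B') = cplx (brk A A' - brk B B') (brk A B' + brk B A')"
    by (rule brk_cplx)
  show "pr (brk Z Z') = 0"
    unfolding eq k complex_linear_add[OF pr_linear] using 1 2 UV
    by (simp add: pr_k pr_ep k_add k_diff brk_kk)
  have "\<sigma> (brk Z Z') = \<sigma> (brk (cplx A B) (cplx A' B'))"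
    unfolding eq complex_linear_add[OF \<sigma>_linear] using UV by (simp add: \<sigma>_ep)
  then show "\<sigma> (brk Z Z') = brk (\<sigma> Z) (\<sigma> Z')"
    using 1 2 \<sigma>_k_brk by (simp add: complex_linear_add[OF \<sigma>_linear] \<sigma>_ep)
qed

lemma brk_brk_em:
  assumes "X \<in> \<pp>" "Z \<in> \<gg>C"
  shows "brk (em X) (brk (em X) Z) \<in> \<pp>minus"
proof -
  obtain A B U V where *: "A \<in> \<kk>" "B \<in> \<kk>" "U \<in> \<pp>" "V \<in> \<pp>" "Z = cplx A B + ep U + em V"
    using g_cases[OF assms(2)] by blast
  have k: "brk (em X) (cplx A B) = em (- (brk A X - brk B (J X)))" if "A \<in> \<kk>" "B \<in> \<kk>" for A B
    unfolding brk_antisym[of "em X"] using that assms(1)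
    by (subst em_minus[symmetric]) (auto simp: brk_k_em intro!: p_diff brk_kp J_mem)
  have mem: "- (brk A X - brk B (J X)) \<in> \<pp>" if "A \<in> \<kk>" "B \<in> \<kk>" for A B
    using that assms(1) by (intro p_minus_mem p_diff brk_kp J_mem)
  have e: "brk (em X) (ep U) = cplx (- (2 *\<^sub>R brk U X)) (- (2 *\<^sub>R brk U (J X)))"
    unfolding brk_antisym[of "em X"] brk_ep_em[OF *(3) assms(1)] cplx_minus ..
  have km: "- (2 *\<^sub>R brk U X) \<in> \<kk>" "- (2 *\<^sub>R brk U (J X)) \<in> \<kk>"
    using * assms(1) by (auto intro!: subspace_neg[OF subspace_k] k_scaleR brk_pp J_mem)
  have "brk (em X) (brk (em X) Z) = brk (em X) (em (- (brk A X - brk B (J X)))) + brk (em X) (cplx (- (2 *\<^sub>R brk U X)) (- (2 *\<^sub>R brk U (J X)))) + 0"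
    unfolding *(5) brk_add_right e k[OF *(1,2)] brk_em_em[OF assms(1) *(4)] by simp
  also have "\<dots> = brk (em X) (cplx (- (2 *\<^sub>R brk U X)) (- (2 *\<^sub>R brk U (J X))))"
    using brk_em_em[OF assms(1) mem[OF *(1,2)]] by simp
  also have "\<dots> \<in> \<pp>minus"
    unfolding k[OF km] pminus_eq using mem[OF km] by blast
  finally show ?thesis .
qed

sublocale cx: abelian_complement \<gg>C \<pp>minus pr \<sigma>
proof
  show "X + Y \<in> \<gg>C" if "X \<in> \<gg>C" "Y \<in> \<gg>C" for X Y using that by (rule gC_add)
  show "scale_mat c X \<in> \<gg>C" if "X \<in> \<gg>C" for c X using that by (rule gC_scale)
  show "brk X Y \<in> \<gg>C" if "X \<in> \<gg>C" "Y \<in> \<gg>C" for X Y using that by (rule gC_brk)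
  show "\<pp>minus \<subseteq> \<gg>C" unfolding pminus_eq using em_gC by blast
  show "brk X Y = 0" if "X \<in> \<pp>minus" "Y \<in> \<pp>minus" for X Y
    using that brk_em_em unfolding pminus_eq by blast
  show "brk X (brk X A) \<in> \<pp>minus" if "X \<in> \<pp>minus" "A \<in> \<gg>C" for X A
    using that brk_brk_em unfolding pminus_eq[THEN arg_cong[where f = "\<lambda>S. X \<in> S"]] by blast
  show "complex_linear pr" by (rule pr_linear)
  show "pr X \<in> \<pp>minus" for X by (rule pr_mem)
  show "pr X = X" if "X \<in> \<pp>minus" for X
    using that pr_em unfolding pminus_eq by blast
  show "complex_linear \<sigma>" by (rule \<sigma>_linear)
  show "pr (brk X Y) = 0" if "X \<in> \<gg>C" "Y \<in> \<gg>C" "pr X = 0" "pr Y = 0" for X Y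
    by (rule \<sigma>_brk) (use that q_eq in auto)
  show "\<sigma> (brk X Y) = brk (\<sigma> X) (\<sigma> Y)" if "X \<in> \<gg>C" "Y \<in> \<gg>C" "pr X = 0" "pr Y = 0" for X Y
    by (rule \<sigma>_brk) (use that q_eq in auto)
qed

definition "\<rho> Z = complexify_map T (THE Y. Y \<in> complexify \<kk> \<and> Z - Y \<in> \<pp>plus)"

lemma \<rho>_eq:
  assumes "Z \<in> \<qq>"
  shows "\<rho> Z = \<sigma> Z"
proof -
  obtain A B X where Z: "A \<in> \<kk>" "B \<in> \<kk>" "X \<in> \<pp>" "Z = cplx A B + ep X" using q_cases assms by blast
  have "(THE Y. Y \<in> complexify \<kk> \<and> Z - Y \<in> \<pp>plus) = cplx A B"
  proof (rule the_equality)
    show "cplx A B \<in> complexify \<kk> \<and> Z - cplx A B \<in> \<pp>plus"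
      using Z by (simp add: cplx_mem_complexify pplus_eq)
  next
    fix Y assume Y: "Y \<in> complexify \<kk> \<and> Z - Y \<in> \<pp>plus"
    then obtain A' B' X' where Y': "A' \<in> \<kk>" "B' \<in> \<kk>" "X' \<in> \<pp>" "Y = cplx A' B'" "Z - Y = ep X'"
      unfolding complexify_eq pplus_eq by blast
    have "Z = cplx A' B' + ep X'" using Y'(4,5) by (simp add: algebra_simps)
    then have "A + X = A' + X'" "B - J X = B' - J X'"
      unfolding Z(4) by (simp_all add: ep_def cplx_add)
    then have "A - A' = X' - X" "B - B' = J X - J X'"
      by (simp_all add: algebra_simps)
    then have "A - A' \<in> \<pp>" "B - B' \<in> \<pp>"
      using p_diff[OF Y'(3) Z(3)] p_diff[OF J_mem[OF Z(3)] J_mem[OF Y'(3)]] by simp_all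
    then have "A - A' = 0" "B - B' = 0"
      using k_p_zero k_diff[OF Z(1) Y'(1)] k_diff[OF Z(2) Y'(2)] by blast+
    then show "Y = cplx A B" using Y'(4) by simp
  qed
  then show ?thesis
    unfolding \<rho>_def Z(4) complex_linear_add[OF \<sigma>_linear]
    using Z by (simp add: complexify_map_eq \<sigma>_k \<sigma>_ep)
qed

definition "ap = \<pp>plus \<inter> complexify \<hh>"
definition "am = \<pp>minus \<inter> complexify \<hh>"
definition "bp = \<pp>plus \<inter> complexify \<hh>\<^sub>0"
definition "bm = \<pp>minus \<inter> complexify \<hh>\<^sub>0"
definition "\<ll>C = complexify (\<kk> \<inter> \<hh>)"

definition "\<aa> = {X \<in> \<pp>. s X = X}"
definition "\<bb> = {X \<in> \<pp>. s X = - X}"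

lemma a_p: "X \<in> \<aa> \<Longrightarrow> X \<in> \<pp>" and b_p: "X \<in> \<bb> \<Longrightarrow> X \<in> \<pp>"
  by (simp_all add: \<aa>_def \<bb>_def)

lemma J_a: "X \<in> \<aa> \<Longrightarrow> J X \<in> \<aa>" and J_b: "X \<in> \<bb> \<Longrightarrow> J X \<in> \<bb>"
  by (simp_all add: \<aa>_def \<bb>_def J_mem J_fixed J_skew_fixed)

lemma p_h: "X \<in> \<pp> \<Longrightarrow> X \<in> \<hh> \<longleftrightarrow> X \<in> \<aa>"
  by (auto simp: \<hh>_def \<aa>_def p_g)

lemma p_h0: "X \<in> \<pp> \<Longrightarrow> X \<in> \<hh>\<^sub>0 \<longleftrightarrow> X \<in> \<bb>"
  using s_minus[of X] minus_equation_iff[of "s X" X] by (auto simp: \<hh>\<^sub>0_def \<bb>_def \<pp>_def)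

lemma a_add: "X \<in> \<aa> \<Longrightarrow> Y \<in> \<aa> \<Longrightarrow> X + Y \<in> \<aa>" and a_minus: "X \<in> \<aa> \<Longrightarrow> - X \<in> \<aa>"
  and b_add: "X \<in> \<bb> \<Longrightarrow> Y \<in> \<bb> \<Longrightarrow> X + Y \<in> \<bb>" and b_minus: "X \<in> \<bb> \<Longrightarrow> - X \<in> \<bb>"
  and b_scaleR: "X \<in> \<bb> \<Longrightarrow> c *\<^sub>R X \<in> \<bb>" 
  by (simp_all add: \<aa>_def \<bb>_def p_add p_scaleR p_minus_mem s_add s_minus s_scaleR p_g)

lemma b_diff: "X \<in> \<bb> \<Longrightarrow> Y \<in> \<bb> \<Longrightarrow> X - Y \<in> \<bb>"
  using b_add[of X "- Y"] b_minus[of Y] by simp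

lemma ap_eq: "ap = ep ` \<aa>"
  unfolding ap_def pplus_eq using a_p p_h a_minus J_a
  by (auto simp: cplx_mem_complexify ep_def p_h J_mem p_minus_mem)

lemma am_eq: "am = em ` \<aa>"
  unfolding am_def pminus_eq using a_p p_h J_a
  by (auto simp: cplx_mem_complexify em_def p_h J_mem)

lemma bp_eq: "bp = ep ` \<bb>"
  unfolding bp_def pplus_eq using b_p p_h0 b_minus J_b
  by (auto simp: cplx_mem_complexify ep_def p_h0 J_mem p_minus_mem)

lemma bm_eq: "bm = em ` \<bb>"
  unfolding bm_def pminus_eq using b_p p_h0 J_b
  by (auto simp: cplx_mem_complexify em_def p_h0 J_mem)

lemma a_b_decomposition:
  assumes "X \<in> \<pp>"
  shows "\<exists>A\<in>\<aa>. \<exists>B\<in>\<bb>. X = A + B"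
proof -
  have sX: "s X \<in> \<pp>"
    using assms s_\<theta>[of X] s_mem[of X] s_minus[of X] by (simp add: \<pp>_def)
  have g: "X \<in> \<gg>" "s X \<in> \<gg>" using assms sX p_g by auto
  have "(1/2) *\<^sub>R (X + s X) \<in> \<aa>"
    using assms sX g by (simp add: \<aa>_def p_scaleR p_add s_scaleR s_add s_s g_add add.commute)
  moreover have "(1/2) *\<^sub>R (X - s X) \<in> \<bb>"
    using assms sX g by (simp add: \<bb>_def p_scaleR p_diff s_scaleR s_diff s_s g_diff flip: scaleR_minus_right)
  moreover have "X = (1/2) *\<^sub>R (X + s X) + (1/2) *\<^sub>R (X - s X)"
    by (simp flip: scaleR_add_right scaleR_2)
  ultimately show ?thesis by blast
qed

lemma h0_decomposition:
  assumes "Z \<in> complexify \<hh>\<^sub>0"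
  shows "\<exists>C\<in>\<ll>C. \<exists>B\<in>bp. \<exists>B'\<in>bm. Z = C + (B + B')"
proof -
  obtain X Y where Z: "X \<in> \<hh>\<^sub>0" "Y \<in> \<hh>\<^sub>0" "Z = cplx X Y" using assms unfolding complexify_eq by blast
  have parts: "k_part X \<in> \<kk> \<inter> \<hh>" "p_part X \<in> \<bb>" if "X \<in> \<hh>\<^sub>0" for X
  proof -
    have X: "X \<in> \<gg>" "s (\<theta> X) = X" using that by (simp_all add: \<hh>\<^sub>0_def)
    have sX: "s X = \<theta> X" using s_s[OF \<theta>_mem[OF X(1)]] X(2) by simp
    have "s (k_part X) = k_part X" "s (p_part X) = - p_part X"
      using X sX by (simp_all add: k_part_def p_part_def s_scaleR s_add s_diff g_add g_diff \<theta>_mem add.commute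
          flip: scaleR_minus_right)
    then show "k_part X \<in> \<kk> \<inter> \<hh>" "p_part X \<in> \<bb>"
      using k_part[OF X(1)] p_part[OF X(1)] k_g by (simp_all add: \<hh>_def \<bb>_def)
  qed
  define x y where "x = p_part X" and "y = p_part Y"
  have xy: "x \<in> \<bb>" "y \<in> \<bb>" using parts Z by (simp_all add: x_def y_def)
  define U V where "U = (1/2) *\<^sub>R (x + J y)" and "V = (1/2) *\<^sub>R (x - J y)"
  have UV: "U \<in> \<bb>" "V \<in> \<bb>"
    unfolding U_def V_def by (intro b_scaleR b_add b_diff J_b xy)+
  have sum: "U + V = x" unfolding U_def V_def by (simp flip: scaleR_add_right scaleR_2)
  have p: "x \<in> \<pp>" "y \<in> \<pp>" using xy b_p by auto
  have "J U = (1/2) *\<^sub>R (J x - y)" "J V = (1/2) *\<^sub>R (J x + y)"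
    unfolding U_def V_def by (simp_all add: J_scaleR J_add J_diff J_J J_mem p_add p_diff p)
  then have "- J U + J V = y"
    by (simp add: scaleR_diff_right scaleR_add_right flip: scaleR_add_left)
  then have "ep U + em V = cplx x y"
    by (simp add: ep_def em_def cplx_add sum)
  then have "Z = cplx (k_part X) (k_part Y) + (ep U + em V)"
    unfolding Z(3) x_def y_def using k_part_p_part by (simp add: cplx_add)
  moreover have "cplx (k_part X) (k_part Y) \<in> \<ll>C"
    unfolding \<ll>C_def cplx_mem_complexify using parts Z by blast
  ultimately show ?thesis
    using UV unfolding bp_eq bm_eq by blast
qed

sublocale md: symmetric_pair_module \<gg>C \<pp>minus pr \<sigma> \<qq> "complexify \<hh>\<^sub>0" \<ll>C ap am bp bm \<rho>
proof
  show "\<qq> = {Z \<in> \<gg>C. pr Z = 0}" by (rule q_eq)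
  show "\<rho> Z = \<sigma> Z" if "Z \<in> \<qq>" for Z using that by (rule \<rho>_eq)
  have q_ep: "ep X \<in> \<qq>" if "X \<in> \<pp>" for X
    unfolding q_eq using that by (simp add: ep_gC pr_ep)
  show "ap \<subseteq> \<qq>"
    unfolding ap_eq using q_ep a_p by blast
  show "\<rho> X = 0" if "X \<in> ap" for X
    using that \<rho>_eq q_ep \<sigma>_ep a_p unfolding ap_eq by auto
  show "am \<subseteq> \<pp>minus" "bm \<subseteq> \<pp>minus" by (auto simp: am_def bm_def)
  show "\<exists>A\<in>am. \<exists>B\<in>bm. Y = A + B" if Y: "Y \<in> \<pp>minus" for Y
  proof -
    obtain X where X: "X \<in> \<pp>" "Y = em X" using Y unfolding pminus_eq by blast
    obtain A B where AB: "A \<in> \<aa>" "B \<in> \<bb>" "X = A + B" using a_b_decomposition[OF X(1)] by blast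
    have "Y = em A + em B" unfolding X(2) AB(3) by (rule em_add[OF a_p[OF AB(1)] b_p[OF AB(2)]])
    then show ?thesis using AB unfolding am_eq bm_eq by blast
  qed
  show "complexify \<hh>\<^sub>0 \<subseteq> \<gg>C" unfolding \<gg>C_def complexify_eq \<hh>\<^sub>0_def by blast
  show "bm \<subseteq> complexify \<hh>\<^sub>0" by (auto simp: bm_def)
  show "\<ll>C \<subseteq> \<gg>C" unfolding \<gg>C_def \<ll>C_def complexify_eq using k_g by blast
  show "bp \<subseteq> \<gg>C" unfolding bp_eq using ep_gC b_p by blast
  show "\<exists>C\<in>\<ll>C. \<exists>B\<in>bp. \<exists>B'\<in>bm. Z = C + (B + B')" if "Z \<in> complexify \<hh>\<^sub>0" for Z
    using that by (rule h0_decomposition)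
  show "brk X C \<in> ap" if XC: "X \<in> ap" "C \<in> \<ll>C" for X C
  proof -
    obtain U A B where *: "U \<in> \<aa>" "X = ep U" "A \<in> \<kk> \<inter> \<hh>" "B \<in> \<kk> \<inter> \<hh>" "C = cplx A B"
      using XC unfolding ap_eq \<ll>C_def complexify_eq by blast
    have U: "U \<in> \<pp>" using * a_p by blast
    have "s (brk A V) = brk A V" if "A \<in> \<kk> \<inter> \<hh>" "V \<in> \<aa>" for A V
      using that s_brk[of A V] p_g by (simp add: \<aa>_def \<hh>_def)
    then have br: "brk A V \<in> \<aa>" if "A \<in> \<kk> \<inter> \<hh>" "V \<in> \<aa>" for A V
      using that brk_kp by (simp add: \<aa>_def)
    have W: "brk A U + brk B (J U) \<in> \<aa>" using * br J_a a_add by auto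
    have "brk X C = - ep (brk A U + brk B (J U))"
      unfolding *(2,5) brk_antisym[of "ep U"] using * U by (simp add: brk_k_ep)
    also have "\<dots> = ep (- (brk A U + brk B (J U)))"
      by (rule ep_minus[OF a_p[OF W]])
    finally show ?thesis
      unfolding ap_eq using a_minus[OF W] by blast
  qed
  show "brk X C \<in> bm" if XC: "X \<in> bm" "C \<in> \<ll>C" for X C
  proof -
    obtain U A B where *: "U \<in> \<bb>" "X = em U" "A \<in> \<kk> \<inter> \<hh>" "B \<in> \<kk> \<inter> \<hh>" "C = cplx A B"
      using XC unfolding bm_eq \<ll>C_def complexify_eq by blast
    have U: "U \<in> \<pp>" using * b_p by blast
    have "s (brk A V) = - brk A V" if "A \<in> \<kk> \<inter> \<hh>" "V \<in> \<bb>" for A V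
      using that s_brk[of A V] p_g by (simp add: \<bb>_def \<hh>_def brk_minus_right)
    then have br: "brk A V \<in> \<bb>" if "A \<in> \<kk> \<inter> \<hh>" "V \<in> \<bb>" for A V
      using that brk_kp by (simp add: \<bb>_def)
    have W: "brk A U - brk B (J U) \<in> \<bb>" using * br J_b b_diff by auto
    have "brk X C = - em (brk A U - brk B (J U))"
      unfolding *(2,5) brk_antisym[of "em U"] using * U by (simp add: brk_k_em)
    also have "\<dots> = em (- (brk A U - brk B (J U)))"
      by (rule em_minus[OF b_p[OF W]])
    finally show ?thesis
      unfolding bm_eq using b_minus[OF W] by blast
  qed
  show "brk X B = 0" if "X \<in> ap" "B \<in> bp" for X B
    using that brk_ep_ep a_p b_p unfolding ap_eq bp_eq by blast
  show "brk Y B \<in> \<ll>C" if YB: "Y \<in> bm" "B \<in> bp" for Y B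
  proof -
    obtain U V where *: "U \<in> \<bb>" "Y = em U" "V \<in> \<bb>" "B = ep V" using YB unfolding bm_eq bp_eq by blast
    have l: "- (2 *\<^sub>R brk V W) \<in> \<kk> \<inter> \<hh>" if "V \<in> \<bb>" "W \<in> \<bb>" for V W
    proof -
      have g: "brk V W \<in> \<kk>" using that brk_pp b_p by blast
      have "s (brk V W) = brk V W"
        using that s_brk[of V W] p_g by (simp add: \<bb>_def brk_minus_left brk_minus_right)
      then show ?thesis
        using g k_g[OF g] by (simp add: \<hh>_def subspace_neg[OF subspace_k] k_scaleR g_minus g_scaleR s_minus s_scaleR)
    qed
    have "brk Y B = cplx (- (2 *\<^sub>R brk V U)) (- (2 *\<^sub>R brk V (J U)))"
      unfolding *(2,4) brk_antisym[of "em U"] brk_ep_em[OF b_p[OF *(3)] b_p[OF *(1)]] cplx_minus ..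
    then show ?thesis
      unfolding \<ll>C_def using l[OF *(3,1)] l[OF *(3) J_b[OF *(1)]] by (simp add: cplx_mem_complexify)
  qed
  show "brk (brk X Y) Y' \<in> \<pp>minus" if XY: "X \<in> ap" "Y \<in> bm" "Y' \<in> bm" for X Y Y'
  proof -
    obtain U V V' where *: "U \<in> \<pp>" "X = ep U" "V \<in> \<pp>" "Y = em V" "V' \<in> \<pp>" "Y' = em V'"
      using XY a_p b_p unfolding ap_eq bm_eq by blast
    have k: "2 *\<^sub>R brk U V \<in> \<kk>" "2 *\<^sub>R brk U (J V) \<in> \<kk>"
      using * by (auto intro!: k_scaleR brk_pp J_mem)
    show ?thesis
      unfolding *(2,4,6) brk_ep_em[OF *(1,3)] brk_k_em[OF k *(5)] pminus_eq
      by (intro imageI p_diff brk_kp k J_mem *)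
  qed
  show "0 \<in> \<pp>minus" unfolding pminus_eq using em_zero p_zero by (metis imageI)
qed

lemma conj_ep: "X \<in> \<pp> \<Longrightarrow> conj_mat (ep X) = em X" and conj_em: "X \<in> \<pp> \<Longrightarrow> conj_mat (em X) = ep X"
  by (simp_all add: ep_def em_def)

lemma brk_space_zero_iff: "brk_space A B = {0} \<longleftrightarrow> (\<forall>X\<in>A. \<forall>Y\<in>B. brk X Y = 0)"
proof -
  define S where "S = {brk X Y | X Y. X \<in> A \<and> Y \<in> B}"
  have "span S = {0} \<longleftrightarrow> S \<subseteq> {0}"
    using span_base span_mono[of S "{0}"] span_zero by fastforce
  then show ?thesis
    unfolding brk_space_def S_def by blast
qed

text \<open>Conjugation exchanges \<open>ap\<close> with \<open>am\<close> and \<open>bp\<close> with \<open>bm\<close>.\<close>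

lemma triple_brackets_iff:
  "(\<forall>X\<in>ap. \<forall>Y\<in>bm. \<forall>Y'\<in>bm. brk (brk X Y) Y' = 0) \<longleftrightarrow> brk_space (brk_space bp am) bp = {0}"
proof -
  have "(\<forall>X\<in>ap. \<forall>Y\<in>bm. \<forall>Y'\<in>bm. brk (brk X Y) Y' = 0) \<longleftrightarrow>
      (\<forall>X\<in>\<aa>. \<forall>Y\<in>\<bb>. \<forall>Y'\<in>\<bb>. brk (brk (ep X) (em Y)) (em Y') = 0)"
    unfolding ap_eq bm_eq by simp
  also have "\<dots> \<longleftrightarrow> (\<forall>X\<in>\<aa>. \<forall>Y\<in>\<bb>. \<forall>Y'\<in>\<bb>. brk (brk (ep Y) (em X)) (ep Y') = 0)"
  proof (intro ball_cong refl)
    fix X Y Y' assume "X \<in> \<aa>" "Y \<in> \<bb>" "Y' \<in> \<bb>"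
    then have "conj_mat (brk (brk (ep X) (em Y)) (em Y')) = - brk (brk (ep Y) (em X)) (ep Y')"
      using a_p b_p by (simp add: conj_brk conj_ep conj_em brk_antisym[of "em X" "ep Y"] brk_minus_left)
    then show "brk (brk (ep X) (em Y)) (em Y') = 0 \<longleftrightarrow> brk (brk (ep Y) (em X)) (ep Y') = 0"
      using conj_zero_iff[of "brk (brk (ep X) (em Y)) (em Y')"] by simp
  qed
  also have "\<dots> \<longleftrightarrow> (\<forall>Z\<in>brk_space bp am. \<forall>Y'\<in>bp. brk Z Y' = 0)"
  proof
    assume *: "\<forall>X\<in>\<aa>. \<forall>Y\<in>\<bb>. \<forall>Y'\<in>\<bb>. brk (brk (ep Y) (em X)) (ep Y') = 0"
    show "\<forall>Z\<in>brk_space bp am. \<forall>Y'\<in>bp. brk Z Y' = 0"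
    proof (intro ballI)
      fix Z Y' assume Z: "Z \<in> brk_space bp am" and Y': "Y' \<in> bp"
      have lin: "linear (\<lambda>Z. brk Z Y')"
        by (intro linearI) (simp_all add: brk_add_left brk_scaleR_left)
      show "brk Z Y' = 0"
        by (rule linear_eq_0_on_span[OF lin _ Z[unfolded brk_space_def]])
           (use * Y' in \<open>auto simp: bp_eq am_eq\<close>)
    qed
  next
    assume *: "\<forall>Z\<in>brk_space bp am. \<forall>Y'\<in>bp. brk Z Y' = 0"
    have "brk (ep Y) (em X) \<in> brk_space bp am" if "X \<in> \<aa>" "Y \<in> \<bb>" for X Y
      unfolding brk_space_def bp_eq am_eq using that by (intro span_base) blast
    then show "\<forall>X\<in>\<aa>. \<forall>Y\<in>\<bb>. \<forall>Y'\<in>\<bb>. brk (brk (ep Y) (em X)) (ep Y') = 0"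
      using * unfolding bp_eq by blast
  qed
  also have "\<dots> \<longleftrightarrow> brk_space (brk_space bp am) bp = {0}"
    by (rule brk_space_zero_iff[symmetric])
  finally show ?thesis .
qed

end

section \<open>Unitarity\<close>

lemma scaleC_ii_ii: "\<i> *\<^sub>C \<i> *\<^sub>C (x :: 'h::complex_hilbert) = - x"
proof -
  have "\<i> *\<^sub>C \<i> *\<^sub>C x = of_real (- 1) *\<^sub>C x" by (simp add: scaleC_scaleC)
  also have "\<dots> = - x" by (simp only: scaleC_of_real) simp
  finally show ?thesis .
qed

lemma scaleC_ii_minus: "\<i> *\<^sub>C (- x) = - (\<i> *\<^sub>C (x :: 'h::complex_hilbert))"
proof -
  have "\<i> *\<^sub>C (0 :: 'h) = 0"
    using scaleC_add_right[of \<i> "0 :: 'h" 0] by simp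
  then have "\<i> *\<^sub>C (- x) + \<i> *\<^sub>C x = 0"
    using scaleC_add_right[of \<i> "- x" x] by simp
  then show ?thesis
    by (simp only: eq_neg_iff_add_eq_0)
qed

lemma inner_scaleC_ii_left: "inner (\<i> *\<^sub>C x) y = - inner x (\<i> *\<^sub>C (y :: 'h::complex_hilbert))"
proof -
  have "inner (\<i> *\<^sub>C \<i> *\<^sub>C x) (\<i> *\<^sub>C y) = inner (\<i> *\<^sub>C x) y" by (rule inner_scaleC_ii)
  then show ?thesis by (simp add: scaleC_ii_ii)
qed

lemma unitary_inner:
  assumes "unitary_representation G \<pi>" "g \<in> G"
  shows "inner (\<pi> g u) (\<pi> g v) = inner u (v :: 'h::complex_hilbert)"
proof -
  have "cinner (\<pi> g u) (\<pi> g v) = cinner u v"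
    using assms unfolding unitary_representation_def by blast
  then have "Re (cinner (\<pi> g u) (\<pi> g v)) = Re (cinner u v)" by simp
  then show ?thesis by (simp add: cinner_def)
qed

lemma unitary_derivative_skew:
  fixes \<pi> :: "'n::finite rmat \<Rightarrow> 'h::complex_hilbert \<Rightarrow> 'h"
  assumes \<pi>: "unitary_representation G \<pi>" and X: "X \<in> lie_algebra G"
    and u: "((\<lambda>t. \<pi> (mexp (t *\<^sub>R X)) u) has_vector_derivative u') (at 0)"
    and v: "((\<lambda>t. \<pi> (mexp (t *\<^sub>R X)) v) has_vector_derivative v') (at 0)"
  shows "inner u' v = - inner u v'"
proof -
  have G: "mexp (t *\<^sub>R X) \<in> G" for t using X by (simp add: lie_algebra_def)
  have one: "\<pi> (mexp (0 *\<^sub>R X)) w = w" for w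
    using \<pi> by (simp add: unitary_representation_def)
  have "((\<lambda>t. inner (\<pi> (mexp (t *\<^sub>R X)) u) (\<pi> (mexp (t *\<^sub>R X)) v)) has_vector_derivative
      inner (\<pi> (mexp (0 *\<^sub>R X)) u) v' + inner u' (\<pi> (mexp (0 *\<^sub>R X)) v)) (at 0)"
    by (rule bounded_bilinear.has_vector_derivative[OF bounded_bilinear_inner u v])
  then have "((\<lambda>t. inner u v) has_vector_derivative inner u v' + inner u' v) (at 0)"
    unfolding unitary_inner[OF \<pi> G] one .
  moreover have "((\<lambda>t::real. inner u v) has_vector_derivative 0) (at 0)"
    by (rule has_vector_derivative_const)
  ultimately have "inner u v' + inner u' v = 0"
    by (rule vector_derivative_unique_at)
  then show ?thesis by simp
qed

text \<open>The real form \<open>\<gg>\<close> acts on the induced module by operators that are skew for the inner product pulled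
  back by an injective linear map \<open>\<Phi>\<close> into a Hilbert space.\<close>

locale unitary_hermitian_pair = hermitian_symmetric_pair \<gg> \<theta> J s T
  for \<gg> :: "'n::finite rmat set" and \<theta> J s and T :: "'n rmat \<Rightarrow> 'm::finite cmat" +
  fixes \<Phi> :: "('n, 'm) pretensor set \<Rightarrow> 'h::complex_hilbert"
  assumes \<Phi>_inj: "inj_on \<Phi> (ind_module \<gg>C \<qq> \<rho>)"
    and \<Phi>_add: "u \<in> ind_module \<gg>C \<qq> \<rho> \<Longrightarrow> v \<in> ind_module \<gg>C \<qq> \<rho> \<Longrightarrow>
      \<Phi> (ind_add \<gg>C \<qq> \<rho> u v) = \<Phi> u + \<Phi> v"
    and \<Phi>_scale: "v \<in> ind_module \<gg>C \<qq> \<rho> \<Longrightarrow> \<Phi> (ind_act \<gg>C \<qq> \<rho> (scalar c) v) = c *\<^sub>C \<Phi> v"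
    and \<Phi>_skew: "X \<in> \<gg> \<Longrightarrow> u \<in> ind_module \<gg>C \<qq> \<rho> \<Longrightarrow> v \<in> ind_module \<gg>C \<qq> \<rho> \<Longrightarrow>
      inner (\<Phi> (ind_act \<gg>C \<qq> \<rho> (letter (of_real_mat X)) u)) (\<Phi> v) =
      - inner (\<Phi> u) (\<Phi> (ind_act \<gg>C \<qq> \<rho> (letter (of_real_mat X)) v))"
begin

abbreviation "M \<equiv> ind_module \<gg>C \<qq> \<rho>"

text \<open>The general criterion applies once skewness over \<open>\<gg>\<close> is extended to complex combinations: the adjoint of
  \<open>X + iY\<close> is \<open>-(X - iY)\<close>.\<close>

theorem lowest_vectors_eq_orbit_iff:
  assumes "ind_layer \<gg>C \<qq> \<rho> \<pp>minus 1 \<inter> annihilated_vectors \<gg>C \<qq> \<rho> ap =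
      ind_layer \<gg>C \<qq> \<rho> \<pp>minus 1 \<inter> enveloping_orbit \<gg>C \<qq> \<rho> (complexify \<hh>\<^sub>0)"
  shows "annihilated_vectors \<gg>C \<qq> \<rho> ap = enveloping_orbit \<gg>C \<qq> \<rho> (complexify \<hh>\<^sub>0) \<longleftrightarrow>
    brk_space (brk_space bp am) bp = {0}"
proof -
  define \<Psi> where "\<Psi> = (\<lambda>f. \<Phi> (md.cls f))"
  have cls_mem: "md.cls f \<in> M" if "f \<in> md.P" for f
    using that unfolding md.ind_module_eq by blast
  have \<Psi>_add: "\<Psi> (f + f') = \<Psi> f + \<Psi> f'" if "f \<in> md.P" "f' \<in> md.P" for f f'
    unfolding \<Psi>_def md.ind_add_cls[OF that, symmetric] by (rule \<Phi>_add[OF cls_mem[OF that(1)] cls_mem[OF that(2)]])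
  have \<Psi>_scale: "\<Psi> (scalar c *s f) = c *\<^sub>C \<Psi> f" if "f \<in> md.P" for c f
    unfolding \<Psi>_def md.ind_act_cls[OF that free_algebra_scalar, symmetric] by (rule \<Phi>_scale[OF cls_mem[OF that]])
  have \<Psi>_cong: "\<Psi> f = \<Psi> f'"
    if "f - f' \<in> md.R" "f \<in> md.P" "f' \<in> md.P" for f f'
    unfolding \<Psi>_def using md.cls_eq_iff[OF that(2,3)] that(1) by simp
  have \<Psi>_zero: "\<Psi> 0 = 0"
    using \<Psi>_add[of 0 0] by simp
  have \<Psi>_zero_iff: "\<Psi> f = 0 \<longleftrightarrow> f \<in> md.R" if f: "f \<in> md.P" for f
  proof -
    have "\<Psi> f = 0 \<longleftrightarrow> \<Phi> (md.cls f) = \<Phi> (md.cls 0)"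
      using \<Psi>_zero by (simp add: \<Psi>_def)
    also have "\<dots> \<longleftrightarrow> md.cls f = md.cls 0"
      by (rule inj_on_eq_iff[OF \<Phi>_inj cls_mem[OF f] cls_mem[OF pretensor_space_zero]])
    also have "\<dots> \<longleftrightarrow> f \<in> md.R"
      using md.cls_eq_iff[OF f pretensor_space_zero] by simp
    finally show ?thesis .
  qed
  have real_mem: "cplx X 0 \<in> \<gg>C" if "X \<in> \<gg>" for X
    using that g_zero by (simp add: \<gg>C_def cplx_mem_complexify)
  have skew: "inner (\<Psi> (letter (cplx X 0) *s f)) (\<Psi> f') = - inner (\<Psi> f) (\<Psi> (letter (cplx X 0) *s f'))"
    if X: "X \<in> \<gg>" and f: "f \<in> md.P" "f' \<in> md.P" for X f f'
  proof -
    have oX: "of_real_mat X = cplx X 0"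
      by (simp add: cplx_def of_real_mat_def scale_mat_def vec_eq_iff)
    show ?thesis
      using \<Phi>_skew[OF X cls_mem[OF f(1)] cls_mem[OF f(2)]] free_algebra_letter[OF real_mem[OF X]]
      unfolding oX \<Psi>_def by (simp only: md.ind_act_cls[OF f(1)] md.ind_act_cls[OF f(2)])
  qed
  have act: "\<Psi> (letter (cplx X Y) *s f) = \<Psi> (letter (cplx X 0) *s f) + \<i> *\<^sub>C \<Psi> (letter (cplx Y 0) *s f)"
    if X: "X \<in> \<gg>" "Y \<in> \<gg>" and f: "f \<in> md.P" for X Y f
  proof -
    define x y where "x = cplx X 0" and "y = cplx Y 0"
    have g: "x \<in> \<gg>C" "y \<in> \<gg>C" unfolding x_def y_def using real_mem X by auto
    have z: "cplx X Y = scale_mat 1 x + scale_mat \<i> y"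
      by (simp add: x_def y_def cplx_scale cplx_add)
    have zg: "cplx X Y \<in> \<gg>C" using X by (simp add: \<gg>C_def cplx_mem_complexify)
    have P: "letter x *s f \<in> md.P" "scalar \<i> *s (letter y *s f) \<in> md.P"
      "letter (cplx X Y) *s f \<in> md.P" "letter y *s f \<in> md.P"
      using md.letter_P[OF g(1) f] md.letter_P[OF zg f] md.letter_P[OF g(2) f]
        pretensor_space_smult[OF free_algebra_scalar md.letter_P[OF g(2) f]] by blast+
    have "letter (cplx X Y) *s f - (letter x *s f + scalar \<i> *s (letter y *s f)) \<in> md.R"
      using md.letter_linear[OF g f, of 1 \<i>] unfolding z[symmetric] scalar_one smult_one .
    from \<Psi>_cong[OF this P(3) pretensor_space_add[OF P(1,2)]]
    show ?thesis
      unfolding \<Psi>_add[OF P(1,2)] \<Psi>_scale[OF P(4)] unfolding x_def y_def .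
  qed
  have adjoint: "inner (\<Psi> (letter (cplx X Y) *s f)) (\<Psi> f') = - inner (\<Psi> f) (\<Psi> (letter (cplx X (- Y)) *s f'))"
    if X: "X \<in> \<gg>" "Y \<in> \<gg>" and f: "f \<in> md.P" "f' \<in> md.P" for X Y f f'
  proof -
    have sf': "scalar \<i> *s f' \<in> md.P" by (rule pretensor_space_smult[OF free_algebra_scalar f(2)])
    have lf': "letter (cplx Y 0) *s f' \<in> md.P" by (rule md.letter_P[OF real_mem[OF X(2)] f(2)])
    have mY: "- Y \<in> \<gg>" by (rule g_minus[OF X(2)])
    have "letter (cplx (- Y) 0) *s f' + letter (cplx Y 0) *s f' \<in> md.R"
      using md.letter_minus[OF real_mem[OF X(2)] f(2)] by (simp add: cplx_minus)
    then have "\<Psi> (letter (cplx (- Y) 0) *s f' + letter (cplx Y 0) *s f') = 0"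
      using \<Psi>_zero_iff[OF pretensor_space_add[OF md.letter_P[OF real_mem[OF mY] f(2)] lf']] by simp
    then have neg: "\<Psi> (letter (cplx (- Y) 0) *s f') = - \<Psi> (letter (cplx Y 0) *s f')"
      using \<Psi>_add[OF md.letter_P[OF real_mem[OF mY] f(2)] lf'] by (simp add: eq_neg_iff_add_eq_0)
    have "inner (\<i> *\<^sub>C \<Psi> (letter (cplx Y 0) *s f)) (\<Psi> f') = - inner (\<Psi> (letter (cplx Y 0) *s f)) (\<Psi> (scalar \<i> *s f'))"
      unfolding inner_scaleC_ii_left \<Psi>_scale[OF f(2)] ..
    also have "\<dots> = inner (\<Psi> f) (\<Psi> (letter (cplx Y 0) *s (scalar \<i> *s f')))"
      unfolding skew[OF X(2) f(1) sf'] by simp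
    also have "\<dots> = inner (\<Psi> f) (\<i> *\<^sub>C \<Psi> (letter (cplx Y 0) *s f'))"
      unfolding smult_scalar_commute \<Psi>_scale[OF lf'] ..
    finally have "inner (\<i> *\<^sub>C \<Psi> (letter (cplx Y 0) *s f)) (\<Psi> f') = inner (\<Psi> f) (\<i> *\<^sub>C \<Psi> (letter (cplx Y 0) *s f'))" .
    then show ?thesis
      unfolding act[OF X f(1)] act[OF X(1) mY f(2)] neg scaleC_ii_minus inner_add_left inner_add_right
        skew[OF X(1) f] by simp
  qed
  interpret um: unitary_symmetric_pair_module \<gg>C \<pp>minus pr \<sigma> \<qq> "complexify \<hh>\<^sub>0" \<ll>C
    ap am bp bm \<rho> conj_mat \<Psi>
  proof unfold_locales
    show "conj_mat A \<in> ap" if "A \<in> am" for A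
      using that conj_em a_p unfolding am_eq ap_eq by auto
    show "\<Psi> (f + f') = \<Psi> f + \<Psi> f'" if "f \<in> md.P" "f' \<in> md.P" for f f'
      using that by (rule \<Psi>_add)
    show "\<Psi> f = 0 \<longleftrightarrow> f \<in> md.R" if "f \<in> md.P" for f
      using that by (rule \<Psi>_zero_iff)
    show "inner (\<Psi> (letter A *s f)) (\<Psi> f') = - inner (\<Psi> f) (\<Psi> (letter (conj_mat A) *s f'))"
      if A: "A \<in> am" and f: "f \<in> md.P" "f' \<in> md.P" for A f f'
    proof -
      obtain X where X: "X \<in> \<aa>" "A = em X"
        using A unfolding am_eq by auto
      have g: "X \<in> \<gg>" "J X \<in> \<gg>"
        using X(1) a_p J_a p_g by auto
      show ?thesis
        unfolding X(2) em_def conj_cplx by (rule adjoint[OF g f])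
    qed
  qed
  show ?thesis
    unfolding um.lowest_eq_orbit_iff[OF assms] by (rule triple_brackets_iff)
qed

end

section \<open>From groups to Lie algebras\<close>

context matrix_involution
begin

lemma endo_on_d: "endo_on \<gg> d"
  unfolding endo_on_def by (simp add: d_mem differential_add differential_scaleR)

lemma fixed_Ad:
  assumes k: "k \<in> G" "\<sigma> k = k" and X: "X \<in> \<gg>" "d X = - X"
  shows "d (k ** X ** matrix_inv k) = - (k ** X ** matrix_inv k)"
proof (rule d_unique[OF lie_Ad(2)[OF k(1) X(1)]])
  fix t
  have inv: "\<sigma> (matrix_inv k) = matrix_inv k"
  proof (rule matrix_inv_unique[symmetric])
    show "k ** \<sigma> (matrix_inv k) = mat 1"
      using image_mult[OF k(1) inv_mem[OF k(1)]] by (simp add: inverse_mult k image_one)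
    show "\<sigma> (matrix_inv k) ** k = mat 1"
      using image_mult[OF inv_mem[OF k(1)] k(1)] by (simp add: inverse_mult k image_one)
  qed
  have "\<sigma> (mexp (t *\<^sub>R (k ** X ** matrix_inv k))) = k ** mexp (- t *\<^sub>R X) ** matrix_inv k"
    unfolding lie_Ad(1)[OF k(1) X(1)]
    by (simp add: image_mult mult_mem k inv_mem mexp_mem X image_mexp inv)
  also have "\<dots> = mexp (t *\<^sub>R - (k ** X ** matrix_inv k))"
    unfolding lie_Ad(1)[OF k(1) X(1), symmetric] by simp
  finally show "\<sigma> (mexp (t *\<^sub>R (k ** X ** matrix_inv k))) = mexp (t *\<^sub>R - (k ** X ** matrix_inv k))" .
qed

lemma subspace_minus_eigenspace: "subspace {X \<in> \<gg>. d X = - X}"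
  unfolding subspace_def
  using differential_scaleR[OF lie_zero, of 0]
  by (auto simp: lie_zero lie_add lie_scaleR differential_add differential_scaleR)

text \<open>The derivative at \<open>s = 0\<close> of the equivariance of \<open>J\<close> under \<open>Ad(exp(sZ))\<close>.\<close>

lemma invariant_structure_brk:
  assumes J: "invariant_complex_structure {X \<in> \<gg>. d X = - X} (fixed_points G \<sigma>) J"
    and Z: "Z \<in> \<gg>" "d Z = Z" and X: "X \<in> \<gg>" "d X = - X"
  shows "J (brk Z X) = brk Z (J X)"
proof -
  define V where "V = {X \<in> \<gg>. d X = - X}"
  have XV: "X \<in> V" and brkV: "brk Z X \<in> V"
    using X Z by (simp_all add: V_def lie_brk differential_brk brk_minus_right)
  have V: "subspace V" unfolding V_def by (rule subspace_minus_eigenspace)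
  have J_lin: "J (a *\<^sub>R A + b *\<^sub>R B) = a *\<^sub>R J A + b *\<^sub>R J B" if "A \<in> V" "B \<in> V" for a b A B
    using J that unfolding V_def[symmetric] invariant_complex_structure_def by blast
  have J_eq: "J (k ** A ** matrix_inv k) = k ** J A ** matrix_inv k" if "k \<in> fixed_points G \<sigma>" "A \<in> V" for k A
    using J that unfolding V_def[symmetric] invariant_complex_structure_def by blast
  obtain P where P: "linear P" "\<And>v. P v \<in> V" "\<And>v. v \<in> V \<Longrightarrow> P v = v"
    using linear_subspace_projection[OF V] by blast
  have "linear (\<lambda>v. J (P v))"
  proof (rule linearI)
    show "J (P (a + b)) = J (P a) + J (P b)" for a b
      using J_lin[OF P(2) P(2), of 1 a 1 b] by (simp add: linear_add[OF P(1)])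
    show "J (P (r *\<^sub>R a)) = r *\<^sub>R J (P a)" for r a
      using J_lin[OF P(2) P(2), of r a 0 a] by (simp add: linear_scale[OF P(1)])
  qed
  then have bl: "bounded_linear (\<lambda>v. J (P v))"
    by (simp add: linear_conv_bounded_linear)
  have fixed: "mexp (s *\<^sub>R Z) \<in> fixed_points G \<sigma>" for s
    using Z by (simp add: fixed_points_def mexp_mem image_mexp)
  have curve: "Ad_curve Z A s = mexp (s *\<^sub>R Z) ** A ** matrix_inv (mexp (s *\<^sub>R Z))" for A s
    by (simp add: Ad_curve_def matrix_inv_mexp)
  have curve_V: "Ad_curve Z X s \<in> V" for s
    unfolding curve V_def using fixed[of s] fixed_Ad[OF _ _ X] lie_Ad(2)[OF _ X(1)]
    by (simp add: fixed_points_def)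
  have "((\<lambda>s. J (P (Ad_curve Z X s))) has_vector_derivative J (P (brk Z X))) (at 0)"
    by (rule bounded_linear.has_vector_derivative[OF bl Ad_curve_derivative])
  moreover have "J (P (Ad_curve Z X s)) = Ad_curve Z (J X) s" for s
    unfolding P(3)[OF curve_V] unfolding curve by (rule J_eq[OF fixed XV])
  ultimately have "(Ad_curve Z (J X) has_vector_derivative J (brk Z X)) (at 0)"
    using P(3)[OF brkV] by simp
  then show ?thesis
    by (rule vector_derivative_unique_at) (rule Ad_curve_derivative)
qed

end

theorem proposition4p11:
  fixes G K H H\<^sub>0 L :: "(real^'n^'n) set"
    and \<theta> \<iota> J :: "real^'n^'n \<Rightarrow> real^'n^'n"
    and \<tau> :: "real^'n^'n \<Rightarrow> complex^'m^'m"
    and \<pi> :: "real^'n^'n \<Rightarrow> 'h::complex_hilbert \<Rightarrow> 'h"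
    and \<pp> :: "(real^'n^'n) set"
    and \<gg>\<^sub>C \<hh>\<^sub>C \<hh>\<^sub>0\<^sub>C \<pp>p \<pp>m \<pp>\<hh>p \<pp>\<hh>m \<pp>\<hh>\<^sub>0p \<qq> :: "(complex^'n^'n) set"
    and \<rho> :: "complex^'n^'n \<Rightarrow> complex^'m^'m"
    and Lc UW V1 :: "('n, 'm) pretensor set set"
  assumes group: "matrix_lie_group G" "connected G" "simple_lie_algebra (lie_algebra G)" "\<not> compact G"
    and maximal_compact: "maximal_compact_subgroup K G"
    and cartan: "cartan_involution G \<theta>" "K = fixed_points G \<theta>"
    and p_def: "\<pp> = cartan_p G \<theta>"
    and complex_structure: "invariant_complex_structure \<pp> K J"
    and iota: "involutive_automorphism G \<iota>" "\<forall>g\<in>G. \<iota> (\<theta> g) = \<theta> (\<iota> g)"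
      "\<exists>g\<in>G. \<iota> g \<noteq> g" "\<exists>g\<in>G. \<iota> g \<noteq> \<theta> g"
    and H_def: "H = identity_component (fixed_points G \<iota>)"
    and H0_def: "H\<^sub>0 = identity_component (fixed_points G (\<iota> \<circ> \<theta>))"
    and L_def: "L = K \<inter> H"
    and holomorphic: "holomorphic_immersion \<pp> (lie_algebra H) L J"
    and complexifications: "\<gg>\<^sub>C = complexify (lie_algebra G)"
      "\<hh>\<^sub>C = complexify (lie_algebra H)" "\<hh>\<^sub>0\<^sub>C = complexify (lie_algebra H\<^sub>0)"
    and p_pm: "\<pp>p = p_plus \<pp> J" "\<pp>m = p_minus \<pp> J"
      "\<pp>\<hh>p = \<pp>p \<inter> \<hh>\<^sub>C" "\<pp>\<hh>m = \<pp>m \<inter> \<hh>\<^sub>C" "\<pp>\<hh>\<^sub>0p = \<pp>p \<inter> \<hh>\<^sub>0\<^sub>C"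
    and hds: "holomorphic_discrete_series G K \<pp>p \<tau> \<pi>"
    and inducing: "\<qq> = parabolic K \<pp>p" "\<rho> = extend_by_zero K \<pp>p \<tau>"
    and subspaces: "V1 = ind_layer \<gg>\<^sub>C \<qq> \<rho> \<pp>m 1"
      "UW = enveloping_orbit \<gg>\<^sub>C \<qq> \<rho> \<hh>\<^sub>0\<^sub>C"
      "Lc = annihilated_vectors \<gg>\<^sub>C \<qq> \<rho> \<pp>\<hh>p"
    and first_layer: "V1 \<inter> Lc = V1 \<inter> UW"
  shows "Lc = UW \<longleftrightarrow> brk_space (brk_space \<pp>\<hh>\<^sub>0p \<pp>\<hh>m) \<pp>\<hh>\<^sub>0p = {0}"
proof -
  interpret ci: commuting_involutions G \<theta> \<iota>
    by unfold_locales (use group cartan iota in \<open>auto simp: cartan_involution_def\<close>)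
  define \<gg> where "\<gg> = lie_algebra G"
  define d\<theta> d\<iota> where "d\<theta> = differential \<theta>" and "d\<iota> = differential \<iota>"
  have p: "\<pp> = {X \<in> \<gg>. d\<theta> X = - X}"
    by (simp add: p_def cartan_p_def \<gg>_def d\<theta>_def)
  have k: "lie_algebra K = {X \<in> \<gg>. d\<theta> X = X}"
    unfolding cartan(2) \<gg>_def d\<theta>_def by (rule ci.\<theta>.lie_algebra_fixed_points)
  have h: "lie_algebra H = {X \<in> \<gg>. d\<iota> X = X}"
    unfolding H_def lie_algebra_identity_component \<gg>_def d\<iota>_def by (rule ci.\<iota>.lie_algebra_fixed_points)
  have h0: "lie_algebra H\<^sub>0 = {X \<in> \<gg>. d\<iota> (d\<theta> X) = X}"
    unfolding H0_def lie_algebra_identity_component \<gg>_def d\<iota>_def d\<theta>_def ci.comp.lie_algebra_fixed_points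
    using ci.d_comp by auto
  have K: "matrix_subgroup K" "compact K" "K \<subseteq> G"
    using maximal_compact unfolding maximal_compact_subgroup_def by auto
  have \<tau>: "K_type K \<tau>"
    using hds unfolding holomorphic_discrete_series_def by blast
  interpret kt: matrix_hom K \<tau>
    by unfold_locales (use \<tau> compact_matrix_subgroup[OF K(1,2)] in \<open>auto simp: K_type_def\<close>)
  \<comment> \<open>the conditions on \<open>G\<close>, \<open>\<theta>\<close>, \<open>J\<close> and \<open>\<iota>\<close> in terms of Lie algebras\<close>
  interpret cp: cartan_pair \<gg> d\<theta>
  proof unfold_locales
    show "subspace \<gg>"
      unfolding \<gg>_def by (rule ci.\<theta>.lie_subspace)
    show "brk X Y \<in> \<gg>" if "X \<in> \<gg>" "Y \<in> \<gg>" for X Y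
      using that unfolding \<gg>_def by (rule ci.\<theta>.lie_brk)
    show "simple_lie_algebra \<gg>"
      using group(3) by (simp add: \<gg>_def)
    show "endo_on \<gg> d\<theta>"
      unfolding \<gg>_def d\<theta>_def by (rule ci.\<theta>.endo_on_d)
    show "d\<theta> (brk X Y) = brk (d\<theta> X) (d\<theta> Y)" if "X \<in> \<gg>" "Y \<in> \<gg>" for X Y
      using that unfolding \<gg>_def d\<theta>_def by (rule ci.\<theta>.differential_brk)
    show "d\<theta> (d\<theta> X) = X" if "X \<in> \<gg>" for X
      using that unfolding \<gg>_def d\<theta>_def by (rule ci.\<theta>.d_d)
    show "- killing_form \<gg> X (d\<theta> X) > 0" if "X \<in> \<gg>" "X \<noteq> 0" for X
      using that cartan(1) unfolding \<gg>_def d\<theta>_def cartan_involution_def by blast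
  qed
  have p_eq: "cp.\<pp> = \<pp>" and k_eq: "cp.\<kk> = lie_algebra K"
    unfolding cp.\<pp>_def cp.\<kk>_def p k by (rule refl)+
  have J: "invariant_complex_structure {X \<in> lie_algebra G. differential \<theta> X = - X} (fixed_points G \<theta>) J"
    using complex_structure unfolding cartan(2) p \<gg>_def d\<theta>_def .
  interpret hp: hermitian_symmetric_pair \<gg> d\<theta> J d\<iota> "differential \<tau>"
  proof (unfold_locales, unfold p_eq k_eq)
    show "J X \<in> \<pp>" "J (J X) = - X" if "X \<in> \<pp>" for X
      using complex_structure that unfolding invariant_complex_structure_def by blast+
    show "J (a *\<^sub>R X + b *\<^sub>R Y) = a *\<^sub>R J X + b *\<^sub>R J Y" if "X \<in> \<pp>" "Y \<in> \<pp>" for X Y a b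
      using complex_structure that unfolding invariant_complex_structure_def by blast
    show "J (brk Z X) = brk Z (J X)" if "Z \<in> lie_algebra K" "X \<in> \<pp>" for Z X
      by (rule ci.\<theta>.invariant_structure_brk[OF J]) (use that in \<open>simp_all add: k p \<gg>_def d\<theta>_def\<close>)
    show "endo_on \<gg> d\<iota>"
      unfolding \<gg>_def d\<iota>_def by (rule ci.\<iota>.endo_on_d)
    show "d\<iota> (brk X Y) = brk (d\<iota> X) (d\<iota> Y)" if "X \<in> \<gg>" "Y \<in> \<gg>" for X Y
      using that unfolding \<gg>_def d\<iota>_def by (rule ci.\<iota>.differential_brk)
    show "d\<iota> (d\<iota> X) = X" if "X \<in> \<gg>" for X
      using that unfolding \<gg>_def d\<iota>_def by (rule ci.\<iota>.d_d)
    show "d\<iota> (d\<theta> X) = d\<theta> (d\<iota> X)" if "X \<in> \<gg>" for X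
      using that unfolding \<gg>_def d\<theta>_def d\<iota>_def by (rule ci.d_commute)
    show "d\<iota> (J X) = J X" if "X \<in> \<pp>" "d\<iota> X = X" for X
    proof -
      have X: "X \<in> \<pp> \<inter> lie_algebra H"
        using that by (simp add: h p)
      have "J X \<in> \<pp> \<inter> lie_algebra H"
        using holomorphic X unfolding holomorphic_immersion_def invariant_complex_structure_def by metis
      then show ?thesis by (simp add: h)
    qed
    show "differential \<tau> (X + Y) = differential \<tau> X + differential \<tau> Y"
      if "X \<in> lie_algebra K" "Y \<in> lie_algebra K" for X Y
      using that by (rule kt.differential_add)
    show "differential \<tau> (c *\<^sub>R X) = c *\<^sub>R differential \<tau> X" if "X \<in> lie_algebra K" for X c
      using that by (rule kt.differential_scaleR)
    show "differential \<tau> (brk X Y) = brk (differential \<tau> X) (differential \<tau> Y)"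
      if "X \<in> lie_algebra K" "Y \<in> lie_algebra K" for X Y
      using that by (rule kt.differential_brk)
  qed
  \<comment> \<open>the complex subspaces and the inducing representation are those of the Lie algebra setting\<close>
  have gC: "\<gg>\<^sub>C = hp.\<gg>C"
    unfolding complexifications(1) hp.\<gg>C_def unfolding \<gg>_def ..
  have pC: "\<pp>p = hp.\<pp>plus" "\<pp>m = hp.\<pp>minus"
    by (simp_all add: p_pm hp.\<pp>plus_def hp.\<pp>minus_def p_eq)
  have hC: "\<hh>\<^sub>C = complexify hp.\<hh>" "\<hh>\<^sub>0\<^sub>C = complexify hp.\<hh>\<^sub>0"
    by (simp_all add: complexifications h h0 hp.\<hh>_def hp.\<hh>\<^sub>0_def)
  have ab: "\<pp>\<hh>p = hp.ap" "\<pp>\<hh>m = hp.am" "\<pp>\<hh>\<^sub>0p = hp.bp"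
    by (simp_all add: p_pm(3-5) pC hC hp.ap_def hp.am_def hp.bp_def)
  have q: "\<qq> = hp.\<qq>"
    by (simp add: inducing parabolic_def hp.\<qq>_def k_eq pC)
  have rho: "\<rho> = hp.\<rho>"
    by (rule ext) (simp add: inducing extend_by_zero_def hp.\<rho>_def k_eq pC)
  have \<pi>: "unitary_representation G \<pi>"
    using hds unfolding holomorphic_discrete_series_def discrete_series_def by blast
  obtain \<Phi> where bij: "bij_betw \<Phi> (ind_module hp.\<gg>C hp.\<qq> hp.\<rho>) (K_finite_vectors K \<pi>)"
    and \<Phi>_add: "\<And>u v. u \<in> ind_module hp.\<gg>C hp.\<qq> hp.\<rho> \<Longrightarrow> v \<in> ind_module hp.\<gg>C hp.\<qq> hp.\<rho> \<Longrightarrow>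
        \<Phi> (ind_add hp.\<gg>C hp.\<qq> hp.\<rho> u v) = \<Phi> u + \<Phi> v"
    and \<Phi>_scale: "\<And>c v. v \<in> ind_module hp.\<gg>C hp.\<qq> hp.\<rho> \<Longrightarrow>
        \<Phi> (ind_act hp.\<gg>C hp.\<qq> hp.\<rho> (scalar c) v) = c *\<^sub>C \<Phi> v"
    and \<Phi>_deriv: "\<And>X v. X \<in> lie_algebra G \<Longrightarrow> v \<in> ind_module hp.\<gg>C hp.\<qq> hp.\<rho> \<Longrightarrow>
        ((\<lambda>t. \<pi> (mexp (t *\<^sub>R X)) (\<Phi> v)) has_vector_derivative
          \<Phi> (ind_act hp.\<gg>C hp.\<qq> hp.\<rho> (letter (of_real_mat X)) v)) (at 0)"
    using hds unfolding holomorphic_discrete_series_def Let_def complexifications(1)[symmetric] gC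
      inducing[symmetric] q rho by blast
  interpret up: unitary_hermitian_pair \<gg> d\<theta> J d\<iota> "differential \<tau>" \<Phi>
  proof unfold_locales
    show "inj_on \<Phi> (ind_module hp.\<gg>C hp.\<qq> hp.\<rho>)"
      using bij by (rule bij_betw_imp_inj_on)
  next
    fix X u v
    assume X: "X \<in> \<gg>" and u: "u \<in> ind_module hp.\<gg>C hp.\<qq> hp.\<rho>" and v: "v \<in> ind_module hp.\<gg>C hp.\<qq> hp.\<rho>"
    have XG: "X \<in> lie_algebra G" using X by (simp add: \<gg>_def)
    show "inner (\<Phi> (ind_act hp.\<gg>C hp.\<qq> hp.\<rho> (letter (of_real_mat X)) u)) (\<Phi> v) =
        - inner (\<Phi> u) (\<Phi> (ind_act hp.\<gg>C hp.\<qq> hp.\<rho> (letter (of_real_mat X)) v))"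
      by (rule unitary_derivative_skew[OF \<pi> XG \<Phi>_deriv[OF XG u] \<Phi>_deriv[OF XG v]])
  qed (rule \<Phi>_add \<Phi>_scale; assumption)+
  show ?thesis
    using up.lowest_vectors_eq_orbit_iff first_layer unfolding subspaces gC q rho pC hC ab by blast
qed

end
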